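(* Let $\{(G_t,Y_t)\}_{t\ge 0}$ be a DED process with period $K$, parameter set $\Theta\subseteq\mathbb R^d$, event probabilities $p_t(\theta)=1-\exp(-\lambda_t(\theta))$ with $\lambda_t=\lambda_{t\bmod K}$, and limiting gating frequencies $\gamma(\theta)$. Let $\theta_0\in\operatorname{int}(\Theta)$, and assume: (1) there are constants $0<\lambda_{\min}\le\lambda_{\max}<\infty$ with $\lambda_{\min}\le\lambda_r(\theta)\le\lambda_{\max}$ for all $r=0,\dots,K-1$ and $\theta\in\Theta$; (2) for each $r=0,\dots,K-1$, $\lambda_r:\Theta\to\mathbb R$ extends to a $C^3$ map on an open set containing $\Theta$; (3) if $\theta\in\Theta$ satisfies $\lambda_r(\theta)=\lambda_r(\theta_0)$ for all $r$ with $\gamma_r(\theta_0)>0$, then $\theta=\theta_0$; (4) $\Theta$ is compact; (5) the matrix $\mathcal I_0=\mathcal I(\theta_0;\gamma(\theta_0))$ is positive definite. Let $W:\mathbb R^d\to[0,\infty)$ be bowl-shaped. Then for every sequence of estimators $(\hat\theta_T)$ ($\hat\theta_T$ a function of $X_{0:T-1}$), $$\lim_{b\to\infty}\lim_{c\to\infty}\liminf_{T\to\infty}\ \sup_{\|\theta-\theta_0\|_2\le c/\sqrt T}\mathbb E_\theta\Bigl[b\wedge W\bigl(\sqrt T(\hat\theta_T-\theta)\bigr)\Bigr]\ \ge\ \mathbb E[W(Z)],\qquad Z\sim\mathcal N(0,\mathcal I_0^{-1}).$$ In particular, $$\lim_{b\to\infty}\lim_{c\to\infty}\liminf_{T\to\infty}\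 \sup_{\|\theta-\theta_0\|_2\le c/\sqrt T}\mathbb E_\theta\Bigl[b\wedge\bigl\|\sqrt T(\hat\theta_T-\theta)\bigr\|_2^2\Bigr]\ \ge\ \operatorname{tr}(\mathcal I_0^{-1}).$$
   Context: $\mathbb N=\{0,1,2,\dots\}$, and $x\wedge y=\min\{x,y\}$. Fix an integer $K\ge 1$ (period), an integer $D\in\mathbb N$ (dead time), and a parameter set $\Theta\subseteq\mathbb R^d$. For each $\theta\in\Theta$ let $p_t(\theta)\in[0,1]$, $t\in\mathbb N$, with $p_{t+K}(\theta)=p_t(\theta)$, written $p_t(\theta)=1-\exp(-\lambda_t(\theta))$. A DED (dead-time event detection) process is a stochastic process $\{(G_t,Y_t)\}_{t\ge0}$ with $G_t,Y_t\in\{0,1\}$, whose law under parameter $\theta$ is denoted $P_\theta$, such that: (i) (observation) under $P_\theta$ there are independent $Z_t\sim\mathrm{Ber}(p_t(\theta))$, $t\in\mathbb N$, with $Y_t=G_tZ_t$; (ii) (dead time) almost surely, $Y_t=1$ implies $G_s=0$ for all $s\in\{t+1,\dots,t+D\}$; (iii) (causality) for every $t$ there are $U_t\sim\mathrm{Unif}([0,1])$, jointly independent of the event sequence $\{Z_s\}_{s\ge0}$ and the past observations $\{(G_s,Y_s)\}_{s=0}^{t-1}$, and a measurable map $\Phi_t:\{0,1\}^{2t}\times[0,1]\to\{0,1\}$, not depending on $\theta$, such that $G_t=\Phi_t(G_0,Y_0,\dots,G_{t-1},Y_{t-1},U_t)$ a.s.; (iv) (gating-frequency convergence) for every $\theta\in\Theta$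 there is $\gamma(\theta)\in[0,1]^K$ such that for each $r=0,\dots,K-1$, $\frac1L\sum_{\ell=0}^{L-1}G_{r+\ell K}\to\gamma_r(\theta)$ in $P_\theta$-probability as $L\to\infty$. $P_{\theta,T}$ denotes the law of $X_{0:T-1}=((G_0,Y_0),\dots,(G_{T-1},Y_{T-1}))$ under $\theta$; $\mathbb E_\theta$ is expectation under $P_{\theta,T}$. Since $\theta_0$ is interior, the ball $\|\theta-\theta_0\|_2\le c/\sqrt T$ lies in $\Theta$ for all large $T$. Fisher information: for $r=0,\dots,K-1$, $\mathcal I_r(\theta)=\frac{1-p_r(\theta)}{p_r(\theta)}\nabla\lambda_r(\theta)\nabla\lambda_r(\theta)^\top$; for $\alpha\in[0,1]^K$, $\mathcal I(\theta;\alpha)=\frac1K\sum_{r=0}^{K-1}\alpha_r\mathcal I_r(\theta)$. A function $W:\mathbb R^d\to[0,\infty)$ is bowl-shaped if for every $a\ge0$ the sublevel set $\{u\in\mathbb R^d:W(u)\le a\}$ is closed, convex and symmetric about the origin. *)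

theory Defs
  imports "HOL-Probability.Probability"
begin

section \<open>Dead-time event detection processes\<close>

definition trajectory :: "(nat \<Rightarrow> 'w \<Rightarrow> bool) \<Rightarrow> (nat \<Rightarrow> 'w \<Rightarrow> bool) \<Rightarrow> nat \<Rightarrow> 'w \<Rightarrow> (bool \<times> bool) list"
  where "trajectory G Y t \<omega> = map (\<lambda>s. (G s \<omega>, Y s \<omega>)) [0..<t]"

abbreviation trajectory_space :: "nat \<Rightarrow> (bool \<times> bool) list measure"
  where "trajectory_space t \<equiv> count_space {x. length x = t}"

definition obs_law ::
    "'w measure \<Rightarrow> (nat \<Rightarrow> 'w \<Rightarrow> bool) \<Rightarrow> (nat \<Rightarrow> 'w \<Rightarrow> bool) \<Rightarrow> nat \<Rightarrow> (bool \<times> bool) list measure"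
  where "obs_law M G Y T = distr M (trajectory_space T) (trajectory G Y T)"

text \<open>
  Independence of two random variables with different codomain types; the library's
  \<open>indep_var\<close> forces both to have the same type. The formula is that of \<open>indep_var_eq\<close>.
\<close>

definition indep_rvs ::
    "'w measure \<Rightarrow> 'a measure \<Rightarrow> ('w \<Rightarrow> 'a) \<Rightarrow> 'b measure \<Rightarrow> ('w \<Rightarrow> 'b) \<Rightarrow> bool"
  where "indep_rvs M S X T Y \<longleftrightarrow>
    X \<in> measurable M S \<and> Y \<in> measurable M T \<and>
    prob_space.indep_set M
      (sigma_sets (space M) {X -` A \<inter> space M | A. A \<in> sets S})
      (sigma_sets (space M) {Y -` A \<inter> space M | A. A \<in> sets T})"

definition tendsto_in_prob :: "'w measure \<Rightarrow> (nat \<Rightarrow> 'w \<Rightarrow> real) \<Rightarrow> real \<Rightarrow> bool"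
  where "tendsto_in_prob M X a \<longleftrightarrow>
    (\<forall>\<epsilon>>0. (\<lambda>n. measure M {\<omega> \<in> space M. \<bar>X n \<omega> - a\<bar> > \<epsilon>}) \<longlonglongrightarrow> 0)"

text \<open>
  Observation, dead time and causality under a single law \<open>M\<close>, with event probabilities \<open>q\<close>
  and gating maps \<open>\<Phi>\<close>. The values 0 and 1 are encoded as \<open>bool\<close>, so the product
  \<open>G\<^sub>t Z\<^sub>t\<close> is a conjunction. The gating noise \<open>U\<close> at time \<open>t\<close> is independent of the pair formed by
  the whole sequence \<open>Z\<close> and the past \<open>(G, Y)\<close> observations; those two components are of course
  not independent of each other.
\<close>

definition ded_law ::
    "nat \<Rightarrow> (nat \<Rightarrow> real) \<Rightarrow> (nat \<Rightarrow> (bool \<times> bool) list \<Rightarrow> real \<Rightarrow> bool) \<Rightarrow>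
     'w measure \<Rightarrow> (nat \<Rightarrow> 'w \<Rightarrow> bool) \<Rightarrow> (nat \<Rightarrow> 'w \<Rightarrow> bool) \<Rightarrow> bool"
  where "ded_law D q \<Phi> M G Y \<longleftrightarrow>
    prob_space M \<and>
    (\<forall>t. G t \<in> measurable M (count_space UNIV) \<and> Y t \<in> measurable M (count_space UNIV)) \<and>
    (AE \<omega> in M. \<forall>t. Y t \<omega> \<longrightarrow> (\<forall>s\<in>{t+1..t+D}. \<not> G s \<omega>)) \<and>
    (\<exists>Z :: nat \<Rightarrow> 'w \<Rightarrow> bool.
      prob_space.indep_vars M (\<lambda>_. count_space UNIV) Z UNIV \<and>
      (\<forall>t. distr M (count_space UNIV) (Z t) = measure_pmf (bernoulli_pmf (q t))) \<and>
      (\<forall>t. AE \<omega> in M. Y t \<omega> \<longleftrightarrow> G t \<omega> \<and> Z t \<omega>) \<and>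
      (\<forall>t. \<exists>U :: 'w \<Rightarrow> real.
        U \<in> borel_measurable M \<and>
        distr M borel U = uniform_measure lborel {0..1} \<and>
        indep_rvs M borel U
          ((\<Pi>\<^sub>M s\<in>UNIV. count_space UNIV) \<Otimes>\<^sub>M trajectory_space t)
          (\<lambda>\<omega>. ((\<lambda>s. Z s \<omega>), trajectory G Y t \<omega>)) \<and>
        (AE \<omega> in M. G t \<omega> \<longleftrightarrow> \<Phi> t (trajectory G Y t \<omega>) (U \<omega>))))"

text \<open>
  The gating maps \<open>\<Phi>\<close> are chosen before \<open>\<theta>\<close>, so they do not depend on it, whereas the auxiliary
  variables \<open>Z\<close> and \<open>U\<close> may differ from one law \<open>P \<theta>\<close> to another.
\<close>

definition DED_process ::
    "nat \<Rightarrow> nat \<Rightarrow> (real^'d) set \<Rightarrow> (nat \<Rightarrow> real^'d \<Rightarrow> real) \<Rightarrow> (real^'d \<Rightarrow> nat \<Rightarrow> real) \<Rightarrow>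
     (real^'d \<Rightarrow> 'w measure) \<Rightarrow> (nat \<Rightarrow> 'w \<Rightarrow> bool) \<Rightarrow> (nat \<Rightarrow> 'w \<Rightarrow> bool) \<Rightarrow> bool"
  where "DED_process K D \<Theta> p \<gamma> P G Y \<longleftrightarrow>
    K \<ge> 1 \<and>
    (\<forall>\<theta>\<in>\<Theta>. \<forall>t. 0 \<le> p t \<theta> \<and> p t \<theta> \<le> 1 \<and> p (t + K) \<theta> = p t \<theta>) \<and>
    (\<exists>\<Phi>. (\<forall>t. (\<lambda>(x, u). \<Phi> t x u)
              \<in> measurable (trajectory_space t \<Otimes>\<^sub>M restrict_space borel {0..1}) (count_space UNIV)) \<and>
          (\<forall>\<theta>\<in>\<Theta>. ded_law D (\<lambda>t. p t \<theta>) \<Phi> (P \<theta>) G Y)) \<and>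
    (\<forall>\<theta>\<in>\<Theta>. \<forall>r<K. 0 \<le> \<gamma> \<theta> r \<and> \<gamma> \<theta> r \<le> 1 \<and>
       tendsto_in_prob (P \<theta>) (\<lambda>L \<omega>. (1 / real L) * (\<Sum>l<L. of_bool (G (r + l * K) \<omega>))) (\<gamma> \<theta> r))"

definition event_prob :: "(nat \<Rightarrow> real^'d \<Rightarrow> real) \<Rightarrow> nat \<Rightarrow> real^'d \<Rightarrow> real"
  where "event_prob lam t \<theta> = 1 - exp (- lam t \<theta>)"

section \<open>Smoothness and Fisher information\<close>

text \<open>
  \<open>k\<close>-fold continuous differentiability on an open set: all iterated directional derivatives
  up to order \<open>k\<close> exist and are continuous.
\<close>

fun Ck_on :: "nat \<Rightarrow> (real^'d \<Rightarrow> real) \<Rightarrow> (real^'d) set \<Rightarrow> bool" where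
  "Ck_on 0 f S \<longleftrightarrow> continuous_on S f"
| "Ck_on (Suc k) f S \<longleftrightarrow>
    (\<forall>x\<in>S. f differentiable (at x)) \<and> (\<forall>v. Ck_on k (\<lambda>x. frechet_derivative f (at x) v) S)"

definition grad :: "(real^'d \<Rightarrow> real) \<Rightarrow> real^'d \<Rightarrow> real^'d"
  where "grad f x = (THE g. GDERIV f x :> g)"

definition outer :: "real^'d \<Rightarrow> real^'d^'d"
  where "outer v = (\<chi> i j. v $ i * v $ j)"

definition fisher_phase :: "(nat \<Rightarrow> real^'d \<Rightarrow> real) \<Rightarrow> nat \<Rightarrow> real^'d \<Rightarrow> real^'d^'d"
  where "fisher_phase lam r \<theta> =
    ((1 - event_prob lam r \<theta>) / event_prob lam r \<theta>) *\<^sub>R outer (grad (lam r) \<theta>)"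

definition fisher :: "nat \<Rightarrow> (nat \<Rightarrow> real^'d \<Rightarrow> real) \<Rightarrow> real^'d \<Rightarrow> (nat \<Rightarrow> real) \<Rightarrow> real^'d^'d"
  where "fisher K lam \<theta> \<alpha> = (1 / real K) *\<^sub>R (\<Sum>r<K. \<alpha> r *\<^sub>R fisher_phase lam r \<theta>)"

definition pos_def_matrix :: "real^'d^'d \<Rightarrow> bool"
  where "pos_def_matrix A \<longleftrightarrow> transpose A = A \<and> (\<forall>v. v \<noteq> 0 \<longrightarrow> v \<bullet> (A *v v) > 0)"

section \<open>Losses, Gaussian law and local risk\<close>

definition bowl_shaped :: "(real^'d \<Rightarrow> real) \<Rightarrow> bool"
  where "bowl_shaped W \<longleftrightarrow>
    (\<forall>u. 0 \<le> W u) \<and>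
    (\<forall>a\<ge>0. closed {u. W u \<le> a} \<and> convex {u. W u \<le> a} \<and> (\<forall>u. W u \<le> a \<longrightarrow> W (- u) \<le> a))"

text \<open>Centred Gaussian law with positive definite covariance matrix \<open>S\<close>.\<close>

definition gaussian :: "real^'d^'d \<Rightarrow> (real^'d) measure"
  where "gaussian S = density lborel (\<lambda>x. ennreal
    (exp (- (x \<bullet> (matrix_inv S *v x)) / 2) / sqrt ((2 * pi) ^ CARD('d) * det S)))"

text \<open>
  The supremum is taken over the part of the ball inside \<open>\<Theta>\<close>, where the laws \<open>P \<theta>\<close> are meaningful;
  for an interior point \<open>\<theta>0\<close> this is the whole ball as soon as \<open>T\<close> is large. Values are in
  \<open>ennreal\<close>, so that expectations and suprema need no integrability or boundedness side condition.
\<close>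

definition local_max_risk ::
    "(real^'d) set \<Rightarrow> (real^'d \<Rightarrow> 'w measure) \<Rightarrow> (nat \<Rightarrow> 'w \<Rightarrow> bool) \<Rightarrow> (nat \<Rightarrow> 'w \<Rightarrow> bool) \<Rightarrow>
     real^'d \<Rightarrow> (nat \<Rightarrow> (bool \<times> bool) list \<Rightarrow> real^'d) \<Rightarrow> (real^'d \<Rightarrow> real) \<Rightarrow>
     real \<Rightarrow> real \<Rightarrow> nat \<Rightarrow> ennreal"
  where "local_max_risk \<Theta> P G Y \<theta>0 est W b c T =
    (SUP \<theta> \<in> {\<theta> \<in> \<Theta>. norm (\<theta> - \<theta>0) \<le> c / sqrt (real T)}.
       \<integral>\<^sup>+ x. ennreal (min b (W (sqrt (real T) *\<^sub>R (est T x - \<theta>)))) \<partial>obs_law (P \<theta>) G Y T)"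

end

(* Locally around \<theta>0 the log-likelihood ratio at \<theta>0 + h / sqrt T is h \<bullet> \<Delta> - h \<bullet> J h / 2 + o(1) in
   probability: given the gating, it is a linear combination of the martingales (events minus their
   compensators, per phase) and of the gating counts, whose frequencies converge. Only bounded second
   moments of \<Delta> are used, no central limit theorem: against a Gaussian prior the posterior under the
   quadratic approximation is exactly Gaussian, and Anderson's inequality (from Prekopa-Leindler) bounds
   its Bayes risk below by the risk at its centre, uniformly in \<Delta>. A bounded second moment of the
   likelihood ratio replaces contiguity. Letting T, the ball radius and then the prior variance tend to
   infinity gives the bound. *)

theory Submission
  imports Defs "HOL-Real_Asymp.Real_Asymp"
begin

section \<open>Prekopa-Leindler and Anderson inequalities\<close>

text \<open>The gating maps are arbitrary functions of the past, so the terms of the score are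
  neither independent nor mixing. Since one family of maps serves every parameter, its factors
  cancel in each likelihood ratio, which then sees the data only through counts of open gates and of
  events per phase. The remainder of the quadratic approximation is small for each fixed h, not
  uniformly in h. Integration over h is therefore carried out on
  \<open>norm (\<Delta> T x) \<le> M\<close>, where the approximate posterior weight stays below the
  integrable envelope \<open>exp (M * norm h - \<kappa> * (h \<bullet> h) / 2)\<close>. Dominated
  convergence then removes the large remainders and the part outside the ball, while Fatou's lemma
  with M tending to infinity restores the mass lost by truncating the score. The prior precision
  \<kappa> stays positive until the end because a flat prior would have infinite mass.\<close>

text \<open>Brunn-Minkowski on the line. Averaging all of A with the least point b of B, and all of
  B with the greatest point a of A, gives two half-size copies inside C. The first lies to the left
  of (a + b) / 2 and the second to the right, so they share at most that point, a null set.\<close>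

lemma emeasure_midpoint_compact:
  fixes A B C :: "real set"
  assumes "compact A" "A \<noteq> {}" "compact B" "B \<noteq> {}" and C: "C \<in> sets borel"
    and mid: "\<And>x y. x \<in> A \<Longrightarrow> y \<in> B \<Longrightarrow> (x + y) / 2 \<in> C"
  shows "emeasure lborel A + emeasure lborel B \<le> 2 * emeasure lborel C"
proof -
  obtain a where a: "a \<in> A" "\<And>x. x \<in> A \<Longrightarrow> x \<le> a"
    using compact_attains_sup[OF assms(1,2)] by blast
  obtain b where b: "b \<in> B" "\<And>x. x \<in> B \<Longrightarrow> b \<le> x"
    using compact_attains_inf[OF assms(3,4)] by blast
  define A' where "A' = (\<lambda>x. (1/2) *\<^sub>R x + b/2) ` A"
  define B' where "B' = (\<lambda>x. (1/2) *\<^sub>R x + a/2) ` B"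
  have A'_eq: "A' = (\<lambda>x. (x + b) / 2) ` A"
    unfolding A'_def by (intro image_cong) (simp_all add: field_simps)
  have B'_eq: "B' = (\<lambda>y. (a + y) / 2) ` B"
    unfolding B'_def by (intro image_cong) (simp_all add: field_simps)
  have cA: "compact A'" "compact B'"
    unfolding A'_def B'_def by (intro compact_continuous_image continuous_intros assms)+
  have sets: "A' \<in> sets borel" "B' \<in> sets borel" "A \<in> sets borel" "B \<in> sets borel"
    using cA assms by (auto intro: borel_compact)
  have half: "2 * ennreal (1/2) = 1"
  proof -
    have "2 * ennreal (1/2) = ennreal 2 * ennreal (1/2)" by simp
    also have "\<dots> = ennreal (2 * (1/2))" by (rule ennreal_mult[symmetric]) auto
    finally show ?thesis by simp
  qed
  have eA: "emeasure lborel A = 2 * emeasure lborel A'"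
  proof -
    have "emeasure lborel A' = ennreal (1/2) * emeasure lborel A"
      using emeasure_lebesgue_affine[of "1/2" "b/2" A] sets by (simp add: A'_def)
    then have "2 * emeasure lborel A' = (2 * ennreal (1/2)) * emeasure lborel A"
      by (simp add: mult.assoc)
    also have "2 * ennreal (1/2) = 1"
      by (rule half)
    finally show ?thesis by simp
  qed
  have eB: "emeasure lborel B = 2 * emeasure lborel B'"
  proof -
    have "emeasure lborel B' = ennreal (1/2) * emeasure lborel B"
      using emeasure_lebesgue_affine[of "1/2" "a/2" B] sets by (simp add: B'_def)
    then have "2 * emeasure lborel B' = (2 * ennreal (1/2)) * emeasure lborel B"
      by (simp add: mult.assoc)
    also have "2 * ennreal (1/2) = 1"
      by (rule half)
    finally show ?thesis by simp
  qed
  have sub: "A' \<union> B' \<subseteq> C"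
  proof
    fix z assume "z \<in> A' \<union> B'"
    then consider x where "x \<in> A" "z = (x + b) / 2" | y where "y \<in> B" "z = (a + y) / 2"
      unfolding A'_eq B'_eq by blast
    then show "z \<in> C" by cases (simp_all only: mid a(1) b(1))
  qed
  have int: "A' \<inter> B' \<subseteq> {(a+b)/2}"
  proof
    fix z assume "z \<in> A' \<inter> B'"
    then obtain x y where "x \<in> A" "z = (x + b)/2" "y \<in> B" "z = (a + y)/2"
      unfolding A'_eq B'_eq by blast
    with a(2)[of x] b(2)[of y] show "z \<in> {(a+b)/2}" by auto
  qed
  have "emeasure lborel A' + emeasure lborel B' = emeasure lborel A' + emeasure lborel (B' - {(a+b)/2})"
  proof -
    have "emeasure lborel (B' - {(a+b)/2}) = emeasure lborel B'"
      by (intro emeasure_Diff_null_set) (use sets in auto)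
    then show ?thesis by simp
  qed
  also have "\<dots> = emeasure lborel (A' \<union> (B' - {(a+b)/2}))"
    using int sets by (intro plus_emeasure) auto
  also have "\<dots> \<le> emeasure lborel C"
    using sub C by (intro emeasure_mono) auto
  finally have "2 * (emeasure lborel A' + emeasure lborel B') \<le> 2 * emeasure lborel C"
    by (rule mult_left_mono) simp
  then show ?thesis
    unfolding eA eB distrib_left .
qed

text \<open>Inner regularity in a form that covers sets of infinite measure: hence a sequence of
  compact sets rather than a single one. The point a is put into every \<open>K n\<close> because
  the compact case needs nonempty sets.\<close>

lemma lborel_compact_exhaustion:
  fixes A :: "'a::euclidean_space set"
  assumes A: "A \<in> sets borel" and ne: "a \<in> A" and e: "e > 0"
  obtains K where "\<And>n::nat. compact (K n)" "\<And>n. a \<in> K n" "\<And>n. K n \<subseteq> A"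
    "(\<lambda>n. emeasure lborel (K n)) \<longlonglongrightarrow> emeasure lborel (\<Union>n. K n)"
    "emeasure lborel A \<le> emeasure lborel (\<Union>n. K n) + ennreal e"
proof -
  obtain T where T: "closed T" "T \<subseteq> A" "A - T \<in> lmeasurable" "emeasure lebesgue (A - T) < ennreal e"
    using sets_lebesgue_inner_closed[of A e] A e by auto
  define K where "K n = insert a (T \<inter> cball 0 (real n))" for n :: nat
  have cK: "compact (K n)" for n
    unfolding K_def using T(1) by (intro compact_insert closed_Int_compact compact_cball)
  have un: "(\<Union>n. K n) = insert a T"
  proof -
    have "\<exists>n::nat. norm x \<le> real n" for x :: 'a by (rule real_arch_simple)
    then show ?thesis by (auto simp: K_def)
  qed
  have inc: "incseq K"
    unfolding K_def by (auto simp: incseq_def)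
  have lim: "(\<lambda>n. emeasure lborel (K n)) \<longlonglongrightarrow> emeasure lborel (\<Union>n. K n)"
    using cK inc by (intro Lim_emeasure_incseq) (auto intro: borel_compact)
  have "emeasure lborel A \<le> emeasure lborel (insert a T \<union> (A - T))"
    using A T by (intro emeasure_mono) auto
  also have "\<dots> \<le> emeasure lborel (insert a T) + emeasure lborel (A - T)"
    using A T by (intro emeasure_subadditive) auto
  also have "emeasure lborel (A - T) = emeasure lebesgue (A - T)"
    using A T(1) by simp
  also have "emeasure lborel (insert a T) + emeasure lebesgue (A - T) \<le> emeasure lborel (insert a T) + ennreal e"
    using T(4) by (intro add_left_mono) simp
  finally have "emeasure lborel A \<le> emeasure lborel (\<Union>n. K n) + ennreal e"
    unfolding un .
  moreover have "K n \<subseteq> A" "a \<in> K n" for n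
    using T(2) ne by (auto simp: K_def)
  ultimately show thesis using that[of K] cK lim by blast
qed

lemma emeasure_midpoint:
  fixes A B C :: "real set"
  assumes A: "A \<in> sets borel" "A \<noteq> {}" and B: "B \<in> sets borel" "B \<noteq> {}" and C: "C \<in> sets borel"
    and mid: "\<And>x y. x \<in> A \<Longrightarrow> y \<in> B \<Longrightarrow> (x + y) / 2 \<in> C"
  shows "emeasure lborel A + emeasure lborel B \<le> 2 * emeasure lborel C"
proof (rule ennreal_le_epsilon)
  fix e :: real assume e: "e > 0"
  obtain a b where ab: "a \<in> A" "b \<in> B" using A B by auto
  obtain K where K: "\<And>n::nat. compact (K n)" "\<And>n. a \<in> K n" "\<And>n. K n \<subseteq> A"
    "(\<lambda>n. emeasure lborel (K n)) \<longlonglongrightarrow> emeasure lborel (\<Union>n. K n)"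
    "emeasure lborel A \<le> emeasure lborel (\<Union>n. K n) + ennreal (e/2)"
    using lborel_compact_exhaustion[OF A(1) ab(1), of "e/2"] e by auto
  obtain L where L: "\<And>n::nat. compact (L n)" "\<And>n. b \<in> L n" "\<And>n. L n \<subseteq> B"
    "(\<lambda>n. emeasure lborel (L n)) \<longlonglongrightarrow> emeasure lborel (\<Union>n. L n)"
    "emeasure lborel B \<le> emeasure lborel (\<Union>n. L n) + ennreal (e/2)"
    using lborel_compact_exhaustion[OF B(1) ab(2), of "e/2"] e by auto
  have "emeasure lborel (K n) + emeasure lborel (L n) \<le> 2 * emeasure lborel C" for n
    using K(1,2,3)[of n] L(1,2,3)[of n] by (intro emeasure_midpoint_compact C mid) auto
  then have "emeasure lborel (\<Union>n. K n) + emeasure lborel (\<Union>n. L n) \<le> 2 * emeasure lborel C"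
    by (intro LIMSEQ_le_const2[OF tendsto_add[OF K(4) L(4)]]) auto
  then have "emeasure lborel A + emeasure lborel B \<le> (emeasure lborel (\<Union>n. K n) + ennreal (e/2)) + (emeasure lborel (\<Union>n. L n) + ennreal (e/2))"
    using K(5) L(5) by (intro add_mono)
  also have "\<dots> = emeasure lborel (\<Union>n. K n) + emeasure lborel (\<Union>n. L n) + ennreal e"
    using e by (simp add: ac_simps flip: ennreal_plus)
  also have "\<dots> \<le> 2 * emeasure lborel C + ennreal e"
    by (intro add_right_mono) fact
  finally show "emeasure lborel A + emeasure lborel B \<le> 2 * emeasure lborel C + ennreal e" .
qed

section \<open>Level sets and the Prekopa-Leindler inequality\<close>

text \<open>Layer-cake formula: each value \<open>f x\<close> is the length of the set of t with 0
  \<le> t < f x, and Tonelli exchanges the two integrals.\<close>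

lemma nn_integral_eq_level_sets:
  assumes [measurable]: "f \<in> borel_measurable M" and M: "sigma_finite_measure M"
  shows "(\<integral>\<^sup>+x. f x \<partial>M) = (\<integral>\<^sup>+t. emeasure M {x \<in> space M. ennreal t < f x} * indicator {0..} t \<partial>lborel)"
proof -
  interpret sigma_finite_measure M by fact
  interpret pair_sigma_finite M lborel by standard
  have layer: "y = (\<integral>\<^sup>+t. indicator {t. 0 \<le> t \<and> ennreal t < y} t \<partial>lborel)" for y :: ennreal
  proof (cases y)
    case (real r)
    then have "{t. 0 \<le> t \<and> ennreal t < y} = {0..<r}" by (auto simp: ennreal_less_iff)
    then show ?thesis using real by simp
  next
    case top
    then have "{t. 0 \<le> t \<and> ennreal t < y} = {0..}" by auto
    moreover have "emeasure lborel {0::real..} = \<infinity>"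
    proof -
      have "ennreal (real n) \<le> emeasure lborel {0::real..}" for n
      proof -
        have "ennreal (real n) = emeasure lborel {0..real n}" by simp
        also have "\<dots> \<le> emeasure lborel {0::real..}" by (intro emeasure_mono) auto
        finally show ?thesis .
      qed
      then show ?thesis
        by (metis ennreal_of_nat_eq_real_of_nat ennreal_Ex_less_of_nat infinity_ennreal_def leD less_top)
    qed
    ultimately show ?thesis using top by simp
  qed
  have "(\<integral>\<^sup>+x. f x \<partial>M) = (\<integral>\<^sup>+x. (\<integral>\<^sup>+t. indicator {t. 0 \<le> t \<and> ennreal t < f x} t \<partial>lborel) \<partial>M)"
    using layer by (intro nn_integral_cong) simp
  also have "\<dots> = (\<integral>\<^sup>+x. (\<integral>\<^sup>+t. indicator {(x, t). 0 \<le> t \<and> ennreal t < f x} (x, t) \<partial>lborel) \<partial>M)"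
    by (intro nn_integral_cong) (auto simp: indicator_def)
  also have "\<dots> = (\<integral>\<^sup>+t. (\<integral>\<^sup>+x. indicator {(x, t). 0 \<le> t \<and> ennreal t < f x} (x, t) \<partial>M) \<partial>lborel)"
    by (intro Fubini'[symmetric]) (simp add: indicator_def split_beta')
  also have "\<dots> = (\<integral>\<^sup>+t. emeasure M {x \<in> space M. ennreal t < f x} * indicator {0..} t \<partial>lborel)"
  proof (intro nn_integral_cong)
    fix t :: real
    have "(\<integral>\<^sup>+x. indicator {(x, t). 0 \<le> t \<and> ennreal t < f x} (x, t) \<partial>M) =
      (\<integral>\<^sup>+x. indicator {0..} t * indicator {x \<in> space M. ennreal t < f x} x \<partial>M)"
      by (intro nn_integral_cong) (auto simp: indicator_def)
    then show "(\<integral>\<^sup>+x. indicator {(x, t). 0 \<le> t \<and> ennreal t < f x} (x, t) \<partial>M) =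
      emeasure M {x \<in> space M. ennreal t < f x} * indicator {0..} t"
      by (simp add: nn_integral_cmult mult.commute)
  qed
  finally show ?thesis .
qed

lemma ennreal_am_gm:
  fixes a b c :: ennreal
  assumes "a + b \<le> 2 * c" shows "a * b \<le> c\<^sup>2"
proof (cases "c = top")
  case True then show ?thesis by (simp add: power2_eq_square)
next
  case False
  then have "a \<noteq> top" "b \<noteq> top" using assms
    by (auto simp: top_unique ennreal_mult_eq_top_iff)
  then obtain a' b' c' where eq: "a = ennreal a'" "0 \<le> a'" "b = ennreal b'" "0 \<le> b'" "c = ennreal c'" "0 \<le> c'"
    using False by (metis ennreal_cases)
  have "ennreal (a' + b') \<le> ennreal (2 * c')"
    using assms eq by (simp add: ennreal_mult)
  then have "a' + b' \<le> 2 * c'" using eq by (subst (asm) ennreal_le_iff) auto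
  then have "(a' + b')\<^sup>2 \<le> (2 * c')\<^sup>2" using eq by (intro power_mono) auto
  moreover have "(a' - b')\<^sup>2 \<ge> 0" by simp
  ultimately have "a' * b' \<le> c'\<^sup>2" by (simp add: power2_eq_square algebra_simps)
  then show ?thesis using eq by (simp flip: ennreal_mult add: ennreal_power)
qed

lemma ennreal_mult_strict_mono:
  fixes a b c d :: ennreal
  assumes "a < b" "c < d" shows "a * c < b * d"
proof -
  obtain a' c' where ac: "a = ennreal a'" "0 \<le> a'" "c = ennreal c'" "0 \<le> c'"
    using assms by (metis ennreal_cases not_top_less)
  show ?thesis
  proof (cases "b = top \<or> d = top")
    case True
    then have "b * d = top"
      using assms by (auto simp: ennreal_mult_eq_top_iff)
    then show ?thesis using ac by (simp add: ennreal_mult[symmetric])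
  next
    case False
    then obtain b' d' where bd: "b = ennreal b'" "0 \<le> b'" "d = ennreal d'" "0 \<le> d'"
      by (metis ennreal_cases)
    have "a' < b'" "c' < d'" using assms ac bd by (auto simp: ennreal_less_iff)
    then have "a' * c' < b' * d'" using ac bd by (intro mult_strict_mono') auto
    then show ?thesis using ac bd by (simp add: ennreal_mult[symmetric] ennreal_less_iff)
  qed
qed

text \<open>Equal suprema make the level sets of f and g nonempty for the same t, and the level set
  of h contains all their midpoints. Brunn-Minkowski at every level, integrated over t, bounds the
  sum of the two integrals; the arithmetic-geometric mean inequality turns the sum into the
  product.\<close>

lemma prekopa_leindler_real_normalized:
  fixes f g h :: "real \<Rightarrow> ennreal"
  assumes [measurable]: "f \<in> borel_measurable borel" "g \<in> borel_measurable borel" "h \<in> borel_measurable borel"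
    and mid: "\<And>x y. f x * g y \<le> (h ((x + y) / 2))\<^sup>2"
    and f: "(SUP x. f x) = 1" and g: "(SUP x. g x) = 1"
  shows "integral\<^sup>N lborel f * integral\<^sup>N lborel g \<le> (integral\<^sup>N lborel h)\<^sup>2"
proof (rule ennreal_am_gm)
  have lev: "integral\<^sup>N lborel u = (\<integral>\<^sup>+t. emeasure lborel {x. ennreal t < u x} * indicator {0..} t \<partial>lborel)"
    if "u \<in> borel_measurable borel" for u :: "real \<Rightarrow> ennreal"
    using nn_integral_eq_level_sets[of u lborel] that by (simp add: sigma_finite_lborel)
  have le1: "f x \<le> 1" "g x \<le> 1" for x
    using f g by (metis SUP_upper UNIV_I)+
  have meas: "(\<lambda>t. emeasure lborel {x. ennreal t < u x} * indicator {0..} t) \<in> borel_measurable borel"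
    if [measurable]: "u \<in> borel_measurable borel" for u :: "real \<Rightarrow> ennreal"
  proof -
    have "{p \<in> space (borel \<Otimes>\<^sub>M lborel). ennreal (fst p) < u (snd p)} \<in> sets (borel \<Otimes>\<^sub>M lborel)"
      by measurable
    from lborel.measurable_emeasure_Pair[OF this]
    have "(\<lambda>t. emeasure lborel {x. ennreal t < u x}) \<in> borel_measurable borel"
      by (simp add: space_pair_measure vimage_def)
    then show ?thesis by measurable
  qed
  have "integral\<^sup>N lborel f + integral\<^sup>N lborel g =
    (\<integral>\<^sup>+t. emeasure lborel {x. ennreal t < f x} * indicator {0..} t + emeasure lborel {x. ennreal t < g x} * indicator {0..} t \<partial>lborel)"
    unfolding lev[OF assms(1)] lev[OF assms(2)]
    by (rule nn_integral_add[symmetric]) (use meas[of f] meas[of g] in auto)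
  also have "\<dots> \<le> (\<integral>\<^sup>+t. 2 * (emeasure lborel {x. ennreal t < h x} * indicator {0..} t) \<partial>lborel)"
  proof (intro nn_integral_mono)
    fix t :: real
    show "emeasure lborel {x. ennreal t < f x} * indicator {0..} t + emeasure lborel {x. ennreal t < g x} * indicator {0..} t
      \<le> 2 * (emeasure lborel {x. ennreal t < h x} * indicator {0..} t)"
    \<comment> \<open>For t in [0, 1) both level sets are nonempty because the suprema exceed t, as
      \<open>emeasure_midpoint\<close> requires. For t \<ge> 1 both are empty, and for t < 0 the
      indicator is zero.\<close>
    proof (cases "0 \<le> t \<and> t < 1")
      case True
      have t1: "ennreal t < 1" using True by (simp add: ennreal_less_one_iff)
      have ne: "{x. ennreal t < f x} \<noteq> {}" "{x. ennreal t < g x} \<noteq> {}"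
        using less_SUP_iff[of "ennreal t" f UNIV] less_SUP_iff[of "ennreal t" g UNIV] f g t1 by auto
      have "emeasure lborel {x. ennreal t < f x} + emeasure lborel {x. ennreal t < g x} \<le> 2 * emeasure lborel {x. ennreal t < h x}"
      proof (rule emeasure_midpoint)
        fix x y assume "x \<in> {x. ennreal t < f x}" "y \<in> {x. ennreal t < g x}"
        then have lt: "ennreal t < f x" "ennreal t < g y" by auto
        have "ennreal t * ennreal t < f x * g y"
          using lt le1 by (intro ennreal_mult_strict_mono) (auto simp: less_top[symmetric] top_unique)
        then have "(ennreal t)\<^sup>2 < (h ((x + y) / 2))\<^sup>2"
          using mid[of x y] by (simp add: power2_eq_square order_less_le_trans)
        then show "(x + y) / 2 \<in> {x. ennreal t < h x}"
          using power_mono[of "h ((x + y) / 2)" "ennreal t" 2] by (auto simp: not_less[symmetric])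
      qed (use ne in auto)
      then show ?thesis using True by simp
    next
      case False
      have "{x. ennreal t < f x} = {}" "{x. ennreal t < g x} = {}" if "0 \<le> t"
      proof -
        have "1 \<le> ennreal t" using False that by simp
        then have "f x \<le> ennreal t" "g x \<le> ennreal t" for x
          using le1[of x] order_trans by blast+
        then show "{x. ennreal t < f x} = {}" "{x. ennreal t < g x} = {}" by (auto simp: not_less)
      qed
      then show ?thesis by (cases "0 \<le> t") auto
    qed
  qed
  also have "\<dots> = 2 * integral\<^sup>N lborel h"
    unfolding lev[OF assms(3)] by (rule nn_integral_cmult) (use meas[of h] in auto)
  finally show "integral\<^sup>N lborel f + integral\<^sup>N lborel g \<le> 2 * integral\<^sup>N lborel h" .
qed

text \<open>The hypothesis is homogeneous: dividing f by F and g by G is matched by dividing h by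
  the geometric mean of F and G. This reduces to suprema equal to 1; a vanishing supremum is
  trivial.\<close>

lemma prekopa_leindler_real_bounded:
  fixes f g h :: "real \<Rightarrow> ennreal"
  assumes [measurable]: "f \<in> borel_measurable borel" "g \<in> borel_measurable borel" "h \<in> borel_measurable borel"
    and mid: "\<And>x y. f x * g y \<le> (h ((x + y) / 2))\<^sup>2"
    and f: "(SUP x. f x) \<noteq> top" and g: "(SUP x. g x) \<noteq> top"
  shows "integral\<^sup>N lborel f * integral\<^sup>N lborel g \<le> (integral\<^sup>N lborel h)\<^sup>2"
proof (cases "(SUP x. f x) = 0 \<or> (SUP x. g x) = 0")
  case True
  then have "(\<forall>x. f x = 0) \<or> (\<forall>x. g x = 0)"
    by (metis SUP_upper UNIV_I le_zero_eq)
  then have "f = (\<lambda>_. 0) \<or> g = (\<lambda>_. 0)" by auto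
  then have "integral\<^sup>N lborel f = 0 \<or> integral\<^sup>N lborel g = 0" by auto
  then show ?thesis by auto
next
  case False
  obtain F where F: "(SUP x. f x) = ennreal F" "F > 0"
    using False f by (metis ennreal_0 ennreal_cases less_eq_real_def)
  obtain G where G: "(SUP x. g x) = ennreal G" "G > 0"
    using False g by (metis ennreal_0 ennreal_cases less_eq_real_def)
  define H where "H = sqrt (F * G)"
  have H: "H > 0" "H * H = F * G" using F G by (auto simp: H_def)
  have "integral\<^sup>N lborel (\<lambda>x. ennreal (1/F) * f x) * integral\<^sup>N lborel (\<lambda>x. ennreal (1/G) * g x) \<le> (integral\<^sup>N lborel (\<lambda>x. ennreal (1/H) * h x))\<^sup>2"
  proof (rule prekopa_leindler_real_normalized)
    show "(SUP x. ennreal (1/F) * f x) = 1"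
      using F by (simp add: SUP_mult_left_ennreal[symmetric] ennreal_mult[symmetric])
    show "(SUP x. ennreal (1/G) * g x) = 1"
      using G by (simp add: SUP_mult_left_ennreal[symmetric] ennreal_mult[symmetric])
    fix x y
    have "ennreal (1/F) * f x * (ennreal (1/G) * g y) = ennreal (1/F) * ennreal (1/G) * (f x * g y)"
      by (simp add: ac_simps)
    also have "ennreal (1/F) * ennreal (1/G) = ennreal (1/H) * ennreal (1/H)"
      using F G H by (simp add: ennreal_mult[symmetric])
    also have "\<dots> * (f x * g y) \<le> ennreal (1/H) * ennreal (1/H) * (h ((x + y) / 2))\<^sup>2"
      by (intro mult_left_mono mid) auto
    also have "\<dots> = (ennreal (1/H) * h ((x + y) / 2))\<^sup>2"
      by (simp add: power2_eq_square ac_simps)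
    finally show "ennreal (1/F) * f x * (ennreal (1/G) * g y) \<le> (ennreal (1/H) * h ((x + y) / 2))\<^sup>2" .
  qed auto
  then have "ennreal (1/F) * ennreal (1/G) * (integral\<^sup>N lborel f * integral\<^sup>N lborel g) \<le> ennreal (1/H) * ennreal (1/H) * (integral\<^sup>N lborel h)\<^sup>2"
    by (simp add: nn_integral_cmult) (simp add: power2_eq_square ac_simps)
  also have "ennreal (1/H) * ennreal (1/H) = ennreal (1/F) * ennreal (1/G)"
    using F G H by (simp add: ennreal_mult[symmetric])
  finally have "ennreal (F * G) * (ennreal (1/F) * ennreal (1/G) * (integral\<^sup>N lborel f * integral\<^sup>N lborel g)) \<le> ennreal (F * G) * (ennreal (1/F) * ennreal (1/G) * (integral\<^sup>N lborel h)\<^sup>2)"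
    by (rule mult_left_mono) simp
  moreover have "ennreal (F * G) * (ennreal (1/F) * ennreal (1/G) * z) = z" for z
    using F G by (simp add: mult.assoc[symmetric] ennreal_mult[symmetric])
  ultimately show ?thesis by simp
qed

lemma nn_integral_SUP_min_nat:
  assumes [measurable]: "f \<in> borel_measurable M"
  shows "integral\<^sup>N M f = (SUP n::nat. \<integral>\<^sup>+x. min (f x) (of_nat n) \<partial>M)"
proof -
  have eq: "f x = (SUP n::nat. min (f x) (of_nat n))" for x
    by (simp add: inf_min[symmetric] inf_SUP[symmetric] ennreal_SUP_of_nat_eq_top)
  have "integral\<^sup>N M f = (\<integral>\<^sup>+x. (SUP n::nat. min (f x) (of_nat n)) \<partial>M)"
    by (intro nn_integral_cong) (rule eq)
  also have "\<dots> = (SUP n::nat. \<integral>\<^sup>+x. min (f x) (of_nat n) \<partial>M)"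
    by (intro nn_integral_monotone_convergence_SUP) (auto simp: incseq_def le_fun_def min.coboundedI2 intro!: min.mono)
  finally show ?thesis .
qed

text \<open>Truncating f and g only weakens the hypothesis, so h can be kept as it is. Independent
  truncation levels m and n let the two suprema be taken one after the other.\<close>

lemma prekopa_leindler_real:
  fixes f g h :: "real \<Rightarrow> ennreal"
  assumes [measurable]: "f \<in> borel_measurable borel" "g \<in> borel_measurable borel" "h \<in> borel_measurable borel"
    and mid: "\<And>x y. f x * g y \<le> (h ((x + y) / 2))\<^sup>2"
  shows "integral\<^sup>N lborel f * integral\<^sup>N lborel g \<le> (integral\<^sup>N lborel h)\<^sup>2"
proof -
  have "(\<integral>\<^sup>+x. min (f x) (of_nat m) \<partial>lborel) * (\<integral>\<^sup>+x. min (g x) (of_nat n) \<partial>lborel) \<le> (integral\<^sup>N lborel h)\<^sup>2" for m n :: nat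
  proof (rule prekopa_leindler_real_bounded)
    show "min (f x) (of_nat m) * min (g y) (of_nat n) \<le> (h ((x + y) / 2))\<^sup>2" for x y
      by (rule order_trans[OF mult_mono mid]) auto
    have "(SUP x. min (f x) (of_nat m)) \<le> of_nat m" "(SUP x. min (g x) (of_nat n)) \<le> of_nat n"
      by (auto intro!: SUP_least)
    then show "(SUP x. min (f x) (of_nat m)) \<noteq> top" "(SUP x. min (g x) (of_nat n)) \<noteq> top"
      using of_nat_less_top[of m] of_nat_less_top[of n] by (metis leD)+
  qed auto
  then show ?thesis
    by (simp add: nn_integral_SUP_min_nat[of f] nn_integral_SUP_min_nat[of g]
      SUP_mult_left_ennreal SUP_mult_right_ennreal SUP_le_iff)
qed

text \<open>Induction on the number of coordinates. With coordinate i frozen at s, the induction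
  hypothesis shows that the partial integrals, as functions of s, satisfy the midpoint condition
  again; the case of the line finishes the step.\<close>

lemma prekopa_leindler_PiM:
  fixes f g h :: "('i \<Rightarrow> real) \<Rightarrow> ennreal"
  assumes "finite I"
    and "f \<in> borel_measurable (Pi\<^sub>M I (\<lambda>_. lborel))" "g \<in> borel_measurable (Pi\<^sub>M I (\<lambda>_. lborel))"
      "h \<in> borel_measurable (Pi\<^sub>M I (\<lambda>_. lborel))"
    and "\<And>x y. f x * g y \<le> (h (\<lambda>i\<in>I. (x i + y i) / 2))\<^sup>2"
  shows "integral\<^sup>N (Pi\<^sub>M I (\<lambda>_. lborel)) f * integral\<^sup>N (Pi\<^sub>M I (\<lambda>_. lborel)) g \<le> (integral\<^sup>N (Pi\<^sub>M I (\<lambda>_. lborel)) h)\<^sup>2"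
  using assms
proof (induction I arbitrary: f g h rule: finite_induct)
  case empty
  then show ?case by (simp add: PiM_empty nn_integral_count_space_finite)
next
  case (insert i I)
  interpret product_sigma_finite "\<lambda>_. lborel :: real measure" by standard
  note [measurable] = insert.prems(1-3)
  have upd: "(\<lambda>x. u (x(i := s))) \<in> borel_measurable (Pi\<^sub>M I (\<lambda>_. lborel))"
    if [measurable]: "u \<in> borel_measurable (Pi\<^sub>M (insert i I) (\<lambda>_. lborel))" for u :: "('i \<Rightarrow> real) \<Rightarrow> ennreal" and s
    by measurable
  have F: "(\<lambda>s. \<integral>\<^sup>+x. u (x(i := s)) \<partial>Pi\<^sub>M I (\<lambda>_. lborel)) \<in> borel_measurable borel"
    if [measurable]: "u \<in> borel_measurable (Pi\<^sub>M (insert i I) (\<lambda>_. lborel))" for u :: "('i \<Rightarrow> real) \<Rightarrow> ennreal"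
  proof -
    interpret I: finite_product_sigma_finite "\<lambda>_. lborel :: real measure" I by standard fact
    have "(\<lambda>s. \<integral>\<^sup>+x. u (x(i := s)) \<partial>Pi\<^sub>M I (\<lambda>_. lborel)) \<in> borel_measurable lborel"
      by measurable
    then show ?thesis by simp
  qed
  show ?case
    unfolding product_nn_integral_insert_rev[OF insert.hyps insert.prems(1)]
      product_nn_integral_insert_rev[OF insert.hyps insert.prems(2)]
      product_nn_integral_insert_rev[OF insert.hyps insert.prems(3)]
  proof (intro prekopa_leindler_real F insert.prems insert.IH upd)
    fix s t :: real and x y :: "'i \<Rightarrow> real"
    have eq: "(\<lambda>j\<in>insert i I. ((x(i := s)) j + (y(i := t)) j) / 2) = (\<lambda>j\<in>I. (x j + y j) / 2)(i := (s + t) / 2)"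
      using insert.hyps by (auto simp: restrict_def)
    show "f (x(i := s)) * g (y(i := t)) \<le> (h ((\<lambda>j\<in>I. (x j + y j) / 2)(i := (s + t) / 2)))\<^sup>2"
      using insert.prems(4)[of "x(i := s)" "y(i := t)"] unfolding eq .
  qed
qed

theorem prekopa_leindler:
  fixes f g h :: "'a::euclidean_space \<Rightarrow> ennreal"
  assumes [measurable]: "f \<in> borel_measurable borel" "g \<in> borel_measurable borel" "h \<in> borel_measurable borel"
    and mid: "\<And>x y. f x * g y \<le> (h ((1/2) *\<^sub>R (x + y)))\<^sup>2"
  shows "integral\<^sup>N lborel f * integral\<^sup>N lborel g \<le> (integral\<^sup>N lborel h)\<^sup>2"
proof -
  let ?P = "Pi\<^sub>M (Basis :: 'a set) (\<lambda>_. lborel :: real measure)"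
  let ?T = "\<lambda>x. \<Sum>b\<in>(Basis :: 'a set). x b *\<^sub>R b"
  have [measurable]: "?T \<in> measurable ?P borel" by measurable
  have eq: "integral\<^sup>N lborel u = (\<integral>\<^sup>+x. u (?T x) \<partial>?P)" if [measurable]: "u \<in> borel_measurable borel" for u :: "'a \<Rightarrow> ennreal"
    by (subst lborel_eq) (simp add: nn_integral_distr)
  have "?T (\<lambda>i\<in>Basis. (x i + y i) / 2) = (1/2) *\<^sub>R (?T x + ?T y)" for x y
    by (simp add: scaleR_sum_right sum.distrib[symmetric] scaleR_add_left[symmetric] cong: sum.cong)
  then have "f (?T x) * g (?T y) \<le> (h (?T (\<lambda>i\<in>Basis. (x i + y i) / 2)))\<^sup>2" for x y
    using mid[of "?T x" "?T y"] by simp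
  then show ?thesis
    unfolding eq[OF assms(1)] eq[OF assms(2)] eq[OF assms(3)] by (intro prekopa_leindler_PiM) auto
qed

section \<open>Anderson's inequality\<close>

lemma nn_integral_lborel_affine:
  fixes f :: "'a::euclidean_space \<Rightarrow> ennreal"
  assumes [measurable]: "f \<in> borel_measurable borel" and c: "\<bar>c\<bar> = 1"
  shows "(\<integral>\<^sup>+x. f (t + c *\<^sub>R x) \<partial>lborel) = (\<integral>\<^sup>+x. f x \<partial>lborel)"
proof -
  have "c \<noteq> 0" using c by auto
  from lborel_affine[OF this, of t] have "(lborel :: 'a measure) = distr lborel borel (\<lambda>x. t + c *\<^sub>R x)"
    using c by (simp add: density_1)
  then have "(\<integral>\<^sup>+x. f x \<partial>lborel) = (\<integral>\<^sup>+x. f x \<partial>distr lborel borel (\<lambda>x. t + c *\<^sub>R x))"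
    by simp
  also have "\<dots> = (\<integral>\<^sup>+x. f (t + c *\<^sub>R x) \<partial>lborel)"
    by (simp add: nn_integral_distr)
  finally show ?thesis by simp
qed

lemma ennreal_power2_le_imp_le:
  fixes a b :: ennreal
  assumes "a\<^sup>2 \<le> b\<^sup>2" shows "a \<le> b"
proof (rule ccontr)
  assume "\<not> a \<le> b"
  then have "b * b < a * a"
    by (intro ennreal_mult_strict_mono) (auto simp: not_le)
  with assms show False by (simp add: power2_eq_square)
qed

text \<open>Prekopa-Leindler is applied to the translates by a and by - a. Midpoints of points x and
  y with a - x and - a - y in C lie in C by convexity and symmetry. Reflection shows that the two
  translated integrals are equal, so their product is a square.\<close>

lemma anderson_set:
  fixes g :: "'a::euclidean_space \<Rightarrow> ennreal" and C :: "'a set"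
  assumes C[measurable]: "C \<in> sets borel" and conv: "convex C" and sym: "\<And>x. x \<in> C \<Longrightarrow> - x \<in> C"
    and [measurable]: "g \<in> borel_measurable borel" and even: "\<And>x. g (- x) = g x"
    and mid: "\<And>x y. g x * g y \<le> (g ((1/2) *\<^sub>R (x + y)))\<^sup>2"
  shows "(\<integral>\<^sup>+z. indicator C (a - z) * g z \<partial>lborel) \<le> (\<integral>\<^sup>+z. indicator C z * g z \<partial>lborel)"
proof -
  have "(\<integral>\<^sup>+z. indicator C (a - z) * g z \<partial>lborel) * (\<integral>\<^sup>+z. indicator C (- a - z) * g z \<partial>lborel)
     \<le> (\<integral>\<^sup>+z. indicator C z * g z \<partial>lborel)\<^sup>2"
  proof (rule prekopa_leindler)
    fix x y
    show "indicator C (a - x) * g x * (indicator C (- a - y) * g y)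
       \<le> (indicator C ((1/2) *\<^sub>R (x + y)) * g ((1/2) *\<^sub>R (x + y)))\<^sup>2"
    proof (cases "a - x \<in> C \<and> - a - y \<in> C")
      case True
      then have "x - a \<in> C" "y + a \<in> C" using sym[of "a - x"] sym[of "- a - y"] by auto
      then have "(1/2) *\<^sub>R (x - a) + (1/2) *\<^sub>R (y + a) \<in> C"
        using conv by (intro convexD) auto
      also have "(1/2) *\<^sub>R (x - a) + (1/2) *\<^sub>R (y + a) = (1/2) *\<^sub>R (x + y)"
        by (simp add: algebra_simps)
      finally show ?thesis using True mid[of x y] by simp
    qed auto
  qed measurable
  moreover have "(\<integral>\<^sup>+z. indicator C (- a - z) * g z \<partial>lborel) = (\<integral>\<^sup>+z. indicator C (a - z) * g z \<partial>lborel)"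
  proof -
    have "(\<integral>\<^sup>+z. indicator C (- a - z) * g z \<partial>lborel) = (\<integral>\<^sup>+z. indicator C (- a - (0 + (-1) *\<^sub>R z)) * g (0 + (-1) *\<^sub>R z) \<partial>lborel)"
      by (subst nn_integral_lborel_affine[where c="-1" and t=0]) auto
    also have "\<dots> = (\<integral>\<^sup>+z. indicator C (a - z) * g z \<partial>lborel)"
    proof (intro nn_integral_cong)
      fix z
      have "- a + z \<in> C \<longleftrightarrow> a - z \<in> C" using sym[of "- a + z"] sym[of "a - z"] by auto
      then show "indicator C (- a - (0 + (-1) *\<^sub>R z)) * g (0 + (-1) *\<^sub>R z) = indicator C (a - z) * g z"
        using even[of z] by (simp add: indicator_def)
    qed
    finally show ?thesis .
  qed
  ultimately have "(\<integral>\<^sup>+z. indicator C (a - z) * g z \<partial>lborel)\<^sup>2 \<le> (\<integral>\<^sup>+z. indicator C z * g z \<partial>lborel)\<^sup>2"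
    by (simp only: power2_eq_square)
  then show ?thesis by (rule ennreal_power2_le_imp_le)
qed

lemma bowl_shaped_borel:
  assumes "bowl_shaped W" shows "W \<in> borel_measurable borel"
proof (rule borel_measurableI_le)
  fix a
  show "{x \<in> space borel. W x \<le> a} \<in> sets borel"
  proof (cases "a \<ge> 0")
    case True
    then have "closed {x. W x \<le> a}" using assms by (auto simp: bowl_shaped_def)
    then show ?thesis by (simp add: borel_closed)
  next
    case False
    have "\<And>x. 0 \<le> W x" using assms by (auto simp: bowl_shaped_def)
    with False have "{x \<in> space borel. W x \<le> a} = {}" by (auto simp: not_le intro: less_le_trans)
    then show ?thesis by simp
  qed
qed

text \<open>The complementary gain \<open>u = b - min b W\<close> has convex symmetric superlevel
  sets, so \<open>anderson_set\<close> integrated over the levels shows that centring maximises the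
  gain. Loss and gain add up to the constant b, and finiteness of the integral of g permits the
  cancellation.\<close>

lemma anderson:
  fixes g :: "real^'d \<Rightarrow> ennreal" and W :: "real^'d \<Rightarrow> real"
  assumes W: "bowl_shaped W" and b: "b > 0"
    and [measurable]: "g \<in> borel_measurable borel" and even: "\<And>x. g (- x) = g x"
    and mid: "\<And>x y. g x * g y \<le> (g ((1/2) *\<^sub>R (x + y)))\<^sup>2"
    and fin: "integral\<^sup>N lborel g < top"
  shows "(\<integral>\<^sup>+z. ennreal (min b (W z)) * g z \<partial>lborel) \<le> (\<integral>\<^sup>+z. ennreal (min b (W (a - z))) * g z \<partial>lborel)"
proof -
  note [measurable] = bowl_shaped_borel[OF W]
  define u where "u x = b - min b (W x)" for x
  have W0: "0 \<le> W x" for x using W by (auto simp: bowl_shaped_def)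
  have [measurable]: "u \<in> borel_measurable borel" unfolding u_def by measurable
  have u0: "0 \<le> u x" "u x \<le> b" for x using W0[of x] b by (auto simp: u_def)
  have layer: "ennreal (u x) = (\<integral>\<^sup>+t. indicator {0..b} t * indicator {x. t \<le> u x} x \<partial>lborel)" for x
  proof -
    have "(\<integral>\<^sup>+t. indicator {0..b} t * indicator {x. t \<le> u x} x \<partial>lborel) = (\<integral>\<^sup>+t. indicator {0..u x} t \<partial>lborel)"
      using u0[of x] by (intro nn_integral_cong) (auto simp: indicator_def)
    then show ?thesis using u0[of x] by simp
  qed
  have lev: "(\<integral>\<^sup>+z. ennreal (u (c z)) * g z \<partial>lborel) =
      (\<integral>\<^sup>+t. indicator {0..b} t * (\<integral>\<^sup>+z. indicator {x. t \<le> u x} (c z) * g z \<partial>lborel) \<partial>lborel)"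
    if [measurable]: "c \<in> borel_measurable borel" for c :: "real^'d \<Rightarrow> real^'d"
  proof -
    have "(\<integral>\<^sup>+z. ennreal (u (c z)) * g z \<partial>lborel) =
      (\<integral>\<^sup>+z. (\<integral>\<^sup>+t. indicator {0..b} t * indicator {x. t \<le> u x} (c z) * g z \<partial>lborel) \<partial>lborel)"
      unfolding layer by (intro nn_integral_cong nn_integral_multc[symmetric]) (simp add: indicator_def)
    also have "\<dots> = (\<integral>\<^sup>+t. (\<integral>\<^sup>+z. indicator {0..b} t * indicator {x. t \<le> u x} (c z) * g z \<partial>lborel) \<partial>lborel)"
      by (intro lborel_pair.Fubini') (simp add: indicator_def split_beta')
    also have "\<dots> = (\<integral>\<^sup>+t. indicator {0..b} t * (\<integral>\<^sup>+z. indicator {x. t \<le> u x} (c z) * g z \<partial>lborel) \<partial>lborel)"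
      unfolding mult.assoc by (intro nn_integral_cong nn_integral_cmult) measurable
    finally show ?thesis .
  qed
  have ulev: "(\<integral>\<^sup>+z. indicator {x. t \<le> u x} (a - z) * g z \<partial>lborel) \<le> (\<integral>\<^sup>+z. indicator {x. t \<le> u x} z * g z \<partial>lborel)"
    if t: "t \<in> {0..b}" for t
  proof (rule anderson_set)
    \<comment> \<open>The level t = 0 is separate: u is nonnegative, so the superlevel set is the
      whole space, not merely the set where W \<le> b.\<close>
    have "{x. t \<le> u x} = (if t = 0 then UNIV else {x. W x \<le> b - t})"
      using u0 t by (auto simp: u_def)
    then show "convex {x. t \<le> u x}" "\<And>x. x \<in> {x. t \<le> u x} \<Longrightarrow> - x \<in> {x. t \<le> u x}"
      using W t by (auto simp: bowl_shaped_def split: if_splits)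
  qed (use even mid in auto)
  have le: "(\<integral>\<^sup>+z. ennreal (u (a - z)) * g z \<partial>lborel) \<le> (\<integral>\<^sup>+z. ennreal (u z) * g z \<partial>lborel)"
    using ulev by (subst lev, simp, subst lev[where c="\<lambda>z. z"], simp, intro nn_integral_mono) (auto simp: indicator_def)
  have tot: "(\<integral>\<^sup>+z. ennreal (min b (W (c z))) * g z \<partial>lborel) + (\<integral>\<^sup>+z. ennreal (u (c z)) * g z \<partial>lborel) = ennreal b * integral\<^sup>N lborel g"
    if [measurable]: "c \<in> borel_measurable borel" for c :: "real^'d \<Rightarrow> real^'d"
  proof -
    have "ennreal (min b (W (c z))) + ennreal (u (c z)) = ennreal b" for z
      using W0[of "c z"] u0[of "c z"] b by (subst ennreal_plus[symmetric]) (auto simp: u_def)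
    then show ?thesis
      by (subst nn_integral_add[symmetric]) (auto simp: distrib_right[symmetric] nn_integral_cmult)
  qed
  have "(\<integral>\<^sup>+z. ennreal (u z) * g z \<partial>lborel) \<noteq> top"
  proof -
    have "(\<integral>\<^sup>+z. ennreal (u z) * g z \<partial>lborel) \<le> ennreal b * integral\<^sup>N lborel g"
      by (subst tot[of "\<lambda>z. z", symmetric]) auto
    then show ?thesis using fin by (auto simp: top_unique ennreal_mult_eq_top_iff)
  qed
  moreover have "(\<integral>\<^sup>+z. ennreal (u z) * g z \<partial>lborel) + (\<integral>\<^sup>+z. ennreal (min b (W z)) * g z \<partial>lborel)
    \<le> (\<integral>\<^sup>+z. ennreal (u z) * g z \<partial>lborel) + (\<integral>\<^sup>+z. ennreal (min b (W (a - z))) * g z \<partial>lborel)"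
    apply (subst (1 2) add.commute) using tot[of "\<lambda>z. z"] tot[of "\<lambda>z. a - z"] add_left_mono[OF le, of "\<integral>\<^sup>+z. ennreal (min b (W (a - z))) * g z \<partial>lborel"] by simp
  ultimately show ?thesis
    by (simp add: ennreal_add_left_cancel_le)
qed

section \<open>Gaussian integrals\<close>

lemma prod_Basis_vec:
  fixes f :: "real^'d \<Rightarrow> 'b::comm_monoid_mult"
  shows "(\<Prod>b\<in>Basis. f b) = (\<Prod>i\<in>UNIV. f (axis i 1))"
proof -
  have "(Basis :: (real^'d) set) = range (\<lambda>i. axis i 1)"
    by (auto simp: Basis_vec_def)
  then have "prod f Basis = prod f (range (\<lambda>i. axis i 1))"
    by (rule arg_cong)
  also have "\<dots> = prod (f \<circ> (\<lambda>i. axis i 1)) UNIV"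
    by (rule prod.reindex) (auto simp: inj_on_def axis_eq_axis)
  finally show ?thesis by simp
qed

lemma sum_Basis_vec:
  fixes f :: "real^'d \<Rightarrow> 'b::comm_monoid_add"
  shows "(\<Sum>b\<in>Basis. f b) = (\<Sum>i\<in>UNIV. f (axis i 1))"
proof -
  have "(Basis :: (real^'d) set) = range (\<lambda>i. axis i 1)"
    by (auto simp: Basis_vec_def)
  then have "sum f Basis = sum f (range (\<lambda>i. axis i 1))"
    by (rule arg_cong)
  also have "\<dots> = sum (f \<circ> (\<lambda>i. axis i 1)) UNIV"
    by (rule sum.reindex) (auto simp: inj_on_def axis_eq_axis)
  finally show ?thesis by simp
qed

text \<open>With all coordinates except m held fixed, the shear is a translation along coordinate m
  by an amount that does not depend on that coordinate, because n differs from m. Integrating that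
  coordinate first removes it.\<close>

lemma nn_integral_lborel_shear:
  fixes f :: "real^'d \<Rightarrow> ennreal"
  assumes [measurable]: "f \<in> borel_measurable borel" and mn: "m \<noteq> n"
  shows "(\<integral>\<^sup>+x. f (x + (c * x $ n) *\<^sub>R axis m 1) \<partial>lborel) = (\<integral>\<^sup>+x. f x \<partial>lborel)"
proof -
  interpret product_sigma_finite "\<lambda>_. lborel :: real measure" by standard
  define B where "B = (Basis :: (real^'d) set)"
  define em where "em = (axis m 1 :: real^'d)"
  define en where "en = (axis n 1 :: real^'d)"
  have em: "em \<in> B" "en \<in> B" "en \<noteq> em"
    using mn by (auto simp: em_def en_def B_def axis_eq_axis)
  have fB: "finite B" by (simp add: B_def)
  define T where "T x = (\<Sum>b\<in>B. x b *\<^sub>R b)" for x :: "real^'d \<Rightarrow> real"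
  have [measurable]: "T \<in> measurable (Pi\<^sub>M B (\<lambda>_. lborel)) borel"
    unfolding T_def by measurable
  have [measurable]: "T \<in> measurable (Pi\<^sub>M (insert em (B - {em})) (\<lambda>_. lborel)) borel"
    using em(1) by (simp add: insert_absorb)
  have eq: "(\<integral>\<^sup>+x. u x \<partial>lborel) = (\<integral>\<^sup>+x. (\<integral>\<^sup>+y. u (T (x(em := y))) \<partial>lborel) \<partial>Pi\<^sub>M (B - {em}) (\<lambda>_. lborel))"
    if [measurable]: "u \<in> borel_measurable borel" for u :: "real^'d \<Rightarrow> ennreal"
  proof -
    have "(\<integral>\<^sup>+x. u x \<partial>lborel) = (\<integral>\<^sup>+x. u (T x) \<partial>Pi\<^sub>M B (\<lambda>_. lborel))"
      by (subst lborel_eq) (simp add: nn_integral_distr T_def B_def)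
    also have "\<dots> = (\<integral>\<^sup>+x. u (T x) \<partial>Pi\<^sub>M (insert em (B - {em})) (\<lambda>_. lborel))"
      using em(1) by (simp add: insert_absorb)
    also have "\<dots> = (\<integral>\<^sup>+x. (\<integral>\<^sup>+y. u (T (x(em := y))) \<partial>lborel) \<partial>Pi\<^sub>M (B - {em}) (\<lambda>_. lborel))"
      by (rule product_nn_integral_insert) (use fB in simp, simp, measurable)
    finally show ?thesis .
  qed
  have T_upd: "T (x(em := y)) = y *\<^sub>R em + (\<Sum>b\<in>B - {em}. x b *\<^sub>R b)" for x y
    unfolding T_def by (subst sum.remove[OF fB em(1)]) (auto intro!: arg_cong2[where f="(+)"] sum.cong)
  have Tn: "T x $ n = x en" for x
  proof -
    have "T x $ n = T x \<bullet> en" by (simp add: en_def inner_axis)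
    also have "\<dots> = (\<Sum>b\<in>B. x b * (b \<bullet> en))"
      by (simp add: T_def inner_sum_left)
    also have "\<dots> = (\<Sum>b\<in>B. if b = en then x en else 0)"
      using em(2) unfolding B_def by (intro sum.cong) (auto simp: inner_Basis)
    also have "\<dots> = x en"
      using em(2) fB by simp
    finally show ?thesis .
  qed
  have [measurable]: "(\<lambda>x. x + (c * x $ n) *\<^sub>R axis m 1) \<in> borel_measurable (borel :: (real^'d) measure)"
    by (intro borel_measurable_continuous_onI continuous_intros)
  have inner: "(\<integral>\<^sup>+y. f (T (x(em := y)) + (c * T (x(em := y)) $ n) *\<^sub>R axis m 1) \<partial>lborel) =
      (\<integral>\<^sup>+y. f (T (x(em := y))) \<partial>lborel)" for x
  proof -
    define z where "z = (\<Sum>b\<in>B - {em}. x b *\<^sub>R b)"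
    have "(\<integral>\<^sup>+y. f (T (x(em := y)) + (c * T (x(em := y)) $ n) *\<^sub>R axis m 1) \<partial>lborel) =
      (\<integral>\<^sup>+y. f ((c * x en + 1 * y) *\<^sub>R em + z) \<partial>lborel)"
    proof (intro nn_integral_cong)
      fix y
      have "T (x(em := y)) $ n = x en" using Tn[of "x(em := y)"] em(3) by simp
      then show "f (T (x(em := y)) + (c * T (x(em := y)) $ n) *\<^sub>R axis m 1) = f ((c * x en + 1 * y) *\<^sub>R em + z)"
        by (simp only: T_upd z_def[symmetric] em_def[symmetric]) (simp add: algebra_simps)
    qed
    also have "\<dots> = (\<integral>\<^sup>+y. f (y *\<^sub>R em + z) \<partial>lborel)"
      by (subst nn_integral_real_affine[where c=1 and t="c * x en"]) auto
    also have "\<dots> = (\<integral>\<^sup>+y. f (T (x(em := y))) \<partial>lborel)"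
      unfolding T_upd z_def[symmetric] ..
    finally show ?thesis .
  qed
  show ?thesis
    by (subst (1 2) eq) (simp_all add: inner)
qed

lemma nn_integral_lborel_diag:
  fixes f :: "real^'d \<Rightarrow> ennreal"
  assumes [measurable]: "f \<in> borel_measurable borel" and c: "\<And>i. c i \<noteq> 0"
  shows "(\<integral>\<^sup>+x. f x \<partial>lborel) = ennreal \<bar>\<Prod>i\<in>UNIV. c i\<bar> * (\<integral>\<^sup>+x. f (\<chi> i. c i * x $ i) \<partial>lborel)"
proof -
  \<comment> \<open>\<open>lborel_affine_euclidean\<close> takes its factors indexed by basis
    vectors; the choice operator recovers the index of a basis vector.\<close>
  define c' where "c' b = c (SOME i. b = axis i (1::real))" for b :: "real^'d"
  have c': "c' (axis i 1) = c i" for i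
  proof -
    have "(SOME j. (axis i 1 :: real^'d) = axis j 1) = i"
      by (rule some_equality) (auto simp: axis_eq_axis)
    then show ?thesis by (simp add: c'_def)
  qed
  have T: "0 + (\<Sum>j\<in>Basis. (c' j * (x \<bullet> j)) *\<^sub>R j) = (\<chi> i. c i * x $ i)" for x :: "real^'d"
    unfolding sum_Basis_vec c' by (simp add: vec_eq_iff inner_axis) (simp add: axis_def if_distrib cong: if_cong)
  have P: "(\<Prod>j\<in>Basis. \<bar>c' j\<bar>) = \<bar>\<Prod>i\<in>UNIV. c i\<bar>"
    unfolding prod_Basis_vec c' by (simp add: abs_prod)
  have [measurable]: "(\<lambda>x. \<chi> i. c i * x $ i) \<in> borel_measurable (borel :: (real^'d) measure)"
    by (intro borel_measurable_continuous_onI continuous_intros)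
  have "c' j \<noteq> 0" if "j \<in> Basis" for j
    using c by (simp add: c'_def)
  from lborel_affine_euclidean[where c=c' and t=0, OF this]
  have "(lborel :: (real^'d) measure) = density (distr lborel borel (\<lambda>x. \<chi> i. c i * x $ i)) (\<lambda>_. ennreal \<bar>\<Prod>i\<in>UNIV. c i\<bar>)"
    unfolding T P by simp
  then have "(\<integral>\<^sup>+x. f x \<partial>lborel) = (\<integral>\<^sup>+x. f x \<partial>density (distr lborel borel (\<lambda>x. \<chi> i. c i * x $ i)) (\<lambda>_. ennreal \<bar>\<Prod>i\<in>UNIV. c i\<bar>))"
    by simp
  also have "\<dots> = ennreal \<bar>\<Prod>i\<in>UNIV. c i\<bar> * (\<integral>\<^sup>+x. f (\<chi> i. c i * x $ i) \<partial>lborel)"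
    by (simp add: nn_integral_density nn_integral_distr nn_integral_cmult)
  finally show ?thesis .
qed

text \<open>Exchanging two coordinates is a composition of three shears and one sign flip, each of
  which preserves Lebesgue measure.\<close>

lemma nn_integral_lborel_transpose:
  fixes f :: "real^'d \<Rightarrow> ennreal"
  assumes [measurable]: "f \<in> borel_measurable borel" and mn: "m \<noteq> n"
  shows "(\<integral>\<^sup>+x. f (\<chi> i. x $ Transposition.transpose m n i) \<partial>lborel) = (\<integral>\<^sup>+x. f x \<partial>lborel)"
proof -
  define S where "S a b c x = x + (c * x $ b) *\<^sub>R axis a 1" for a b :: 'd and c :: real and x :: "real^'d"
  define F where "F x = (\<chi> i. (if i = m then - 1 else 1) * x $ i)" for x :: "real^'d"
  have [measurable]: "S a b c \<in> borel_measurable borel" "F \<in> borel_measurable borel" for a b c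
    unfolding S_def F_def by (intro borel_measurable_continuous_onI continuous_intros)+
  have S: "(\<integral>\<^sup>+x. u (S a b c x) \<partial>lborel) = (\<integral>\<^sup>+x. u x \<partial>lborel)"
    if "u \<in> borel_measurable borel" "a \<noteq> b" for u :: "real^'d \<Rightarrow> ennreal" and a b c
    unfolding S_def using nn_integral_lborel_shear[OF that] .
  have F: "(\<integral>\<^sup>+x. u (F x) \<partial>lborel) = (\<integral>\<^sup>+x. u x \<partial>lborel)"
    if [measurable]: "u \<in> borel_measurable borel" for u :: "real^'d \<Rightarrow> ennreal"
  proof -
    have "\<bar>\<Prod>i\<in>UNIV. if i = m then - 1 else (1::real)\<bar> = 1"
      by (simp add: abs_prod)
    then show ?thesis
      unfolding F_def by (subst (2) nn_integral_lborel_diag[where c="\<lambda>i. if i = m then - 1 else 1"]) auto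
  qed
  have "(\<chi> i. x $ Transposition.transpose m n i) = F (S m n (-1) (S n m 1 (S m n (-1) x)))" for x
    using mn by (auto simp: vec_eq_iff F_def S_def axis_def Transposition.transpose_def)
  then have "(\<integral>\<^sup>+x. f (\<chi> i. x $ Transposition.transpose m n i) \<partial>lborel) =
    (\<integral>\<^sup>+x. f (F (S m n (-1) (S n m 1 (S m n (-1) x)))) \<partial>lborel)" by simp
  also have "\<dots> = (\<integral>\<^sup>+x. f (F (S m n (-1) (S n m 1 x))) \<partial>lborel)"
    using mn by (intro S) auto
  also have "\<dots> = (\<integral>\<^sup>+x. f (F (S m n (-1) x)) \<partial>lborel)"
    using mn by (intro S) auto
  also have "\<dots> = (\<integral>\<^sup>+x. f (F x) \<partial>lborel)"
    using mn by (intro S) auto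
  also have "\<dots> = (\<integral>\<^sup>+x. f x \<partial>lborel)"
    by (intro F) auto
  finally show ?thesis .
qed

lemma borel_measurable_matrix_vector_mult [measurable]:
  fixes A :: "real^'d^'d"
  shows "(\<lambda>x. A *v x) \<in> borel_measurable borel"
  by (intro borel_measurable_continuous_onI linear_continuous_on) (simp add: linear_conv_bounded_linear[symmetric])

text \<open>Induction over elementary matrices. The property \<open>P\<close> quantifies over all
  measurable f, since the product case applies it to f composed with one factor; the guard
  \<open>det A \<noteq> 0\<close> makes the zero-row case vacuous.\<close>

lemma nn_integral_lborel_linear:
  fixes f :: "real^'d \<Rightarrow> ennreal" and A :: "real^'d^'d"
  assumes "f \<in> borel_measurable borel" and "det A \<noteq> 0"
  shows "(\<integral>\<^sup>+x. f x \<partial>lborel) = ennreal \<bar>det A\<bar> * (\<integral>\<^sup>+x. f (A *v x) \<partial>lborel)"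
proof -
  define P where "P A \<longleftrightarrow> (det A \<noteq> 0 \<longrightarrow> (\<forall>f\<in>borel_measurable borel.
    (\<integral>\<^sup>+x. f x \<partial>lborel) = ennreal \<bar>det A\<bar> * (\<integral>\<^sup>+x. f (A *v x) \<partial>lborel)))" for A :: "real^'d^'d"
  have "P A"
  proof (induction rule: induct_matrix_elementary[case_names mult zero_row diagonal swap1 idplus])
    case (mult A B)
    show ?case unfolding P_def
    proof (intro impI ballI)
      fix f :: "real^'d \<Rightarrow> ennreal" assume "det (A ** B) \<noteq> 0" and [measurable]: "f \<in> borel_measurable borel"
      then have nz: "det A \<noteq> 0" "det B \<noteq> 0" by (auto simp: det_mul)
      have PA: "(\<integral>\<^sup>+x. u x \<partial>lborel) = ennreal \<bar>det A\<bar> * (\<integral>\<^sup>+x. u (A *v x) \<partial>lborel)"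
        and PB: "(\<integral>\<^sup>+x. u x \<partial>lborel) = ennreal \<bar>det B\<bar> * (\<integral>\<^sup>+x. u (B *v x) \<partial>lborel)"
        if "u \<in> borel_measurable borel" for u
        using mult nz that unfolding P_def by blast+
      have "(\<integral>\<^sup>+x. f x \<partial>lborel) = ennreal \<bar>det A\<bar> * (\<integral>\<^sup>+x. f (A *v x) \<partial>lborel)"
        by (rule PA) measurable
      also have "(\<integral>\<^sup>+x. f (A *v x) \<partial>lborel) = ennreal \<bar>det B\<bar> * (\<integral>\<^sup>+x. f (A *v (B *v x)) \<partial>lborel)"
        by (rule PB) measurable
      finally show "(\<integral>\<^sup>+x. f x \<partial>lborel) = ennreal \<bar>det (A ** B)\<bar> * (\<integral>\<^sup>+x. f ((A ** B) *v x) \<partial>lborel)"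
        by (simp add: det_mul abs_mult ennreal_mult mult.assoc matrix_vector_mul_assoc)
    qed
  next
    case (zero_row A i)
    then show ?case by (simp add: P_def det_zero_row)
  next
    case (diagonal A)
    then have d: "det A = (\<Prod>i\<in>UNIV. A $ i $ i)" by (intro det_diagonal) auto
    have Ax: "A *v x = (\<chi> i. A $ i $ i * x $ i)" for x
    proof -
      have "(\<Sum>j\<in>UNIV. A $ i $ j * x $ j) = A $ i $ i * x $ i" for i
        using diagonal by (subst sum.remove[of _ i]) (auto intro!: sum.neutral)
      then show ?thesis by (simp add: matrix_vector_mult_def)
    qed
    show ?case unfolding P_def Ax d by (intro impI ballI nn_integral_lborel_diag) auto
  next
    case (swap1 m n)
    let ?p = "Transposition.transpose m n"
    have "det (\<chi> i j. (mat 1 :: real^'d^'d) $ i $ ?p j) = of_int (sign ?p) * det (mat 1 :: real^'d^'d)"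
      by (rule det_permute_columns) (simp add: permutes_swap_id)
    then have d: "\<bar>det (\<chi> i j. (mat 1 :: real^'d^'d) $ i $ ?p j)\<bar> = 1"
      by (simp add: sign_def)
    have Ax: "(\<chi> i j. (mat 1 :: real^'d^'d) $ i $ ?p j) *v x = (\<chi> i. x $ ?p i)" for x
    proof -
      have "(\<Sum>j\<in>UNIV. (mat 1 :: real^'d^'d) $ i $ ?p j * x $ j) = x $ ?p i" for i
      proof -
        have "(\<Sum>j\<in>UNIV. (mat 1 :: real^'d^'d) $ i $ ?p j * x $ j) = (\<Sum>j\<in>UNIV. if j = ?p i then x $ ?p i else 0)"
          by (intro sum.cong) (auto simp: mat_def Transposition.transpose_def)
        then show ?thesis by simp
      qed
      then show ?thesis by (simp add: matrix_vector_mult_def)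
    qed
    show ?case unfolding P_def Ax d using nn_integral_lborel_transpose[OF _ swap1] by simp
  next
    case (idplus m n c)
    let ?A = "(\<chi> i j. if i = m \<and> j = n then c else of_bool (i = j)) :: real^'d^'d"
    have "?A = (\<chi> k. if k = m then row m (mat 1) + c *s row n (mat 1) else row k (mat 1 :: real^'d^'d))"
      using idplus by (auto simp: vec_eq_iff row_def mat_def)
    then have d: "det ?A = 1"
      using det_row_operation[OF idplus, of "mat 1 :: real^'d^'d" c] by simp
    have Ax: "?A *v x = x + (c * x $ n) *\<^sub>R axis m 1" for x
    proof -
      have "(\<Sum>j\<in>UNIV. (if i = m \<and> j = n then c else of_bool (i = j)) * x $ j) = x $ i + (if i = m then c * x $ n else 0)" for i
      proof -
        have "(\<Sum>j\<in>UNIV. (if i = m \<and> j = n then c else of_bool (i = j)) * x $ j) =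
          (\<Sum>j\<in>UNIV. (if j = i then x $ i else 0) + (if j = n then (if i = m then c * x $ n else 0) else 0))"
          using idplus by (intro sum.cong) auto
        then show ?thesis by (simp add: sum.distrib)
      qed
      then show ?thesis by (auto simp: vec_eq_iff matrix_vector_mult_def axis_def)
    qed
    show ?case unfolding P_def Ax d using nn_integral_lborel_shear[OF _ idplus] by simp
  qed
  with assms show ?thesis unfolding P_def by blast
qed

section \<open>Congruence of positive definite matrices with the identity\<close>

lemma quadratic_form_transpose:
  fixes J :: "real^'d^'d"
  assumes "transpose J = J"
  shows "x \<bullet> (J *v y) = y \<bullet> (J *v x)"
  by (metis assms dot_lmul_matrix inner_commute transpose_matrix_vector)

text \<open>Gram-Schmidt for the inner product x \<bullet> (J *v y). The resulting orthonormal
  system, indexed by the coordinates, supplies the columns of A.\<close>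

lemma gram_schmidt_matrix:
  fixes J :: "real^'d^'d"
  assumes J: "pos_def_matrix J"
  obtains A :: "real^'d^'d" where "transpose A ** J ** A = mat 1"
proof -
  have sym: "x \<bullet> (J *v y) = y \<bullet> (J *v x)" for x y
    using J quadratic_form_transpose by (auto simp: pos_def_matrix_def)
  have "\<exists>v. \<forall>i\<in>S. \<forall>j\<in>S. v i \<bullet> (J *v v j) = of_bool (i = j)" if "finite S" for S :: "'d set"
    using that
  proof (induction S rule: finite_induct)
    case (insert k S)
    then obtain v where v: "\<And>i j. i \<in> S \<Longrightarrow> j \<in> S \<Longrightarrow> v i \<bullet> (J *v v j) = of_bool (i = j)"
      by blast
    \<comment> \<open>Fewer vectors than the dimension cannot span the space, so some w is left over
      to be orthogonalised.\<close>
    have "card (v ` S) \<le> card S" by (intro card_image_le insert)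
    also have "\<dots> < card (UNIV :: 'd set)" using insert by (intro psubset_card_mono) auto
    finally have "dim (v ` S) < DIM(real^'d)"
      using dim_le_card[of "v ` S" "v ` S"] insert.hyps(1) by (simp add: span_superset)
    then obtain w where w: "w \<notin> span (v ` S)"
      by (metis UNIV_I dim_UNIV dim_span less_irrefl subsetI top.extremum_uniqueI)
    define u where "u = w - (\<Sum>j\<in>S. (w \<bullet> (J *v v j)) *\<^sub>R v j)"
    have "u \<noteq> 0"
    proof
      assume "u = 0"
      then have "w = (\<Sum>j\<in>S. (w \<bullet> (J *v v j)) *\<^sub>R v j)" by (simp add: u_def)
      also have "\<dots> \<in> span (v ` S)" by (intro span_sum span_scale span_base) auto
      finally show False using w by simp
    qed
    then have pos: "u \<bullet> (J *v u) > 0" using J by (auto simp: pos_def_matrix_def)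
    have orth: "u \<bullet> (J *v v i) = 0" if "i \<in> S" for i
    proof -
      have "(\<Sum>j\<in>S. (w \<bullet> (J *v v j)) *\<^sub>R v j) \<bullet> (J *v v i) = (\<Sum>j\<in>S. (w \<bullet> (J *v v j)) * of_bool (j = i))"
        using v that by (simp add: inner_sum_left)
      also have "\<dots> = w \<bullet> (J *v v i)"
        using that insert.hyps(1) by (simp add: of_bool_def if_distrib cong: if_cong)
      finally show ?thesis by (simp add: u_def inner_diff_left)
    qed
    define s where "s = sqrt (u \<bullet> (J *v u))"
    have s: "s > 0" "s * s = u \<bullet> (J *v u)" using pos by (auto simp: s_def)
    define v' where "v' = v(k := (1/s) *\<^sub>R u)"
    have "v' i \<bullet> (J *v v' j) = of_bool (i = j)" if "i \<in> insert k S" "j \<in> insert k S" for i j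
    proof (cases "i = k"; cases "j = k")
      assume "i = k" "j = k"
      then show ?thesis using s pos by (simp add: v'_def matrix_vector_mult_scaleR)
    next
      assume "i = k" "j \<noteq> k"
      then show ?thesis using orth[of j] that by (simp add: v'_def)
    next
      assume "i \<noteq> k" "j = k"
      then show ?thesis using orth[of i] that sym[of "v i" u] by (simp add: v'_def matrix_vector_mult_scaleR)
    next
      assume "i \<noteq> k" "j \<noteq> k"
      then show ?thesis using v[of i j] that by (simp add: v'_def)
    qed
    then show ?case by blast
  qed auto
  from this[of UNIV] obtain v :: "'d \<Rightarrow> real^'d" where v: "\<And>i j. v i \<bullet> (J *v v j) = of_bool (i = j)"
    by auto
  define A where "A = (\<chi> i j. v j $ i)"
  have "(transpose A ** J ** A) $ i $ j = v i \<bullet> (J *v v j)" for i j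
  proof -
    have "(transpose A ** J ** A) $ i $ j = (transpose A ** (J ** A)) $ i $ j"
      by (simp add: matrix_mul_assoc)
    also have "\<dots> = (\<Sum>k\<in>UNIV. v i $ k * (\<Sum>l\<in>UNIV. J $ k $ l * v j $ l))"
      by (simp add: matrix_matrix_mult_def transpose_def A_def)
    also have "\<dots> = v i \<bullet> (J *v v j)"
      by (simp add: inner_vec_def matrix_vector_mult_def)
    finally show ?thesis .
  qed
  then have "transpose A ** J ** A = mat 1"
    using v by (auto simp: vec_eq_iff mat_def)
  then show thesis by (rule that)
qed

text \<open>\<open>matrix_inv\<close> is a choice operator. A one-sided inverse of a square matrix
  is two-sided and unique, which pins down the chosen matrix.\<close>

lemma
  fixes J :: "'a::field^'d^'d"
  assumes "B ** J = mat 1"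
  shows matrix_inv_eqI: "matrix_inv J = B"
    and matrix_inv_matrix_inv_eqI: "matrix_inv (matrix_inv J) = J"
proof -
  have uniq: "matrix_inv C = C'" if "C' ** C = mat 1" for C C' :: "'a^'d^'d"
  proof -
    have C: "C ** C' = mat 1" using that matrix_left_right_inverse by blast
    have "\<exists>X. C ** X = mat 1 \<and> X ** C = mat 1" using that C by blast
    then have "C ** matrix_inv C = mat 1 \<and> matrix_inv C ** C = mat 1"
      unfolding matrix_inv_def by (rule someI_ex)
    then have "C' ** (C ** matrix_inv C) = C'" by simp
    then show ?thesis by (simp add: matrix_mul_assoc that)
  qed
  show 1: "matrix_inv J = B" by (rule uniq) fact
  have "J ** B = mat 1" using assms matrix_left_right_inverse by blast
  then show "matrix_inv (matrix_inv J) = J" unfolding 1 by (rule uniq)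
qed

text \<open>Collects what the substitution z = A *v w needs: it turns the form of J into the
  standard one. The same relation, read from the other side, says that A ** transpose A inverts
  J.\<close>

lemma pos_def_matrix_factor:
  fixes J :: "real^'d^'d"
  assumes "pos_def_matrix J"
  obtains A :: "real^'d^'d" where "det A \<noteq> 0" "\<And>w. (A *v w) \<bullet> (J *v (A *v w)) = w \<bullet> w"
    "matrix_inv J = A ** transpose A" "matrix_inv (matrix_inv J) = J"
proof -
  obtain A :: "real^'d^'d" where A: "transpose A ** J ** A = mat 1" using gram_schmidt_matrix[OF assms] .
  have "det (transpose A ** J ** A) = 1" unfolding A by simp
  then have d: "det A \<noteq> 0" by (auto simp: det_mul)
  have q: "(A *v w) \<bullet> (J *v (A *v w)) = w \<bullet> w" for w
  proof -
    have "(A *v w) \<bullet> (J *v (A *v w)) = w \<bullet> (transpose A *v (J *v (A *v w)))"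
      by (metis dot_lmul_matrix inner_commute transpose_matrix_vector)
    also have "\<dots> = w \<bullet> ((transpose A ** J ** A) *v w)"
      by (simp add: matrix_vector_mul_assoc matrix_mul_assoc)
    finally show ?thesis unfolding A by simp
  qed
  have "A ** (transpose A ** J) = mat 1"
    using A matrix_left_right_inverse by blast
  then have i: "(A ** transpose A) ** J = mat 1" by (simp add: matrix_mul_assoc)
  show thesis
    using that[OF d q matrix_inv_eqI[OF i] matrix_inv_matrix_inv_eqI[OF i]] .
qed

section \<open>Gaussian normalising constants and second moments\<close>

lemma nn_integral_exp_square:
  "(\<integral>\<^sup>+x. ennreal (exp (- x\<^sup>2 / 2)) \<partial>lborel) = ennreal (sqrt (2 * pi))"
  "(\<integral>\<^sup>+x. ennreal (x\<^sup>2 * exp (- x\<^sup>2 / 2)) \<partial>lborel) = ennreal (sqrt (2 * pi))"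
proof -
  have m: "(\<integral>\<^sup>+x. ennreal (std_normal_density x * x ^ (2 * k)) \<partial>lborel) = ennreal (fact (2 * k) / (2 ^ k * fact k))" for k
    unfolding integral_std_normal_moment_even[symmetric]
    by (rule nn_integral_eq_integral[OF integrable_std_normal_moment]) (auto simp: zero_le_even_power)
  have e: "exp (- x\<^sup>2 / 2) = sqrt (2 * pi) * std_normal_density x" for x
    by (simp add: std_normal_density_def)
  have "(\<integral>\<^sup>+x. ennreal (exp (- x\<^sup>2 / 2)) \<partial>lborel) = (\<integral>\<^sup>+x. ennreal (sqrt (2 * pi)) * ennreal (std_normal_density x * x ^ (2 * 0)) \<partial>lborel)"
    unfolding e by (intro nn_integral_cong) (simp add: ennreal_mult)
  also have "\<dots> = ennreal (sqrt (2 * pi))"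
    by (subst nn_integral_cmult) (simp_all only: m, simp_all)
  finally show "(\<integral>\<^sup>+x. ennreal (exp (- x\<^sup>2 / 2)) \<partial>lborel) = ennreal (sqrt (2 * pi))" .
  have m1: "(\<integral>\<^sup>+x. ennreal (std_normal_density x * x\<^sup>2) \<partial>lborel) = 1"
    using m[of 1] by simp
  have "(\<integral>\<^sup>+x. ennreal (x\<^sup>2 * exp (- x\<^sup>2 / 2)) \<partial>lborel) = (\<integral>\<^sup>+x. ennreal (sqrt (2 * pi)) * ennreal (std_normal_density x * x\<^sup>2) \<partial>lborel)"
    unfolding e by (intro nn_integral_cong) (subst ennreal_mult[symmetric], auto simp: ac_simps)
  also have "\<dots> = ennreal (sqrt (2 * pi))"
    by (subst nn_integral_cmult) (simp_all only: m1, simp_all)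
  finally show "(\<integral>\<^sup>+x. ennreal (x\<^sup>2 * exp (- x\<^sup>2 / 2)) \<partial>lborel) = ennreal (sqrt (2 * pi))" .
qed

lemma exp_norm_square_prod:
  "exp (- (w \<bullet> w) / 2) = (\<Prod>b\<in>Basis. exp (- (w \<bullet> b)\<^sup>2 / 2))" for w :: "'a::euclidean_space"
  by (simp add: exp_sum[symmetric] sum_negf sum_divide_distrib[symmetric] euclidean_inner[of w w] power2_eq_square)

lemma nn_integral_exp_norm_square:
  fixes b :: "'a::euclidean_space"
  shows
  "(\<integral>\<^sup>+w. ennreal (exp (- (w \<bullet> (w::'a)) / 2)) \<partial>lborel) = ennreal (sqrt (2 * pi) ^ DIM('a))" (is ?a)
  and
  "b \<in> Basis \<Longrightarrow> (\<integral>\<^sup>+w. ennreal ((w \<bullet> b)\<^sup>2 * exp (- (w \<bullet> w) / 2)) \<partial>lborel) = ennreal (sqrt (2 * pi) ^ DIM('a))" (is "_ \<Longrightarrow> ?b")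
proof -
  have "(\<integral>\<^sup>+w. ennreal (exp (- (w \<bullet> (w::'a)) / 2)) \<partial>lborel) = (\<integral>\<^sup>+w. (\<Prod>b\<in>Basis. ennreal (exp (- (w \<bullet> (b::'a))\<^sup>2 / 2))) \<partial>lborel)"
    unfolding exp_norm_square_prod by (intro nn_integral_cong prod_ennreal[symmetric]) auto
  also have "\<dots> = (\<Prod>b\<in>(Basis :: 'a set). \<integral>\<^sup>+x. ennreal (exp (- x\<^sup>2 / 2)) \<partial>lborel)"
    by (rule nn_integral_lborel_prod) auto
  finally show ?a unfolding nn_integral_exp_square by (simp add: ennreal_power)
next
  assume b: "b \<in> Basis"
  have "(\<integral>\<^sup>+w. ennreal ((w \<bullet> b)\<^sup>2 * exp (- (w \<bullet> w) / 2)) \<partial>lborel) = 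
    (\<integral>\<^sup>+w. (\<Prod>c\<in>Basis. ennreal ((if c = b then (w \<bullet> c)\<^sup>2 else 1) * exp (- (w \<bullet> c)\<^sup>2 / 2))) \<partial>lborel)"
    using b unfolding exp_norm_square_prod
    by (intro nn_integral_cong) (simp add: prod_ennreal prod.distrib)
  also have "\<dots> = (\<Prod>c\<in>(Basis :: 'a set). \<integral>\<^sup>+x. ennreal ((if c = b then x\<^sup>2 else 1) * exp (- x\<^sup>2 / 2)) \<partial>lborel)"
    by (rule nn_integral_lborel_prod) auto
  also have "\<dots> = (\<Prod>c\<in>(Basis :: 'a set). ennreal (sqrt (2 * pi)))"
  proof (intro prod.cong refl)
    fix c
    show "(\<integral>\<^sup>+x. ennreal ((if c = b then x\<^sup>2 else 1) * exp (- x\<^sup>2 / 2)) \<partial>lborel) = ennreal (sqrt (2 * pi))"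
      by (cases "c = b") (simp_all only: if_True if_False mult_1 simp_thms nn_integral_exp_square)
  qed
  finally show ?b by (simp add: ennreal_power)
qed

text \<open>Flipping the sign of one coordinate removes the cross terms.\<close>
lemma nn_integral_inner_square_exp:
  fixes v :: "real^'d"
  shows "(\<integral>\<^sup>+w. ennreal ((v \<bullet> w)\<^sup>2 * exp (- (w \<bullet> w) / 2)) \<partial>lborel) = ennreal ((norm v)\<^sup>2 * sqrt (2 * pi) ^ CARD('d))"
proof -
  let ?c = "sqrt (2 * pi) ^ CARD('d)"
  let ?e = "\<lambda>w :: real^'d. exp (- (w \<bullet> w) / 2)"
  let ?v = "\<lambda>S. (\<chi> i. if i \<in> S then v $ i else 0) :: real^'d"
  have "(\<integral>\<^sup>+w. ennreal ((?v S \<bullet> w)\<^sup>2 * ?e w) \<partial>lborel) = ennreal ((\<Sum>i\<in>S. (v $ i)\<^sup>2) * ?c)" if "finite S" for S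
    using that
  proof (induction S rule: finite_induct)
    case empty
    have "?v {} = 0" by (simp add: vec_eq_iff)
    then show ?case by simp
  next
    case (insert k S)
    define D where "D w = (\<chi> i. (if i = k then - 1 else 1) * w $ i)" for w :: "real^'d"
    have [measurable]: "D \<in> borel_measurable borel"
      unfolding D_def by (intro borel_measurable_continuous_onI continuous_intros)
    have DD: "D w \<bullet> D w = w \<bullet> w" for w
      unfolding inner_vec_def D_def by (intro sum.cong) auto
    have vS: "?v (insert k S) = v $ k *\<^sub>R axis k 1 + ?v S"
      using insert.hyps by (auto simp: vec_eq_iff axis_def)
    have vk: "?v (insert k S) \<bullet> w = v $ k * w $ k + ?v S \<bullet> w" for w
      unfolding vS by (simp add: inner_add_left inner_axis')
    have "?v S \<bullet> D w = ?v S \<bullet> w" for w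
      using insert.hyps unfolding inner_vec_def D_def by (intro sum.cong) auto
    then have vD: "?v (insert k S) \<bullet> D w = - v $ k * w $ k + ?v S \<bullet> w" for w
      unfolding vk by (simp add: D_def)
    let ?I = "\<integral>\<^sup>+w. ennreal ((?v (insert k S) \<bullet> w)\<^sup>2 * ?e w) \<partial>lborel"
    have "\<bar>\<Prod>i\<in>UNIV. if i = k then - 1 else (1::real)\<bar> = 1"
      by (simp add: abs_prod)
    then have "?I = (\<integral>\<^sup>+w. ennreal ((?v (insert k S) \<bullet> D w)\<^sup>2 * ?e (D w)) \<partial>lborel)"
      unfolding D_def by (subst nn_integral_lborel_diag[where c="\<lambda>i. if i = k then - 1 else 1"]) auto
    then have "?I + ?I = (\<integral>\<^sup>+w. ennreal ((?v (insert k S) \<bullet> w)\<^sup>2 * ?e w) + ennreal ((?v (insert k S) \<bullet> D w)\<^sup>2 * ?e (D w)) \<partial>lborel)"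
      by (subst nn_integral_add) auto
    also have "\<dots> = (\<integral>\<^sup>+w. ennreal (2 * (v $ k)\<^sup>2) * ennreal ((w \<bullet> axis k 1)\<^sup>2 * ?e w) + ennreal 2 * ennreal ((?v S \<bullet> w)\<^sup>2 * ?e w) \<partial>lborel)"
      unfolding vD DD unfolding vk
    proof (intro nn_integral_cong)
      fix w
      let ?a = "v $ k * w $ k" and ?q = "?v S \<bullet> w"
      have "ennreal ((?a + ?q)\<^sup>2 * ?e w) + ennreal ((- v $ k * w $ k + ?q)\<^sup>2 * ?e w)
        = ennreal ((?a + ?q)\<^sup>2 * ?e w + (- v $ k * w $ k + ?q)\<^sup>2 * ?e w)"
        by (subst ennreal_plus) auto
      also have "(?a + ?q)\<^sup>2 * ?e w + (- v $ k * w $ k + ?q)\<^sup>2 * ?e w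
        = 2 * (v $ k)\<^sup>2 * ((w \<bullet> axis k 1)\<^sup>2 * ?e w) + 2 * (?q\<^sup>2 * ?e w)"
        by (simp add: inner_axis) (simp add: algebra_simps power2_eq_square)
      also have "ennreal \<dots> = ennreal (2 * (v $ k)\<^sup>2) * ennreal ((w \<bullet> axis k 1)\<^sup>2 * ?e w) + ennreal 2 * ennreal (?q\<^sup>2 * ?e w)"
        by (subst ennreal_plus) (auto simp: ennreal_mult)
      finally show "ennreal ((?a + ?q)\<^sup>2 * ?e w) + ennreal ((- v $ k * w $ k + ?q)\<^sup>2 * ?e w) =
        ennreal (2 * (v $ k)\<^sup>2) * ennreal ((w \<bullet> axis k 1)\<^sup>2 * ?e w) + ennreal 2 * ennreal (?q\<^sup>2 * ?e w)" .
    qed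
    also have "\<dots> = ennreal (2 * (v $ k)\<^sup>2) * (\<integral>\<^sup>+w. ennreal ((w \<bullet> axis k 1)\<^sup>2 * ?e w) \<partial>lborel) + ennreal 2 * (\<integral>\<^sup>+w. ennreal ((?v S \<bullet> w)\<^sup>2 * ?e w) \<partial>lborel)"
      by (simp add: nn_integral_add nn_integral_cmult)
    also have "\<dots> = ennreal (2 * (v $ k)\<^sup>2) * ennreal ?c + ennreal 2 * ennreal ((\<Sum>i\<in>S. (v $ i)\<^sup>2) * ?c)"
      unfolding insert.IH by (subst nn_integral_exp_norm_square(2)) (auto simp: axis_in_Basis_iff)
    also have "\<dots> = ennreal (2 * ((v $ k)\<^sup>2 * ?c + (\<Sum>i\<in>S. (v $ i)\<^sup>2) * ?c))"
    proof -
      have "ennreal (2 * (v $ k)\<^sup>2) * ennreal ?c = ennreal (2 * (v $ k)\<^sup>2 * ?c)"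
        by (rule ennreal_mult[symmetric]) auto
      moreover have "ennreal 2 * ennreal ((\<Sum>i\<in>S. (v $ i)\<^sup>2) * ?c) = ennreal (2 * ((\<Sum>i\<in>S. (v $ i)\<^sup>2) * ?c))"
        by (rule ennreal_mult[symmetric]) (auto simp: sum_nonneg)
      ultimately show ?thesis
        by (subst distrib_left, subst ennreal_plus) (auto simp: sum_nonneg mult.assoc)
    qed
    also have "\<dots> = ennreal 2 * ennreal ((\<Sum>i\<in>insert k S. (v $ i)\<^sup>2) * ?c)"
      using insert.hyps by (subst ennreal_mult[symmetric]) (auto simp: sum_nonneg algebra_simps)
    finally have "2 * ?I = 2 * ennreal ((\<Sum>i\<in>insert k S. (v $ i)\<^sup>2) * ?c)"
      by (simp only: mult_2 ennreal_numeral)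
    then show ?case by (subst (asm) ennreal_mult_cancel_left) auto
  qed
  from this[of UNIV] show ?thesis
    by (simp add: norm_vec_def L2_set_def sum_nonneg)
qed

lemma nn_integral_exp_quadratic:
  fixes J :: "real^'d^'d"
  assumes "pos_def_matrix J"
  shows "(\<integral>\<^sup>+z. ennreal (exp (- (z \<bullet> (J *v z)) / 2)) \<partial>lborel) = ennreal (sqrt ((2 * pi) ^ CARD('d) * det (matrix_inv J)))"
    and "det (matrix_inv J) > 0"
proof -
  obtain A where A: "det A \<noteq> 0" "\<And>w. (A *v w) \<bullet> (J *v (A *v w)) = w \<bullet> w"
    "matrix_inv J = A ** transpose A" using pos_def_matrix_factor[OF assms] by metis
  have d: "det (matrix_inv J) = (det A)\<^sup>2" by (simp add: A(3) det_mul power2_eq_square)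
  then show "det (matrix_inv J) > 0" using A(1) by simp
  have "(\<integral>\<^sup>+z. ennreal (exp (- (z \<bullet> (J *v z)) / 2)) \<partial>lborel) = ennreal \<bar>det A\<bar> * (\<integral>\<^sup>+z. ennreal (exp (- (z \<bullet> (z::real^'d)) / 2)) \<partial>lborel)"
    by (subst nn_integral_lborel_linear[OF _ A(1)]) (auto simp: A(2))
  also have "\<dots> = ennreal \<bar>det A\<bar> * ennreal (sqrt (2 * pi) ^ CARD('d))"
    by (subst nn_integral_exp_norm_square) simp
  also have "\<dots> = ennreal (sqrt ((2 * pi) ^ CARD('d) * det (matrix_inv J)))"
    unfolding d real_sqrt_mult[of "(2 * pi) ^ CARD('d)"] real_sqrt_power[of "2 * pi"] real_sqrt_abs
    by (subst ennreal_mult[symmetric]) (auto simp: mult.commute)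
  finally show "(\<integral>\<^sup>+z. ennreal (exp (- (z \<bullet> (J *v z)) / 2)) \<partial>lborel) = ennreal (sqrt ((2 * pi) ^ CARD('d) * det (matrix_inv J)))" .
qed

text \<open>The normalising constant is kept as a factor on the left, which avoids division in
  \<open>ennreal\<close>; it is cancelled only at the end, where it is known to be positive and
  finite.\<close>

lemma nn_integral_gaussian:
  fixes J :: "real^'d^'d"
  assumes J: "pos_def_matrix J" and [measurable]: "f \<in> borel_measurable borel"
  shows "(\<integral>\<^sup>+z. f z \<partial>gaussian (matrix_inv J)) * (\<integral>\<^sup>+z. ennreal (exp (- (z \<bullet> (J *v z)) / 2)) \<partial>lborel)
    = (\<integral>\<^sup>+z. f z * ennreal (exp (- (z \<bullet> (J *v z)) / 2)) \<partial>lborel)"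
proof -
  let ?s = "sqrt ((2 * pi) ^ CARD('d) * det (matrix_inv J))"
  have s: "?s > 0" using nn_integral_exp_quadratic(2)[OF J] by simp
  have inv: "matrix_inv (matrix_inv J) = J" using pos_def_matrix_factor[OF J] by blast
  have "(\<integral>\<^sup>+z. f z \<partial>gaussian (matrix_inv J)) = (\<integral>\<^sup>+z. ennreal (1 / ?s) * (f z * ennreal (exp (- (z \<bullet> (J *v z)) / 2))) \<partial>lborel)"
    unfolding gaussian_def inv
  proof (subst nn_integral_density)
    have "ennreal (exp (- (z \<bullet> (J *v z)) / 2) / ?s) = ennreal (1 / ?s) * ennreal (exp (- (z \<bullet> (J *v z)) / 2))" for z
      using s by (subst ennreal_mult[symmetric]) auto
    then show "(\<integral>\<^sup>+z. ennreal (exp (- (z \<bullet> (J *v z)) / 2) / ?s) * f z \<partial>lborel) =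
      (\<integral>\<^sup>+z. ennreal (1 / ?s) * (f z * ennreal (exp (- (z \<bullet> (J *v z)) / 2))) \<partial>lborel)"
      by (intro nn_integral_cong) (simp only: ac_simps)
  qed measurable
  also have "\<dots> = ennreal (1 / ?s) * (\<integral>\<^sup>+z. f z * ennreal (exp (- (z \<bullet> (J *v z)) / 2)) \<partial>lborel)"
    by (rule nn_integral_cmult) measurable
  finally have "(\<integral>\<^sup>+z. f z \<partial>gaussian (matrix_inv J)) * ennreal ?s = (ennreal (1 / ?s) * ennreal ?s) * (\<integral>\<^sup>+z. f z * ennreal (exp (- (z \<bullet> (J *v z)) / 2)) \<partial>lborel)"
    by (simp add: ac_simps)
  also have "ennreal (1 / ?s) * ennreal ?s = 1"
    using s by (subst ennreal_mult[symmetric]) auto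
  finally show ?thesis unfolding nn_integral_exp_quadratic(1)[OF J] by simp
qed

text \<open>After z = A *v w the squared norm splits into squares of w against the rows of A. Each
  integrates to the squared norm of its row, up to the common constant, and these add up to the
  trace of A ** transpose A.\<close>

lemma nn_integral_gaussian_norm_square:
  fixes J :: "real^'d^'d"
  assumes J: "pos_def_matrix J"
  shows "(\<integral>\<^sup>+z. ennreal ((norm z)\<^sup>2) \<partial>gaussian (matrix_inv J)) = ennreal (trace (matrix_inv J))"
proof -
  let ?s = "sqrt ((2 * pi) ^ CARD('d) * det (matrix_inv J))"
  obtain A where A: "det A \<noteq> 0" "\<And>w. (A *v w) \<bullet> (J *v (A *v w)) = w \<bullet> w"
    "matrix_inv J = A ** transpose A" using pos_def_matrix_factor[OF J] by metis
  have d: "det (matrix_inv J) = (det A)\<^sup>2" by (simp add: A(3) det_mul power2_eq_square)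
  have s: "?s = \<bar>det A\<bar> * sqrt (2 * pi) ^ CARD('d)"
    unfolding d real_sqrt_mult[of "(2 * pi) ^ CARD('d)"] real_sqrt_power[of "2 * pi"] real_sqrt_abs by (simp add: mult.commute)
  have tr: "trace (matrix_inv J) = (\<Sum>i\<in>UNIV. (norm (A $ i))\<^sup>2)"
    unfolding A(3) trace_def matrix_matrix_mult_def transpose_def
    by (simp add: norm_vec_def L2_set_def sum_nonneg power2_eq_square)
  have nA: "(norm (A *v w))\<^sup>2 = (\<Sum>i\<in>UNIV. (A $ i \<bullet> w)\<^sup>2)" for w
    by (simp add: norm_vec_def L2_set_def sum_nonneg matrix_vector_mul_component)
  have "(\<integral>\<^sup>+z. ennreal ((norm z)\<^sup>2) * ennreal (exp (- (z \<bullet> (J *v z)) / 2)) \<partial>lborel)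
    = ennreal \<bar>det A\<bar> * (\<integral>\<^sup>+w. ennreal ((norm (A *v w))\<^sup>2) * ennreal (exp (- (w \<bullet> w) / 2)) \<partial>lborel)"
    by (subst nn_integral_lborel_linear[OF _ A(1)]) (auto simp: A(2))
  also have "(\<integral>\<^sup>+w. ennreal ((norm (A *v w))\<^sup>2) * ennreal (exp (- (w \<bullet> w) / 2)) \<partial>lborel)
    = (\<integral>\<^sup>+w. (\<Sum>i\<in>UNIV. ennreal ((A $ i \<bullet> w)\<^sup>2 * exp (- (w \<bullet> w) / 2))) \<partial>lborel)"
    unfolding nA by (intro nn_integral_cong) (simp add: ennreal_mult[symmetric] sum_nonneg sum_distrib_right)
  also have "\<dots> = (\<Sum>i\<in>UNIV. ennreal ((norm (A $ i))\<^sup>2 * sqrt (2 * pi) ^ CARD('d)))"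
  proof (subst nn_integral_sum)
    show "(\<Sum>i\<in>UNIV. \<integral>\<^sup>+w. ennreal ((A $ i \<bullet> w)\<^sup>2 * exp (- (w \<bullet> w) / 2)) \<partial>lborel) =
      (\<Sum>i\<in>UNIV. ennreal ((norm (A $ i))\<^sup>2 * sqrt (2 * pi) ^ CARD('d)))"
      by (simp only: nn_integral_inner_square_exp)
  qed measurable
  also have "\<dots> = ennreal (trace (matrix_inv J) * sqrt (2 * pi) ^ CARD('d))"
    unfolding tr by (simp add: sum_distrib_right)
  also have "ennreal \<bar>det A\<bar> * \<dots> = ennreal (trace (matrix_inv J)) * ennreal ?s"
    unfolding s by (simp add: tr ennreal_mult[symmetric] sum_nonneg ac_simps)
  finally have "(\<integral>\<^sup>+z. ennreal ((norm z)\<^sup>2) \<partial>gaussian (matrix_inv J)) * ennreal ?s = ennreal (trace (matrix_inv J)) * ennreal ?s"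
    using nn_integral_gaussian[OF J, of "\<lambda>z. ennreal ((norm z)\<^sup>2)"] unfolding nn_integral_exp_quadratic(1)[OF J] by simp
  moreover have "?s > 0" using nn_integral_exp_quadratic(2)[OF J] by simp
  ultimately show ?thesis
    unfolding mult.commute[of _ "ennreal ?s"] by (subst (asm) ennreal_mult_cancel_left) auto
qed

section \<open>Asymptotic minimax bound for locally asymptotically normal experiments\<close>

text \<open>Eventually u lies below u0 plus a small slack. What remains is a continuous monotone
  function of v, and such functions commute with the limit inferior; no subtraction in
  \<open>ennreal\<close> is involved.\<close>

lemma liminf_le_affine:
  fixes a u v :: "nat \<Rightarrow> ennreal"
  assumes le: "\<And>n. a n \<le> q * v n + u n" and u: "u \<longlonglongrightarrow> u0" and fin: "q < top" "u0 < top"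
  shows "liminf a \<le> q * liminf v + u0"
proof (rule ennreal_le_epsilon)
  fix e :: real assume e: "e > 0"
  have "u0 < u0 + ennreal e"
    using e fin(2) by (cases u0) (auto simp: ennreal_plus[symmetric] ennreal_less_iff simp del: ennreal_plus)
  from order_tendstoD(2)[OF u this] have ev: "eventually (\<lambda>n. a n \<le> q * v n + (u0 + ennreal e)) sequentially"
    by eventually_elim (rule order_trans[OF le], auto intro: add_left_mono)
  have "liminf a \<le> liminf (\<lambda>n. q * v n + (u0 + ennreal e))"
    by (rule Liminf_mono[OF ev])
  also have "\<dots> = q * liminf v + (u0 + ennreal e)"
  proof (rule Liminf_compose_continuous_mono)
    show "continuous_on UNIV (\<lambda>x. q * x + (u0 + ennreal e))"
      using fin by (intro continuous_on_add_ennreal ennreal_continuous_on_cmult continuous_intros) auto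
    show "mono (\<lambda>x. q * x + (u0 + ennreal e))"
      by (auto intro!: monoI add_right_mono mult_left_mono)
  qed auto
  finally show "liminf a \<le> q * liminf v + u0 + ennreal e" by (simp add: add.assoc)
qed

lemma liminf_cmult_ennreal:
  fixes f :: "nat \<Rightarrow> ennreal"
  assumes "c < top"
  shows "liminf (\<lambda>n. c * f n) = c * liminf f"
  using assms by (intro Liminf_compose_continuous_mono ennreal_continuous_on_cmult continuous_intros)
    (auto intro!: monoI mult_left_mono)

lemma ennreal_mult_right_le_cancel:
  fixes a b c :: ennreal
  assumes "a * c \<le> b * c" "c \<noteq> 0" "c < top"
  shows "a \<le> b"
  using assms ennreal_mult_le_mult_iff[of c a b] by (auto simp: mult.commute less_top)

lemma scaleR_mat_mult_vector: "(c *\<^sub>R mat 1 :: real^'d^'d) *v z = c *\<^sub>R z"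
  by (simp add: scaleR_matrix_vector_assoc[symmetric])

lemma pos_def_matrix_scaleR_mat: "c > 0 \<Longrightarrow> pos_def_matrix (c *\<^sub>R mat 1 :: real^'d^'d)"
  unfolding pos_def_matrix_def scaleR_mat_mult_vector
  by (auto simp: transpose_def mat_def vec_eq_iff inner_gt_zero_iff)

text \<open>Half of the quadratic term absorbs the linear one by completing a square, at the price
  of the factor exp (M^2 / k). The other half is integrable.\<close>

lemma nn_integral_exp_norm_minus_square_finite:
  assumes k: "k > 0"
  shows "(\<integral>\<^sup>+h. ennreal (exp (M * norm h - k * (h \<bullet> (h :: real^'d)) / 2)) \<partial>lborel) < top"
proof -
  define J where "J = (k / 2) *\<^sub>R (mat 1 :: real^'d^'d)"
  have J: "pos_def_matrix J" unfolding J_def using k by (intro pos_def_matrix_scaleR_mat) auto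
  have le: "exp (M * norm h - k * (h \<bullet> h) / 2) \<le> exp (M\<^sup>2 / k) * exp (- (h \<bullet> (J *v h)) / 2)" for h :: "real^'d"
  proof -
    have "0 \<le> (M / k - norm h / 2)\<^sup>2 * k" using k by simp
    also have "(M / k - norm h / 2)\<^sup>2 * k = M\<^sup>2 / k - M * norm h + k * (h \<bullet> h) / 4"
      using k by (simp add: power2_eq_square field_simps dot_square_norm)
    finally have "M * norm h - k * (h \<bullet> h) / 2 \<le> M\<^sup>2 / k + - (h \<bullet> (J *v h)) / 2"
      by (simp add: J_def scaleR_mat_mult_vector)
    then show ?thesis by (simp only: exp_add[symmetric] exp_le_cancel_iff)
  qed
  have "(\<integral>\<^sup>+h. ennreal (exp (M * norm h - k * (h \<bullet> (h :: real^'d)) / 2)) \<partial>lborel)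
    \<le> (\<integral>\<^sup>+h. ennreal (exp (M\<^sup>2 / k)) * ennreal (exp (- (h \<bullet> (J *v h)) / 2)) \<partial>lborel)"
    by (intro nn_integral_mono) (subst ennreal_mult[symmetric], auto intro!: ennreal_leI simp only: le exp_ge_zero)
  also have "\<dots> = ennreal (exp (M\<^sup>2 / k)) * (\<integral>\<^sup>+h. ennreal (exp (- (h \<bullet> (J *v h)) / 2)) \<partial>lborel)"
    by (rule nn_integral_cmult) measurable
  also have "\<dots> < top"
    unfolding nn_integral_exp_quadratic(1)[OF J] by (simp add: ennreal_mult_less_top)
  finally show ?thesis .
qed

section \<open>Bayes risk under a Gaussian posterior\<close>

text \<open>Unnormalised density of the centred Gaussian law with precision matrix Q, the inverse of
  its covariance.\<close>

definition quad_exp :: "real^'d^'d \<Rightarrow> real^'d \<Rightarrow> ennreal" where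
  "quad_exp Q z = ennreal (exp (- (z \<bullet> (Q *v z)) / 2))"

lemma borel_measurable_quad_exp [measurable]: "quad_exp Q \<in> borel_measurable borel"
  unfolding quad_exp_def by measurable

text \<open>Completing the square turns the posterior under a Gaussian prior into a Gaussian centred
  at \<open>m = Q\<inverse> D\<close>, whose Bayes risk is bounded below by Anderson's inequality.\<close>
lemma gaussian_posterior_risk:
  fixes Q :: "real^'d^'d"
  assumes Q: "pos_def_matrix Q" and W: "bowl_shaped W" and b: "b > 0"
  shows "(\<integral>\<^sup>+z. ennreal (min b (W z)) * quad_exp Q z \<partial>lborel) * (\<integral>\<^sup>+h. ennreal (exp (h \<bullet> D - (h \<bullet> (Q *v h)) / 2)) \<partial>lborel)
    \<le> (\<integral>\<^sup>+z. quad_exp Q z \<partial>lborel) * (\<integral>\<^sup>+h. ennreal (exp (h \<bullet> D - (h \<bullet> (Q *v h)) / 2)) * ennreal (min b (W (e - h))) \<partial>lborel)"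
proof -
  note [measurable] = bowl_shaped_borel[OF W]
  have sym: "x \<bullet> (Q *v y) = y \<bullet> (Q *v x)" for x y
    using Q quadratic_form_transpose by (auto simp: pos_def_matrix_def)
  have pos: "x \<bullet> (Q *v x) \<ge> 0" for x
    using Q by (cases "x = 0") (auto simp: pos_def_matrix_def less_imp_le)
  have "inj ((*v) Q)"
  proof (rule injI)
    fix x y assume "Q *v x = Q *v y"
    then have "(x - y) \<bullet> (Q *v (x - y)) = 0" by (simp add: matrix_vector_mult_diff_distrib)
    then show "x = y" using Q by (auto simp: pos_def_matrix_def dest!: spec[of _ "x - y"])
  qed
  then have "surj ((*v) Q)" by (simp add: linear_injective_imp_surjective)
  then obtain m where m: "D = Q *v m" by (metis surjD)
  define E where "E = ennreal (exp ((m \<bullet> (Q *v m)) / 2))"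
  have sq: "ennreal (exp (h \<bullet> D - (h \<bullet> (Q *v h)) / 2)) = E * quad_exp Q (h - m)" for h
  proof -
    have "(h - m) \<bullet> (Q *v (h - m)) = h \<bullet> (Q *v h) - 2 * (h \<bullet> (Q *v m)) + m \<bullet> (Q *v m)"
      using sym[of m h] by (simp add: matrix_vector_mult_diff_distrib inner_diff_left inner_diff_right)
    then have "h \<bullet> D - (h \<bullet> (Q *v h)) / 2 = (m \<bullet> (Q *v m)) / 2 + - ((h - m) \<bullet> (Q *v (h - m))) / 2"
      by (simp add: m field_simps)
    then show ?thesis
      by (simp only: exp_add E_def quad_exp_def) (simp add: ennreal_mult)
  qed
  have shift: "(\<integral>\<^sup>+h. u (m + h) \<partial>lborel) = (\<integral>\<^sup>+h. u h \<partial>lborel)"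
    if "u \<in> borel_measurable borel" for u :: "real^'d \<Rightarrow> ennreal"
    using nn_integral_lborel_affine[OF that, of 1 m] by simp
  have 1: "(\<integral>\<^sup>+h. ennreal (exp (h \<bullet> D - (h \<bullet> (Q *v h)) / 2)) \<partial>lborel) = E * (\<integral>\<^sup>+z. quad_exp Q z \<partial>lborel)"
    unfolding sq by (subst shift[symmetric]) (auto simp: nn_integral_cmult)
  have 2: "(\<integral>\<^sup>+h. ennreal (exp (h \<bullet> D - (h \<bullet> (Q *v h)) / 2)) * ennreal (min b (W (e - h))) \<partial>lborel)
    = E * (\<integral>\<^sup>+z. ennreal (min b (W ((e - m) - z))) * quad_exp Q z \<partial>lborel)"
    unfolding sq by (subst shift[symmetric]) (auto simp: nn_integral_cmult[symmetric] diff_diff_add ac_simps)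
  have "(\<integral>\<^sup>+z. ennreal (min b (W z)) * quad_exp Q z \<partial>lborel) \<le> (\<integral>\<^sup>+z. ennreal (min b (W ((e - m) - z))) * quad_exp Q z \<partial>lborel)"
  proof (rule anderson[OF W b])
    show "quad_exp Q (- x) = quad_exp Q x" for x
      by (simp add: quad_exp_def linear_neg[OF matrix_vector_mul_linear])
    show "integral\<^sup>N lborel (quad_exp Q) < top"
      unfolding quad_exp_def nn_integral_exp_quadratic(1)[OF Q] by simp
    fix x y :: "real^'d"
    define z where "z = (1/2) *\<^sub>R (x + y)"
    \<comment> \<open>The parallelogram identity, after dropping the nonnegative form at x - y, is
      the midpoint log-concavity of \<open>quad_exp Q\<close> that Anderson's inequality asks
      for.\<close>
    have "z \<bullet> (Q *v z) = (1/4) * ((x + y) \<bullet> (Q *v (x + y)))"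
      by (simp add: z_def matrix_vector_mult_scaleR)
    moreover have "(x + y) \<bullet> (Q *v (x + y)) + (x - y) \<bullet> (Q *v (x - y)) = 2 * (x \<bullet> (Q *v x)) + 2 * (y \<bullet> (Q *v y))"
      by (simp add: matrix_vector_mult_diff_distrib matrix_vector_right_distrib inner_diff_left inner_diff_right inner_add_left inner_add_right)
    ultimately have "- (x \<bullet> (Q *v x)) / 2 + - (y \<bullet> (Q *v y)) / 2 \<le> 2 * (- (z \<bullet> (Q *v z)) / 2)"
      using pos[of "x - y"] by simp
    then have "exp (- (x \<bullet> (Q *v x)) / 2 + - (y \<bullet> (Q *v y)) / 2) \<le> exp (2 * (- (z \<bullet> (Q *v z)) / 2))"
      by simp
    then have "exp (- (x \<bullet> (Q *v x)) / 2) * exp (- (y \<bullet> (Q *v y)) / 2) \<le> (exp (- (z \<bullet> (Q *v z)) / 2))\<^sup>2"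
      by (simp only: exp_add exp_double)
    then show "quad_exp Q x * quad_exp Q y \<le> (quad_exp Q ((1/2) *\<^sub>R (x + y)))\<^sup>2"
      unfolding z_def[symmetric] quad_exp_def
      by (simp only: ennreal_mult[symmetric, OF exp_ge_zero exp_ge_zero] ennreal_power[OF exp_ge_zero]) (simp add: ennreal_leI)
  qed measurable
  then show ?thesis
    unfolding 1 2 by (simp add: ac_simps mult_left_mono)
qed

section \<open>Experiments with a quadratic log-likelihood expansion\<close>

text \<open>\<open>f T h\<close> is a probability mass function on \<open>X T\<close> for every h in
  the whole space, so that a Gaussian prior on h makes sense. \<open>R_lim\<close> and
  \<open>ratio_bound\<close> are pointwise in h, with a constant and a starting index that may
  depend on h; \<open>R_meas\<close> is what allows integrating over h.\<close>

locale lan_experiment =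
  fixes X :: "nat \<Rightarrow> 'x set" and f :: "nat \<Rightarrow> real^'d \<Rightarrow> 'x \<Rightarrow> real"
    and \<Delta> :: "nat \<Rightarrow> 'x \<Rightarrow> real^'d" and R :: "nat \<Rightarrow> real^'d \<Rightarrow> 'x \<Rightarrow> real"
    and J :: "real^'d^'d" and C :: real
  assumes fin: "\<And>T. finite (X T)"
    and nonneg: "\<And>T h x. 0 \<le> f T h x"
    and total: "\<And>T h. (\<Sum>x\<in>X T. f T h x) = 1"
    and ratio: "\<And>T h x. x \<in> X T \<Longrightarrow>
      f T h x = f T 0 x * exp (h \<bullet> \<Delta> T x - (h \<bullet> (J *v h)) / 2 + R T h x)"
    and R_meas: "\<And>T x. x \<in> X T \<Longrightarrow> (\<lambda>h. R T h x) \<in> borel_measurable borel"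
    and R_lim: "\<And>h \<epsilon>. \<epsilon> > 0 \<Longrightarrow> (\<lambda>T. \<Sum>x\<in>{x \<in> X T. \<bar>R T h x\<bar> > \<epsilon>}. f T 0 x) \<longlonglongrightarrow> 0"
    and \<Delta>_bound: "\<And>T. (\<Sum>x\<in>X T. f T 0 x * (norm (\<Delta> T x))\<^sup>2) \<le> C"
    and ratio_bound: "\<And>h. \<exists>C'. eventually (\<lambda>T.
      (\<Sum>x\<in>X T. f T 0 x * (exp (h \<bullet> \<Delta> T x - (h \<bullet> (J *v h)) / 2 + R T h x))\<^sup>2) \<le> C') sequentially"
    and J: "pos_def_matrix J"
begin

text \<open>Maximal risk over the ball. It dominates the Bayes risk of any prior restricted to the
  ball, up to the mass of that prior.\<close>

definition bayes_sup :: "(nat \<Rightarrow> 'x \<Rightarrow> real^'d) \<Rightarrow> (real^'d \<Rightarrow> real) \<Rightarrow> real \<Rightarrow> nat \<Rightarrow> ennreal" where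
  "bayes_sup e l c T = (SUP h\<in>cball 0 c. \<Sum>x\<in>X T. ennreal (f T h x * l (e T x - h)))"

text \<open>Probability at h that the score is bounded by M and the remainder by \<epsilon>. The
  condition on the remainder is an indicator in h, so that measurability in h can be read off
  termwise.\<close>

definition good :: "real \<Rightarrow> real \<Rightarrow> nat \<Rightarrow> real^'d \<Rightarrow> ennreal" where
  "good M \<epsilon> T h = (\<Sum>x\<in>{x \<in> X T. norm (\<Delta> T x) \<le> M}. ennreal (f T h x) * indicator {h. \<bar>R T h x\<bar> \<le> \<epsilon>} h)"

text \<open>Probability of a large remainder, taken at the centre 0 and not at h: in the risk
  estimate the approximate posterior carries the weight \<open>f T 0 x\<close>.\<close>

definition bad :: "real \<Rightarrow> nat \<Rightarrow> real^'d \<Rightarrow> ennreal" where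
  "bad \<epsilon> T h = (\<Sum>x\<in>X T. ennreal (f T 0 x) * indicator {h. \<bar>R T h x\<bar> > \<epsilon>} h)"

lemma f_meas: "x \<in> X T \<Longrightarrow> (\<lambda>h. f T h x) \<in> borel_measurable borel"
  using R_meas[of x T] by (subst ratio) measurable

lemma good_meas [measurable]: "good M \<epsilon> T \<in> borel_measurable borel"
  unfolding good_def
proof (intro borel_measurable_sum)
  fix x assume "x \<in> {x \<in> X T. norm (\<Delta> T x) \<le> M}"
  then have [measurable]: "(\<lambda>h. R T h x) \<in> borel_measurable borel" "(\<lambda>h. f T h x) \<in> borel_measurable borel"
    using R_meas f_meas by auto
  show "(\<lambda>h. ennreal (f T h x) * indicator {h. \<bar>R T h x\<bar> \<le> \<epsilon>} h) \<in> borel_measurable borel"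
    by measurable
qed

lemma bad_meas [measurable]: "bad \<epsilon> T \<in> borel_measurable borel"
  unfolding bad_def
proof (intro borel_measurable_sum)
  fix x assume "x \<in> X T"
  then have [measurable]: "(\<lambda>h. R T h x) \<in> borel_measurable borel"
    using R_meas by auto
  show "(\<lambda>h. ennreal (f T 0 x) * indicator {h. \<bar>R T h x\<bar> > \<epsilon>} h) \<in> borel_measurable borel"
    by measurable
qed

lemma bad_le_1: "bad \<epsilon> T h \<le> 1"
proof -
  have "bad \<epsilon> T h \<le> (\<Sum>x\<in>X T. ennreal (f T 0 x))"
    unfolding bad_def by (intro sum_mono) (auto simp: indicator_def)
  also have "\<dots> = 1" by (simp add: total nonneg)
  finally show ?thesis .
qed

lemma bad_lim: assumes "\<epsilon> > 0" shows "(\<lambda>T. bad \<epsilon> T h) \<longlonglongrightarrow> 0"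
proof -
  have "bad \<epsilon> T h = ennreal (\<Sum>x\<in>{x \<in> X T. \<bar>R T h x\<bar> > \<epsilon>}. f T 0 x)" for T
  proof -
    have "bad \<epsilon> T h = (\<Sum>x\<in>X T. if \<bar>R T h x\<bar> > \<epsilon> then ennreal (f T 0 x) else 0)"
      unfolding bad_def by (intro sum.cong) auto
    also have "\<dots> = (\<Sum>x\<in>{x \<in> X T. \<bar>R T h x\<bar> > \<epsilon>}. ennreal (f T 0 x))"
      by (rule sum.inter_filter[symmetric]) (rule fin)
    finally show ?thesis by (simp add: nonneg)
  qed
  then show ?thesis
    using tendsto_ennrealI[OF R_lim[OF assms, of h]] by simp
qed

text \<open>The bound on the second moment of the likelihood ratio gives contiguity, so tightness of
  \<open>\<Delta>\<close> and negligibility of the remainder carry over from the centre to the alternatives.\<close>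
lemma good_lower:
  assumes "\<epsilon> > 0" "\<delta> > 0"
  shows "\<exists>M0. \<forall>M\<ge>M0. ennreal (1 - \<delta>) \<le> liminf (\<lambda>T. good M \<epsilon> T h)"
proof -
  obtain C' where C': "eventually (\<lambda>T. (\<Sum>x\<in>X T. f T 0 x * (exp (h \<bullet> \<Delta> T x - (h \<bullet> (J *v h)) / 2 + R T h x))\<^sup>2) \<le> C') sequentially"
    using ratio_bound by blast
  define K where "K = max 1 C'"
  have K: "K > 0" by (simp add: K_def)
  \<comment> \<open>Weight of the square in r \<le> \<eta> * r^2 + 1 / (4 * \<eta>); the second
    moment of the ratio then costs at most \<delta> / 4.\<close>
  define \<eta> where "\<eta> = \<delta> / (4 * K)"
  have \<eta>: "\<eta> > 0" "\<eta> * K = \<delta> / 4" using K assms by (auto simp: \<eta>_def)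
  \<comment> \<open>Chosen so that Chebyshev's bound C / (4 * \<eta> * M^2) for a large score is at
    most \<delta> / 4. The maximum with 1 gives M \<le> M^2, which lets a bound on M serve for its
    square.\<close>
  define M0 where "M0 = max 1 (C * (4 / (4 * \<eta> * \<delta>)))"
  show ?thesis
  proof (intro exI[of _ M0] allI impI Liminf_bounded)
    fix M assume M: "M \<ge> M0"
    have ev: "eventually (\<lambda>T. (\<Sum>x\<in>{x \<in> X T. \<bar>R T h x\<bar> > \<epsilon>}. f T 0 x) < \<delta> * \<eta>) sequentially"
      using order_tendstoD(2)[OF R_lim[OF assms(1), of h], of "\<delta> * \<eta>"] assms \<eta> by auto
    show "eventually (\<lambda>T. ennreal (1 - \<delta>) \<le> good M \<epsilon> T h) sequentially"
      using ev C'
    proof eventually_elim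
      case (elim T)
      let ?A = "{x \<in> X T. norm (\<Delta> T x) \<le> M \<and> \<bar>R T h x\<bar> \<le> \<epsilon>}"
      let ?r = "\<lambda>x. exp (h \<bullet> \<Delta> T x - (h \<bullet> (J *v h)) / 2 + R T h x)"
      have "good M \<epsilon> T h = (\<Sum>x\<in>{x \<in> X T. norm (\<Delta> T x) \<le> M}. if \<bar>R T h x\<bar> \<le> \<epsilon> then ennreal (f T h x) else 0)"
        unfolding good_def by (intro sum.cong) auto
      also have "\<dots> = (\<Sum>x\<in>{x \<in> {x \<in> X T. norm (\<Delta> T x) \<le> M}. \<bar>R T h x\<bar> \<le> \<epsilon>}. ennreal (f T h x))"
        by (rule sum.inter_filter[symmetric]) (simp add: fin)
      also have "\<dots> = ennreal (\<Sum>x\<in>?A. f T h x)"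
        by (simp add: nonneg)
      finally have good: "good M \<epsilon> T h = ennreal (\<Sum>x\<in>?A. f T h x)" .
      have "1 = (\<Sum>x\<in>?A. f T h x) + (\<Sum>x\<in>X T - ?A. f T h x)"
        unfolding total[of T h, symmetric] by (subst sum.subset_diff[of ?A]) (auto simp: fin)
      moreover have "(\<Sum>x\<in>X T - ?A. f T h x) \<le> \<delta>"
      proof -
        have "(\<Sum>x\<in>X T - ?A. f T h x) \<le> (\<Sum>x\<in>X T. \<eta> * (f T 0 x * (?r x)\<^sup>2) + 1 / (4 * \<eta>) * (f T 0 x * (norm (\<Delta> T x))\<^sup>2 / M\<^sup>2)
            + 1 / (4 * \<eta>) * (if \<bar>R T h x\<bar> > \<epsilon> then f T 0 x else 0))"
        proof (rule sum_mono2[OF fin, THEN order_trans[rotated]])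
          show "X T - ?A \<subseteq> X T" by auto
          show "0 \<le> \<eta> * (f T 0 x * (?r x)\<^sup>2) + 1 / (4 * \<eta>) * (f T 0 x * (norm (\<Delta> T x))\<^sup>2 / M\<^sup>2)
            + 1 / (4 * \<eta>) * (if \<bar>R T h x\<bar> > \<epsilon> then f T 0 x else 0)" for x
            using \<eta>(1) nonneg[of T 0 x] by auto
          show "(\<Sum>x\<in>X T - ?A. f T h x) \<le> (\<Sum>x\<in>X T - ?A. \<eta> * (f T 0 x * (?r x)\<^sup>2) + 1 / (4 * \<eta>) * (f T 0 x * (norm (\<Delta> T x))\<^sup>2 / M\<^sup>2)
            + 1 / (4 * \<eta>) * (if \<bar>R T h x\<bar> > \<epsilon> then f T 0 x else 0))"
          proof (rule sum_mono)
            fix x assume x: "x \<in> X T - ?A"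
            have f0: "f T 0 x \<ge> 0" by (rule nonneg)
            \<comment> \<open>This inequality splits the mass at h into a multiple of the squared
              ratio and a multiple of the mass at the centre, where tightness and smallness of the
              remainder are known.\<close>
            have "\<eta> * r\<^sup>2 + 1 / (4 * \<eta>) - r = (2 * \<eta> * r - 1)\<^sup>2 / (4 * \<eta>)" for r
              using \<eta>(1) by (simp add: field_simps power2_eq_square)
            then have "0 \<le> \<eta> * r\<^sup>2 + 1 / (4 * \<eta>) - r" for r
              using \<eta>(1) by simp
            then have "?r x \<le> \<eta> * (?r x)\<^sup>2 + 1 / (4 * \<eta>)" by (simp only: diff_ge_0_iff_ge)
            then have "f T 0 x * ?r x \<le> f T 0 x * (\<eta> * (?r x)\<^sup>2 + 1 / (4 * \<eta>))"
              using f0 by (rule mult_left_mono)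
            then have 1: "f T h x \<le> \<eta> * (f T 0 x * (?r x)\<^sup>2) + 1 / (4 * \<eta>) * f T 0 x"
              using x ratio[of x T h] by (simp add: algebra_simps)
            have 2: "f T 0 x \<le> f T 0 x * (norm (\<Delta> T x))\<^sup>2 / M\<^sup>2 + (if \<bar>R T h x\<bar> > \<epsilon> then f T 0 x else 0)"
            proof (cases "\<bar>R T h x\<bar> > \<epsilon>")
              case False
              then have "norm (\<Delta> T x) > M" using x by auto
              moreover have "M \<ge> 1" using M by (simp add: M0_def)
              ultimately have "(norm (\<Delta> T x))\<^sup>2 / M\<^sup>2 \<ge> 1" by (simp add: power_mono)
              then have "f T 0 x * 1 \<le> f T 0 x * ((norm (\<Delta> T x))\<^sup>2 / M\<^sup>2)"
                using f0 by (rule mult_left_mono)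
              then show ?thesis using False by simp
            qed (use f0 in simp)
            have "1 / (4 * \<eta>) * f T 0 x \<le> 1 / (4 * \<eta>) * (f T 0 x * (norm (\<Delta> T x))\<^sup>2 / M\<^sup>2 + (if \<bar>R T h x\<bar> > \<epsilon> then f T 0 x else 0))"
              using \<eta>(1) by (intro mult_left_mono 2) auto
            with 1 show "f T h x \<le> \<eta> * (f T 0 x * (?r x)\<^sup>2) + 1 / (4 * \<eta>) * (f T 0 x * (norm (\<Delta> T x))\<^sup>2 / M\<^sup>2)
              + 1 / (4 * \<eta>) * (if \<bar>R T h x\<bar> > \<epsilon> then f T 0 x else 0)"
              unfolding distrib_left by linarith
          qed
        qed
        also have "\<dots> = \<eta> * (\<Sum>x\<in>X T. f T 0 x * (?r x)\<^sup>2) + 1 / (4 * \<eta>) * ((\<Sum>x\<in>X T. f T 0 x * (norm (\<Delta> T x))\<^sup>2) / M\<^sup>2)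
            + 1 / (4 * \<eta>) * (\<Sum>x\<in>{x \<in> X T. \<bar>R T h x\<bar> > \<epsilon>}. f T 0 x)"
          by (simp add: sum.distrib sum_distrib_left sum_divide_distrib sum.inter_filter[OF fin])
        also have "\<dots> \<le> \<eta> * K + 1 / (4 * \<eta>) * (C / M\<^sup>2) + 1 / (4 * \<eta>) * (\<delta> * \<eta>)"
          using \<eta>(1) elim \<Delta>_bound[of T]
          by (intro add_mono mult_left_mono divide_right_mono) (auto simp: K_def)
        also have "\<dots> \<le> \<delta> / 4 + \<delta> / 4 + \<delta> / 4"
        proof -
          have M1: "M \<ge> 1" "M \<ge> C * (4 / (4 * \<eta> * \<delta>))" using M by (auto simp: M0_def)
          have "M \<le> M\<^sup>2" using M1(1) by (simp add: power2_eq_square)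
          then have "C * (4 / (4 * \<eta> * \<delta>)) \<le> M\<^sup>2" using M1 by linarith
          then have "1 / (4 * \<eta>) * (C / M\<^sup>2) \<le> \<delta> / 4"
            using \<eta>(1) assms M1 by (simp add: field_simps)
          then show ?thesis using \<eta> by simp
        qed
        also have "\<dots> \<le> \<delta>" using assms by simp
        finally show ?thesis .
      qed
      ultimately show ?case unfolding good by (intro ennreal_leI) linarith
    qed
  qed
qed

text \<open>Precision matrix of the posterior: the information J plus the precision of a prior with
  covariance \<open>mat 1\<close> divided by \<kappa>.\<close>

definition posterior_form :: "real \<Rightarrow> real^'d^'d" where
  "posterior_form \<kappa> = J + \<kappa> *\<^sub>R mat 1"

lemma posterior_form_mult: "posterior_form \<kappa> *v z = J *v z + \<kappa> *\<^sub>R z"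
  by (simp add: posterior_form_def matrix_vector_mult_add_rdistrib scaleR_mat_mult_vector)

lemma posterior_form_quad: "z \<bullet> (posterior_form \<kappa> *v z) = z \<bullet> (J *v z) + \<kappa> * (z \<bullet> z)"
  by (simp add: posterior_form_mult inner_add_right)

lemma J_nonneg: "0 \<le> z \<bullet> (J *v z)"
  using J by (cases "z = 0") (auto simp: pos_def_matrix_def less_imp_le)

lemma pos_def_posterior_form: "\<kappa> \<ge> 0 \<Longrightarrow> pos_def_matrix (posterior_form \<kappa>)"
  unfolding pos_def_matrix_def posterior_form_quad
proof (intro conjI allI impI)
  show "transpose (posterior_form \<kappa>) = posterior_form \<kappa>"
    using J by (auto simp: posterior_form_def pos_def_matrix_def transpose_def mat_def vec_eq_iff)
  fix v :: "real^'d" assume "v \<noteq> 0" "0 \<le> \<kappa>"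
  then show "0 < v \<bullet> (J *v v) + \<kappa> * (v \<bullet> v)"
    using J by (auto simp: pos_def_matrix_def intro!: add_pos_nonneg)
qed

text \<open>Holds for each fixed T. The likelihood is replaced by its quadratic approximation on the
  left, Anderson's bound is applied outcome by outcome, and the approximation is replaced back by
  the likelihood on the right. Each replacement costs a factor \<open>exp \<epsilon>\<close>. Where
  the second one fails, because the remainder is large or h leaves the ball, the loss is bounded by
  b and the weight by \<open>env\<close>.\<close>

lemma bayes_risk_inequality:
  fixes M \<kappa> \<epsilon> b c :: real
  assumes W: "bowl_shaped W" and b: "b > 0" and \<kappa>: "\<kappa> > 0" and \<epsilon>: "\<epsilon> > 0"
  defines "l \<equiv> (\<lambda>u. min b (W u))" and "Q \<equiv> posterior_form \<kappa>"
    and "prior \<equiv> (\<lambda>h :: real^'d. ennreal (exp (- (\<kappa> * (h \<bullet> h) / 2))))"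
    and "env \<equiv> (\<lambda>h :: real^'d. ennreal (exp (M * norm h - \<kappa> * (h \<bullet> h) / 2)))"
  shows "(\<integral>\<^sup>+z. ennreal (l z) * quad_exp Q z \<partial>lborel) * (\<integral>\<^sup>+h. indicator (cball 0 c) h * (prior h * good M \<epsilon> T h) \<partial>lborel)
    \<le> ennreal (exp \<epsilon>) * (\<integral>\<^sup>+z. quad_exp Q z \<partial>lborel) *
      (ennreal (exp \<epsilon>) * (\<integral>\<^sup>+h. prior h \<partial>lborel) * bayes_sup e l c T
        + ennreal b * (\<integral>\<^sup>+h. env h * bad \<epsilon> T h \<partial>lborel)
        + ennreal b * (\<integral>\<^sup>+h. indicator (- cball 0 c) h * env h \<partial>lborel))"
proof -
  note [measurable] = bowl_shaped_borel[OF W]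
  have l0: "0 \<le> l u" "l u \<le> b" for u
    using W b by (auto simp: l_def bowl_shaped_def)
  have [measurable]: "l \<in> borel_measurable borel" unfolding l_def by measurable
  have [measurable]: "prior \<in> borel_measurable borel" "env \<in> borel_measurable borel"
    unfolding prior_def env_def by measurable
  define \<Gamma> where "\<Gamma> = {x \<in> X T. norm (\<Delta> T x) \<le> M}"
  have fin\<Gamma>: "finite \<Gamma>" "\<Gamma> \<subseteq> X T" by (auto simp: \<Gamma>_def fin)
  define post where "post x h = exp (h \<bullet> \<Delta> T x - (h \<bullet> (Q *v h)) / 2)" for x h
  have [measurable]: "post x \<in> borel_measurable borel" for x
    unfolding post_def by measurable
  define A where "A = (\<integral>\<^sup>+z. ennreal (l z) * quad_exp Q z \<partial>lborel)"
  define G where "G = (\<integral>\<^sup>+z. quad_exp Q z \<partial>lborel)"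
  have ratio': "exp (- (\<kappa> * (h \<bullet> h) / 2)) * f T h x = f T 0 x * post x h * exp (R T h x)" if "x \<in> \<Gamma>" for x h
  proof -
    have "exp (- (\<kappa> * (h \<bullet> h) / 2)) * exp (h \<bullet> \<Delta> T x - (h \<bullet> (J *v h)) / 2 + R T h x) = post x h * exp (R T h x)"
      unfolding post_def Q_def posterior_form_quad exp_add[symmetric] by (simp add: add_divide_distrib)
    then show ?thesis using ratio[of x T h] that fin\<Gamma>(2) by (auto simp: ac_simps)
  qed
  \<comment> \<open>This is where truncating the score at M enters: Cauchy-Schwarz bounds the linear
    term, and the nonnegative form of J is dropped.\<close>
  have post_env: "post x h \<le> exp (M * norm h - \<kappa> * (h \<bullet> h) / 2)" if "x \<in> \<Gamma>" for x h
  proof -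
    have "h \<bullet> \<Delta> T x \<le> norm h * norm (\<Delta> T x)" by (rule norm_cauchy_schwarz)
    also have "\<dots> \<le> norm h * M" using that by (intro mult_left_mono) (auto simp: \<Gamma>_def)
    finally show ?thesis
      using J_nonneg[of h] by (simp add: post_def Q_def posterior_form_quad add_divide_distrib mult.commute)
  qed
  have anders: "A * (\<integral>\<^sup>+h. ennreal (post x h) \<partial>lborel) \<le> G * (\<integral>\<^sup>+h. ennreal (post x h) * ennreal (l (e T x - h)) \<partial>lborel)" for x
    using gaussian_posterior_risk[OF pos_def_posterior_form[OF less_imp_le[OF \<kappa>]] W b, of "\<Delta> T x" "e T x"]
    unfolding A_def G_def post_def Q_def l_def .
  have prior_le: "indicator (cball 0 c) h * (prior h * good M \<epsilon> T h) \<le> (\<Sum>x\<in>\<Gamma>. ennreal (exp \<epsilon> * f T 0 x) * ennreal (post x h))" for h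
  proof -
    have "prior h * good M \<epsilon> T h = (\<Sum>x\<in>\<Gamma>. prior h * (ennreal (f T h x) * indicator {h. \<bar>R T h x\<bar> \<le> \<epsilon>} h))"
      unfolding good_def \<Gamma>_def by (rule sum_distrib_left)
    also have "\<dots> \<le> (\<Sum>x\<in>\<Gamma>. ennreal (exp \<epsilon> * f T 0 x) * ennreal (post x h))"
    proof (rule sum_mono)
      fix x assume x: "x \<in> \<Gamma>"
      show "prior h * (ennreal (f T h x) * indicator {h. \<bar>R T h x\<bar> \<le> \<epsilon>} h) \<le> ennreal (exp \<epsilon> * f T 0 x) * ennreal (post x h)"
      proof (cases "\<bar>R T h x\<bar> \<le> \<epsilon>")
        case True
        have "exp (- (\<kappa> * (h \<bullet> h) / 2)) * f T h x \<le> f T 0 x * post x h * exp \<epsilon>"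
          unfolding ratio'[OF x] using True nonneg[of T 0 x] by (intro mult_left_mono) (auto simp: post_def)
        then have "ennreal (exp (- (\<kappa> * (h \<bullet> h) / 2)) * f T h x) \<le> ennreal ((exp \<epsilon> * f T 0 x) * post x h)"
          by (intro ennreal_leI) (simp add: ac_simps)
        then show ?thesis using True nonneg by (simp add: prior_def ennreal_mult post_def)
      qed simp
    qed
    finally show ?thesis by (simp add: indicator_def)
  qed
  \<comment> \<open>The three summands cover, in order, points of the ball with a small remainder,
    points with a large remainder, and points outside the ball.\<close>
  have risk_le: "(\<Sum>x\<in>\<Gamma>. ennreal (f T 0 x) * (ennreal (post x h) * ennreal (l (e T x - h))))
      \<le> ennreal (exp \<epsilon>) * bayes_sup e l c T * prior h + ennreal b * (env h * bad \<epsilon> T h)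
        + ennreal b * (indicator (- cball 0 c) h * env h)" for h
  proof (cases "h \<in> cball 0 c")
    case False
    have "(\<Sum>x\<in>\<Gamma>. ennreal (f T 0 x) * (ennreal (post x h) * ennreal (l (e T x - h)))) \<le> (\<Sum>x\<in>\<Gamma>. ennreal (f T 0 x) * (env h * ennreal b))"
      using post_env l0 unfolding env_def by (intro sum_mono mult_mono mult_left_mono ennreal_leI) auto
    also have "\<dots> \<le> (\<Sum>x\<in>X T. ennreal (f T 0 x) * (env h * ennreal b))"
      using fin\<Gamma> fin by (intro sum_mono2) auto
    also have "\<dots> = ennreal b * env h"
      unfolding sum_distrib_right[symmetric] by (simp add: nonneg total mult.commute)
    finally show ?thesis using False by (simp add: add_increasing)
  next
    case True
    have term_le: "ennreal (f T 0 x) * (ennreal (post x h) * ennreal (l (e T x - h)))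
        \<le> (ennreal (exp \<epsilon>) * prior h) * ennreal (f T h x * l (e T x - h)) + (ennreal b * env h) * (ennreal (f T 0 x) * indicator {h. \<bar>R T h x\<bar> > \<epsilon>} h)"
      if x: "x \<in> \<Gamma>" for x
    proof (cases "\<bar>R T h x\<bar> > \<epsilon>")
      case True
      have "ennreal (f T 0 x) * (ennreal (post x h) * ennreal (l (e T x - h))) \<le> ennreal (f T 0 x) * (env h * ennreal b)"
        using post_env[OF x] l0 unfolding env_def by (intro mult_mono mult_left_mono ennreal_leI) auto
      then show ?thesis using True by (simp add: ac_simps add_increasing add_increasing2)
    next
      case False
      have "f T 0 x * post x h = exp (- (\<kappa> * (h \<bullet> h) / 2)) * f T h x * exp (- R T h x)"
        unfolding ratio'[OF x] by (simp add: mult.assoc exp_add[symmetric])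
      also have "\<dots> \<le> exp (- (\<kappa> * (h \<bullet> h) / 2)) * f T h x * exp \<epsilon>"
        using False nonneg[of T h x] by (intro mult_left_mono) auto
      finally have "f T 0 x * post x h * l (e T x - h) \<le> exp (- (\<kappa> * (h \<bullet> h) / 2)) * f T h x * exp \<epsilon> * l (e T x - h)"
        by (rule mult_right_mono) (rule l0)
      then have "ennreal (f T 0 x * (post x h * l (e T x - h))) \<le> ennreal ((exp \<epsilon> * exp (- (\<kappa> * (h \<bullet> h) / 2))) * (f T h x * l (e T x - h)))"
        by (intro ennreal_leI) (simp add: ac_simps)
      then show ?thesis using False nonneg l0
        by (simp add: prior_def ennreal_mult post_def)
    qed
    have "(\<Sum>x\<in>\<Gamma>. ennreal (f T 0 x) * (ennreal (post x h) * ennreal (l (e T x - h))))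
      \<le> (\<Sum>x\<in>\<Gamma>. (ennreal (exp \<epsilon>) * prior h) * ennreal (f T h x * l (e T x - h)) + (ennreal b * env h) * (ennreal (f T 0 x) * indicator {h. \<bar>R T h x\<bar> > \<epsilon>} h))"
      by (rule sum_mono) (rule term_le)
    also have "\<dots> \<le> (\<Sum>x\<in>X T. (ennreal (exp \<epsilon>) * prior h) * ennreal (f T h x * l (e T x - h)) + (ennreal b * env h) * (ennreal (f T 0 x) * indicator {h. \<bar>R T h x\<bar> > \<epsilon>} h))"
      using fin\<Gamma> fin by (intro sum_mono2) auto
    also have "\<dots> = (ennreal (exp \<epsilon>) * prior h) * (\<Sum>x\<in>X T. ennreal (f T h x * l (e T x - h))) + (ennreal b * env h) * bad \<epsilon> T h"
      unfolding bad_def by (simp only: sum.distrib sum_distrib_left)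
    also have "\<dots> \<le> (ennreal (exp \<epsilon>) * prior h) * bayes_sup e l c T + (ennreal b * env h) * bad \<epsilon> T h"
      unfolding bayes_sup_def by (intro add_right_mono mult_left_mono SUP_upper True) auto
    finally show ?thesis using True by (simp add: ac_simps)
  qed
  have "A * (\<integral>\<^sup>+h. indicator (cball 0 c) h * (prior h * good M \<epsilon> T h) \<partial>lborel)
    \<le> A * (\<integral>\<^sup>+h. (\<Sum>x\<in>\<Gamma>. ennreal (exp \<epsilon> * f T 0 x) * ennreal (post x h)) \<partial>lborel)"
    by (intro mult_left_mono nn_integral_mono prior_le) auto
  also have "(\<integral>\<^sup>+h. (\<Sum>x\<in>\<Gamma>. ennreal (exp \<epsilon> * f T 0 x) * ennreal (post x h)) \<partial>lborel)
    = (\<Sum>x\<in>\<Gamma>. ennreal (exp \<epsilon> * f T 0 x) * (\<integral>\<^sup>+h. ennreal (post x h) \<partial>lborel))"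
    by (simp add: nn_integral_sum nn_integral_cmult)
  also have "A * \<dots> = (\<Sum>x\<in>\<Gamma>. ennreal (exp \<epsilon> * f T 0 x) * (A * (\<integral>\<^sup>+h. ennreal (post x h) \<partial>lborel)))"
    by (simp add: sum_distrib_left ac_simps)
  also have "\<dots> \<le> (\<Sum>x\<in>\<Gamma>. ennreal (exp \<epsilon> * f T 0 x) * (G * (\<integral>\<^sup>+h. ennreal (post x h) * ennreal (l (e T x - h)) \<partial>lborel)))"
    by (intro sum_mono mult_left_mono anders) auto
  also have "\<dots> = ennreal (exp \<epsilon>) * G * (\<Sum>x\<in>\<Gamma>. ennreal (f T 0 x) * (\<integral>\<^sup>+h. ennreal (post x h) * ennreal (l (e T x - h)) \<partial>lborel))"
    by (simp add: sum_distrib_left ennreal_mult nonneg ac_simps)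
  also have "(\<Sum>x\<in>\<Gamma>. ennreal (f T 0 x) * (\<integral>\<^sup>+h. ennreal (post x h) * ennreal (l (e T x - h)) \<partial>lborel))
    = (\<integral>\<^sup>+h. (\<Sum>x\<in>\<Gamma>. ennreal (f T 0 x) * (ennreal (post x h) * ennreal (l (e T x - h)))) \<partial>lborel)"
    by (simp add: nn_integral_sum nn_integral_cmult)
  also have "ennreal (exp \<epsilon>) * G * \<dots> \<le> ennreal (exp \<epsilon>) * G * (\<integral>\<^sup>+h. ennreal (exp \<epsilon>) * bayes_sup e l c T * prior h + ennreal b * (env h * bad \<epsilon> T h)
        + ennreal b * (indicator (- cball 0 c) h * env h) \<partial>lborel)"
    by (intro mult_left_mono nn_integral_mono risk_le) auto
  also have "(\<integral>\<^sup>+h. ennreal (exp \<epsilon>) * bayes_sup e l c T * prior h + ennreal b * (env h * bad \<epsilon> T h)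
        + ennreal b * (indicator (- cball 0 c) h * env h) \<partial>lborel)
    = ennreal (exp \<epsilon>) * bayes_sup e l c T * (\<integral>\<^sup>+h. prior h \<partial>lborel) + ennreal b * (\<integral>\<^sup>+h. env h * bad \<epsilon> T h \<partial>lborel)
        + ennreal b * (\<integral>\<^sup>+h. indicator (- cball 0 c) h * env h \<partial>lborel)"
    by (simp add: nn_integral_add nn_integral_cmult)
  finally show ?thesis
    unfolding A_def G_def by (simp only: ac_simps)
qed

text \<open>Limits of \<open>bayes_risk_inequality\<close>, taken in the order T, radius of the
  ball, score bound M, and \<epsilon>. The prior precision \<kappa> is still fixed here.\<close>

lemma bayes_sup_bound:
  fixes \<kappa> b :: real
  assumes W: "bowl_shaped W" and b: "b > 0" and \<kappa>: "\<kappa> > 0"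
  defines "l \<equiv> (\<lambda>u. min b (W u))" and "Q \<equiv> posterior_form \<kappa>"
  shows "(\<integral>\<^sup>+z. ennreal (l z) * quad_exp Q z \<partial>lborel) \<le> (\<integral>\<^sup>+z. quad_exp Q z \<partial>lborel) * (SUP c. liminf (bayes_sup e l c))"
proof -
  note [measurable] = bowl_shaped_borel[OF W]
  have l0: "0 \<le> l u" "l u \<le> b" for u
    using W b by (auto simp: l_def bowl_shaped_def)
  define V where "V = (SUP c. liminf (bayes_sup e l c))"
  define A where "A = (\<integral>\<^sup>+z. ennreal (l z) * quad_exp Q z \<partial>lborel)"
  define G where "G = (\<integral>\<^sup>+z. quad_exp Q z \<partial>lborel)"
  define prior where "prior h = ennreal (exp (- (\<kappa> * (h \<bullet> h) / 2)))" for h :: "real^'d"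
  define env where "env M h = ennreal (exp (M * norm h - \<kappa> * (h \<bullet> h) / 2))" for M and h :: "real^'d"
  have [measurable]: "prior \<in> borel_measurable borel" "env M \<in> borel_measurable borel" for M
    unfolding prior_def env_def by measurable
  define P where "P = (\<integral>\<^sup>+h. prior h \<partial>lborel)"
  have env_fin: "(\<integral>\<^sup>+h. env M h \<partial>lborel) < top" for M
    unfolding env_def by (rule nn_integral_exp_norm_minus_square_finite[OF \<kappa>])
  have P_fin: "P < top"
    using env_fin[of 0] by (simp add: P_def prior_def env_def)
  have P_pos: "P \<noteq> 0"
  proof
    assume "P = 0"
    then have "AE h :: real^'d in lborel. prior h = 0"
      unfolding P_def by (subst (asm) nn_integral_0_iff_AE) auto
    then have "AE h :: real^'d in lborel. False" by eventually_elim (simp add: prior_def)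
    then have "emeasure lborel (UNIV :: (real^'d) set) = 0"
      using AE_iff_measurable[of UNIV "lborel :: (real^'d) measure" "\<lambda>_. False"] by simp
    then show False by simp
  qed
  have G_fin: "G < top"
    unfolding G_def quad_exp_def Q_def
    using nn_integral_exp_quadratic(1)[OF pos_def_posterior_form[of \<kappa>]] \<kappa> by simp
  have A_fin: "A < top"
  proof -
    have "A \<le> (\<integral>\<^sup>+z. ennreal b * quad_exp Q z \<partial>lborel)"
      unfolding A_def using l0 by (intro nn_integral_mono mult_right_mono ennreal_leI) auto
    also have "\<dots> = ennreal b * G" unfolding G_def by (rule nn_integral_cmult) measurable
    also have "\<dots> < top" using G_fin by (simp add: ennreal_mult_less_top)
    finally show ?thesis .
  qed
  have main: "A \<le> ennreal (exp (2 * \<epsilon>)) * (G * V)" if \<epsilon>: "\<epsilon> > 0" for \<epsilon>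
  proof -
    \<comment> \<open>Lower limit of the mass on which the approximation is usable; by
      \<open>good_lower\<close> it is close to 1 once M is large, for each h.\<close>
    define w where "w M h = liminf (\<lambda>T. good M \<epsilon> T h)" for M h
    have [measurable]: "w M \<in> borel_measurable borel" for M
      unfolding w_def by measurable
    have [measurable]: "cball (0 :: real^'d) c \<in> sets borel" for c
      by (simp add: borel_closed)
    have [measurable]: "(\<lambda>h. prior h * good M \<epsilon> T h) \<in> borel_measurable borel" for M T
      by (intro borel_measurable_times_ennreal) (auto simp: good_meas)
    define p where "p = ennreal (exp \<epsilon>) * G"
    define q where "q = ennreal (exp \<epsilon>) * G * (ennreal (exp \<epsilon>) * P)"
    have pq_fin: "p < top" "q < top"
      using G_fin P_fin by (auto simp: p_def q_def ennreal_mult_less_top)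
    define tail where "tail M c = (\<integral>\<^sup>+h. indicator (- cball 0 c) h * env M h \<partial>lborel)" for M c
    have tail_fin: "tail M c < top" for M c
      by (rule le_less_trans[OF _ env_fin[of M]]) (auto simp: tail_def indicator_def intro!: nn_integral_mono)
    \<comment> \<open>T tends to infinity: Fatou's lemma on the left, dominated convergence with
      envelope \<open>env M\<close> for the large remainders on the right.\<close>
    have cut: "A * (\<integral>\<^sup>+h. indicator (cball 0 c) h * (prior h * w M h) \<partial>lborel) \<le> q * V + p * (ennreal b * tail M c)" for M c
    proof -
      have "A * (\<integral>\<^sup>+h. indicator (cball 0 c) h * (prior h * w M h) \<partial>lborel)
        \<le> A * (\<integral>\<^sup>+h. liminf (\<lambda>T. indicator (cball 0 c) h * (prior h * good M \<epsilon> T h)) \<partial>lborel)"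
      proof (intro mult_left_mono nn_integral_mono)
        fix h :: "real^'d"
        have "liminf (\<lambda>T. (indicator (cball 0 c) h * prior h) * good M \<epsilon> T h) = (indicator (cball 0 c) h * prior h) * w M h"
          unfolding w_def by (rule liminf_cmult_ennreal) (auto simp: prior_def indicator_def)
        then show "indicator (cball 0 c) h * (prior h * w M h) \<le> liminf (\<lambda>T. indicator (cball 0 c) h * (prior h * good M \<epsilon> T h))"
          by (simp only: mult.assoc order_refl)
      qed auto
      also have "\<dots> \<le> A * liminf (\<lambda>T. \<integral>\<^sup>+h. indicator (cball 0 c) h * (prior h * good M \<epsilon> T h) \<partial>lborel)"
        by (intro mult_left_mono nn_integral_liminf; (measurable | simp))
      also have "\<dots> = liminf (\<lambda>T. A * (\<integral>\<^sup>+h. indicator (cball 0 c) h * (prior h * good M \<epsilon> T h) \<partial>lborel))"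
        by (rule liminf_cmult_ennreal[symmetric]) (rule A_fin)
      also have "\<dots> \<le> q * liminf (bayes_sup e l c) + p * (ennreal b * 0 + ennreal b * tail M c)"
      proof (rule liminf_le_affine)
        show "A * (\<integral>\<^sup>+h. indicator (cball 0 c) h * (prior h * good M \<epsilon> T h) \<partial>lborel)
          \<le> q * bayes_sup e l c T + p * (ennreal b * (\<integral>\<^sup>+h. env M h * bad \<epsilon> T h \<partial>lborel) + ennreal b * tail M c)" for T
          using bayes_risk_inequality[OF W b \<kappa> \<epsilon>, where M=M and c=c and T=T and e=e]
          unfolding A_def G_def P_def p_def q_def tail_def l_def Q_def prior_def env_def
          by (simp only: distrib_left mult.assoc add.assoc)
        have "(\<lambda>T. \<integral>\<^sup>+h. env M h * bad \<epsilon> T h \<partial>lborel) \<longlonglongrightarrow> (\<integral>\<^sup>+h. 0 \<partial>(lborel :: (real^'d) measure))"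
        proof (rule nn_integral_dominated_convergence[where w="env M"])
          show "AE h in lborel. env M h * bad \<epsilon> T h \<le> env M h" for T
            using mult_left_mono[OF bad_le_1, of "env M _"] by simp
          have "(\<lambda>T. env M h * bad \<epsilon> T h) \<longlonglongrightarrow> env M h * 0" for h
            by (intro ennreal_tendsto_cmult bad_lim \<epsilon>) (simp add: env_def)
          then show "AE h in lborel. (\<lambda>T. env M h * bad \<epsilon> T h) \<longlonglongrightarrow> 0" by simp
        qed (use env_fin in auto)
        then have "(\<lambda>T. \<integral>\<^sup>+h. env M h * bad \<epsilon> T h \<partial>lborel) \<longlonglongrightarrow> 0" by simp
        then show "(\<lambda>T. p * (ennreal b * (\<integral>\<^sup>+h. env M h * bad \<epsilon> T h \<partial>lborel) + ennreal b * tail M c))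
          \<longlonglongrightarrow> p * (ennreal b * 0 + ennreal b * tail M c)"
          using pq_fin by (intro ennreal_tendsto_cmult tendsto_add tendsto_const) auto
      qed (use pq_fin tail_fin in \<open>auto simp: ennreal_mult_less_top\<close>)
      also have "\<dots> \<le> q * V + p * (ennreal b * tail M c)"
        unfolding V_def by (intro add_mono mult_left_mono SUP_upper) auto
      finally show ?thesis .
    qed
    \<comment> \<open>The radius tends to infinity: the left side increases to the integral over the
      whole space, and the tail of the integrable envelope vanishes.\<close>
    have uncut: "A * (\<integral>\<^sup>+h. prior h * w M h \<partial>lborel) \<le> q * V" for M
    proof (rule LIMSEQ_le)
      have "(\<lambda>n. \<integral>\<^sup>+h. indicator (cball 0 (real n)) h * (prior h * w M h) \<partial>lborel) \<longlonglongrightarrow> (SUP n. \<integral>\<^sup>+h. indicator (cball 0 (real n)) h * (prior h * w M h) \<partial>lborel)"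
        by (intro LIMSEQ_SUP) (auto simp: incseq_def indicator_def intro!: nn_integral_mono)
      also have "(SUP n. \<integral>\<^sup>+h. indicator (cball 0 (real n)) h * (prior h * w M h) \<partial>lborel) = (\<integral>\<^sup>+h. (SUP n. indicator (cball 0 (real n)) h * (prior h * w M h)) \<partial>lborel)"
        by (intro nn_integral_monotone_convergence_SUP[symmetric]) (auto simp: incseq_def le_fun_def indicator_def)
      also have "\<dots> = (\<integral>\<^sup>+h. prior h * w M h \<partial>lborel)"
      proof (intro nn_integral_cong antisym)
        fix h :: "real^'d"
        show "(SUP n. indicator (cball 0 (real n)) h * (prior h * w M h)) \<le> prior h * w M h"
          by (intro SUP_least) (auto simp: indicator_def)
        obtain n :: nat where "norm h \<le> real n" using real_arch_simple by blast
        then show "prior h * w M h \<le> (SUP n. indicator (cball 0 (real n)) h * (prior h * w M h))"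
          by (intro SUP_upper2[of n]) auto
      qed
      finally show "(\<lambda>n. A * (\<integral>\<^sup>+h. indicator (cball 0 (real n)) h * (prior h * w M h) \<partial>lborel)) \<longlonglongrightarrow> A * (\<integral>\<^sup>+h. prior h * w M h \<partial>lborel)"
        by (rule ennreal_tendsto_cmult[OF A_fin])
      have "(\<lambda>n. tail M (real n)) \<longlonglongrightarrow> (\<integral>\<^sup>+h. 0 \<partial>(lborel :: (real^'d) measure))"
        unfolding tail_def
      proof (rule nn_integral_dominated_convergence[where w="env M"])
        have "eventually (\<lambda>n. indicator (- cball 0 (real n)) h * env M h = 0) sequentially" for h :: "real^'d"
        proof -
          obtain n0 :: nat where "norm h \<le> real n0" using real_arch_simple by blast
          then have "norm h \<le> real n" if "n \<ge> n0" for n using that by linarith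
          then show ?thesis by (intro eventually_sequentiallyI[of n0]) auto
        qed
        then show "AE h in lborel. (\<lambda>n. indicator (- cball 0 (real n)) h * env M h) \<longlonglongrightarrow> 0"
          by (simp add: tendsto_eventually)
      qed (use env_fin in \<open>auto simp: indicator_def\<close>)
      then have "(\<lambda>n. q * V + p * (ennreal b * tail M (real n))) \<longlonglongrightarrow> q * V + p * (ennreal b * 0)"
        using pq_fin by (intro ennreal_tendsto_cmult tendsto_add tendsto_const) auto
      then show "(\<lambda>n. q * V + p * (ennreal b * tail M (real n))) \<longlonglongrightarrow> q * V" by simp
    qed (use cut in auto)
    \<comment> \<open>M tends to infinity: by Fatou's lemma the whole mass P of the prior is
      recovered on the left, and it cancels against the factor P contained in q.\<close>
    have "P \<le> (\<integral>\<^sup>+h. liminf (\<lambda>n. prior h * w (real n) h) \<partial>lborel)"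
      unfolding P_def
    proof (intro nn_integral_mono)
      fix h :: "real^'d"
      have "1 \<le> liminf (\<lambda>n. w (real n) h)"
      proof (rule ennreal_le_epsilon)
        fix \<delta> :: real assume \<delta>: "\<delta> > 0"
        obtain M0 where M0: "\<And>M. M \<ge> M0 \<Longrightarrow> ennreal (1 - \<delta>) \<le> w M h"
          using good_lower[OF \<epsilon> \<delta>] unfolding w_def by blast
        obtain n0 :: nat where n0: "M0 \<le> real n0" using real_arch_simple by blast
        have "ennreal (1 - \<delta>) \<le> liminf (\<lambda>n. w (real n) h)"
          using n0 by (intro Liminf_bounded eventually_sequentiallyI[of n0] M0) linarith
        then have "ennreal (1 - \<delta>) + ennreal \<delta> \<le> liminf (\<lambda>n. w (real n) h) + ennreal \<delta>"
          by (rule add_right_mono)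
        moreover have "(1::ennreal) \<le> ennreal (1 - \<delta>) + ennreal \<delta>"
          using \<delta> by (cases "\<delta> \<le> 1") (auto simp: ennreal_plus[symmetric] ennreal_ge_1 add_increasing simp del: ennreal_plus)
        ultimately show "1 \<le> liminf (\<lambda>n. w (real n) h) + ennreal \<delta>" by (rule order_trans[rotated])
      qed
      then have "prior h * 1 \<le> prior h * liminf (\<lambda>n. w (real n) h)" by (rule mult_left_mono) simp
      also have "\<dots> = liminf (\<lambda>n. prior h * w (real n) h)"
        by (rule liminf_cmult_ennreal[symmetric]) (simp add: prior_def)
      finally show "prior h \<le> liminf (\<lambda>n. prior h * w (real n) h)" by simp
    qed
    also have "\<dots> \<le> liminf (\<lambda>n. \<integral>\<^sup>+h. prior h * w (real n) h \<partial>lborel)"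
      by (rule nn_integral_liminf) measurable
    finally have "A * P \<le> A * liminf (\<lambda>n. \<integral>\<^sup>+h. prior h * w (real n) h \<partial>lborel)"
      by (rule mult_left_mono) simp
    also have "\<dots> = liminf (\<lambda>n. A * (\<integral>\<^sup>+h. prior h * w (real n) h \<partial>lborel))"
      by (rule liminf_cmult_ennreal[symmetric]) (rule A_fin)
    also have "\<dots> \<le> liminf (\<lambda>n::nat. q * V)"
      by (intro Liminf_mono always_eventually allI uncut)
    also have "\<dots> = q * V" by (simp add: Liminf_const)
    also have "\<dots> = (ennreal (exp (2 * \<epsilon>)) * (G * V)) * P"
    proof -
      have "ennreal (exp (2 * \<epsilon>)) = ennreal (exp \<epsilon>) * ennreal (exp \<epsilon>)"
        by (simp add: ennreal_mult[symmetric] exp_add[symmetric])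
      then show ?thesis by (simp only: q_def ac_simps)
    qed
    finally show ?thesis
      using P_pos P_fin by (rule ennreal_mult_right_le_cancel)
  qed
  \<comment> \<open>\<epsilon> tends to 0 along 1 / (n + 1). An infinite right side is excluded
    first, as multiplication by it would not be continuous in \<open>ennreal\<close>.\<close>
  have "A \<le> G * V"
  proof (cases "G * V = top")
    case False
    have "(\<lambda>n. exp (2 * (1 / real (Suc n)))) \<longlonglongrightarrow> exp (2 * 0)"
      by (intro tendsto_intros LIMSEQ_Suc[OF lim_1_over_n])
    then have "(\<lambda>n. (G * V) * ennreal (exp (2 * (1 / real (Suc n))))) \<longlonglongrightarrow> (G * V) * ennreal (exp (2 * 0))"
      using False by (intro ennreal_tendsto_cmult tendsto_ennrealI) (auto simp: less_top)
    then have "A \<le> (G * V) * ennreal (exp (2 * 0))"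
    proof (rule LIMSEQ_le_const)
      have "A \<le> (G * V) * ennreal (exp (2 * (1 / real (Suc n))))" for n
        using main[of "1 / real (Suc n)"] by (simp only: mult.commute zero_less_divide_1_iff of_nat_0_less_iff zero_less_Suc)
      then show "\<exists>N. \<forall>n\<ge>N. A \<le> (G * V) * ennreal (exp (2 * (1 / real (Suc n))))" by blast
    qed
    then show ?thesis by simp
  qed simp
  then show ?thesis unfolding A_def G_def V_def .
qed

text \<open>The precision \<kappa> = 1 / (n + 1) decreases to 0, so the unnormalised posterior
  densities increase to \<open>quad_exp J\<close>. Monotone convergence handles the left side, and
  on the right they are bounded by their limit.\<close>

theorem asymptotic_minimax:
  assumes W: "bowl_shaped W" and b: "b > 0"
  shows "(\<integral>\<^sup>+z. ennreal (min b (W z)) * quad_exp J z \<partial>lborel)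
    \<le> (\<integral>\<^sup>+z. quad_exp J z \<partial>lborel) * (SUP c. liminf (bayes_sup e (\<lambda>u. min b (W u)) c))"
proof -
  note [measurable] = bowl_shaped_borel[OF W]
  define V where "V = (SUP c. liminf (bayes_sup e (\<lambda>u. min b (W u)) c))"
  define Q where "Q n = posterior_form (1 / real (Suc n))" for n
  have Q: "quad_exp (Q n) z = quad_exp J z * ennreal (exp (- (z \<bullet> z) / (2 * real (Suc n))))" for n z
  proof -
    have "- (z \<bullet> (Q n *v z)) / 2 = - (z \<bullet> (J *v z)) / 2 + - (z \<bullet> z) / (2 * real (Suc n))"
    proof -
      have "- (a + 1 / k * c) / 2 = - a / 2 + - c / (2 * k)" if "k > 0" for a c k :: real
        using that by (simp add: field_simps)
      from this[of "real (Suc n)"] show ?thesis unfolding Q_def posterior_form_quad by (simp only: of_nat_0_less_iff zero_less_Suc)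
    qed
    then show ?thesis unfolding quad_exp_def by (simp only: exp_add ennreal_mult exp_ge_zero)
  qed
  have le: "quad_exp (Q n) z \<le> quad_exp J z" for n z
  proof -
    have "quad_exp J z * ennreal (exp (- (z \<bullet> z) / (2 * real (Suc n)))) \<le> quad_exp J z * 1"
      by (rule mult_left_mono) auto
    then show ?thesis by (simp add: Q)
  qed
  have inc: "quad_exp (Q m) z \<le> quad_exp (Q n) z" if "m \<le> n" for m n z
    unfolding Q using that by (intro mult_left_mono ennreal_leI) (auto intro!: divide_left_mono mult_pos_pos)
  have lim: "(SUP n. quad_exp (Q n) z) = quad_exp J z" for z
  proof -
    have "(\<lambda>n. exp (- (z \<bullet> z) / 2 * (1 / real (Suc n)))) \<longlonglongrightarrow> exp (- (z \<bullet> z) / 2 * 0)"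
      by (intro tendsto_intros LIMSEQ_Suc[OF lim_1_over_n])
    then have "(\<lambda>n. quad_exp J z * ennreal (exp (- (z \<bullet> z) / 2 * (1 / real (Suc n))))) \<longlonglongrightarrow> quad_exp J z * ennreal (exp (- (z \<bullet> z) / 2 * 0))"
      by (intro ennreal_tendsto_cmult tendsto_ennrealI) (auto simp: quad_exp_def)
    then have "(\<lambda>n. quad_exp (Q n) z) \<longlonglongrightarrow> quad_exp J z" by (simp add: Q)
    moreover have "(\<lambda>n. quad_exp (Q n) z) \<longlonglongrightarrow> (SUP n. quad_exp (Q n) z)"
      using inc by (intro LIMSEQ_SUP) (auto simp: incseq_def)
    ultimately show ?thesis by (rule LIMSEQ_unique[symmetric])
  qed
  have "(\<integral>\<^sup>+z. ennreal (min b (W z)) * quad_exp J z \<partial>lborel) = (\<integral>\<^sup>+z. (SUP n. ennreal (min b (W z)) * quad_exp (Q n) z) \<partial>lborel)"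
    unfolding lim[symmetric] by (simp only: SUP_mult_left_ennreal)
  also have "\<dots> = (SUP n. \<integral>\<^sup>+z. ennreal (min b (W z)) * quad_exp (Q n) z \<partial>lborel)"
    using inc by (intro nn_integral_monotone_convergence_SUP) (auto simp: incseq_def le_fun_def intro!: mult_left_mono)
  also have "\<dots> \<le> (\<integral>\<^sup>+z. quad_exp J z \<partial>lborel) * V"
  proof (rule SUP_least)
    fix n
    have "(\<integral>\<^sup>+z. ennreal (min b (W z)) * quad_exp (Q n) z \<partial>lborel) \<le> (\<integral>\<^sup>+z. quad_exp (Q n) z \<partial>lborel) * V"
      unfolding V_def Q_def by (rule bayes_sup_bound[OF W b]) simp
    also have "\<dots> \<le> (\<integral>\<^sup>+z. quad_exp J z \<partial>lborel) * V"
      by (intro mult_right_mono nn_integral_mono le) auto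
    finally show "(\<integral>\<^sup>+z. ennreal (min b (W z)) * quad_exp (Q n) z \<partial>lborel) \<le> (\<integral>\<^sup>+z. quad_exp J z \<partial>lborel) * V" .
  qed
  finally show ?thesis unfolding V_def .
qed

end

section \<open>Likelihood of a trajectory\<close>

text \<open>Conditional probability of the gate value g given the past x, with the uniform noise
  integrated out. The set stays inside {0..1} because the gating maps are measurable only
  there.\<close>

definition gate_prob :: "(nat \<Rightarrow> (bool \<times> bool) list \<Rightarrow> real \<Rightarrow> bool) \<Rightarrow> nat \<Rightarrow> (bool \<times> bool) list \<Rightarrow> bool \<Rightarrow> real" where
  "gate_prob \<Phi> t x g = measure (uniform_measure lborel {0..1}) {u \<in> {0..1}. \<Phi> t x u = g}"

text \<open>Conditional weight of the event bit given the gate: a closed gate forces no event,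
  because Y is the product of G and Z. At an open gate it is the Bernoulli mass, so
  \<open>obs_prob q (True, b)\<close> also serves as the law of Z.\<close>

definition obs_prob :: "real \<Rightarrow> bool \<times> bool \<Rightarrow> real" where
  "obs_prob q z = (if fst z then (if snd z then q else 1 - q) else (if snd z then 0 else 1))"

text \<open>Chain rule for the law of a trajectory. Only the \<open>obs_prob\<close> factors involve
  q, so the gate factors are common to all parameters.\<close>

definition likelihood :: "(nat \<Rightarrow> (bool \<times> bool) list \<Rightarrow> real \<Rightarrow> bool) \<Rightarrow> (nat \<Rightarrow> real) \<Rightarrow> (bool \<times> bool) list \<Rightarrow> real" where
  "likelihood \<Phi> q x = (\<Prod>t<length x. gate_prob \<Phi> t (take t x) (fst (x ! t)) * obs_prob (q t) (x ! t))"

lemma likelihood_Nil [simp]: "likelihood \<Phi> q [] = 1"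
  by (simp add: likelihood_def)

lemma likelihood_snoc:
  "likelihood \<Phi> q (x @ [z]) = likelihood \<Phi> q x * (gate_prob \<Phi> (length x) x (fst z) * obs_prob (q (length x)) z)"
  by (simp add: likelihood_def nth_append)

lemma gate_set_measurable:
  fixes \<Phi> :: "nat \<Rightarrow> (bool \<times> bool) list \<Rightarrow> real \<Rightarrow> bool"
  assumes "(\<lambda>(x, u). \<Phi> t x u) \<in> measurable (trajectory_space t \<Otimes>\<^sub>M restrict_space borel {0..1}) (count_space UNIV)"
    and "length x = t"
  shows "{u \<in> {0..1}. \<Phi> t x u = g} \<in> sets borel"
proof -
  have "(\<lambda>u. (x, u)) \<in> measurable (restrict_space borel {0..1}) (trajectory_space t \<Otimes>\<^sub>M restrict_space borel {0..1})"
    using assms(2) by (intro measurable_Pair1') simp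
  from measurable_compose[OF this assms(1)]
  have "(\<lambda>u. \<Phi> t x u) \<in> measurable (restrict_space borel {0..1::real}) (count_space UNIV)"
    by simp
  then have "(\<lambda>u. \<Phi> t x u) -` {g} \<inter> space (restrict_space borel {0..1}) \<in> sets (restrict_space borel {0..1})"
    by (rule measurable_sets) simp
  then have "{u \<in> {0..1}. \<Phi> t x u = g} \<in> sets (restrict_space borel {0..1})"
    by (simp add: vimage_def space_restrict_space Int_def conj_commute)
  then show ?thesis by (simp add: sets_restrict_space_iff)
qed

lemma prob_space_uniform_01: "prob_space (uniform_measure lborel {0..1::real})"
  by (rule prob_space_uniform_measure) auto

lemma gate_prob_sum:
  assumes "(\<lambda>(x, u). \<Phi> t x u) \<in> measurable (trajectory_space t \<Otimes>\<^sub>M restrict_space borel {0..1}) (count_space UNIV)"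
    and "length x = t"
  shows "gate_prob \<Phi> t x True + gate_prob \<Phi> t x False = 1"
proof -
  interpret prob_space "uniform_measure lborel {0..1::real}" by (rule prob_space_uniform_01)
  have "gate_prob \<Phi> t x True + gate_prob \<Phi> t x False = prob ({u \<in> {0..1}. \<Phi> t x u = True} \<union> {u \<in> {0..1}. \<Phi> t x u = False})"
    unfolding gate_prob_def
  proof (rule finite_measure_Union[symmetric])
    show "{u \<in> {0..1}. \<Phi> t x u = True} \<in> sets (uniform_measure lborel {0..1})"
      "{u \<in> {0..1}. \<Phi> t x u = False} \<in> sets (uniform_measure lborel {0..1})"
      using gate_set_measurable[where \<Phi>=\<Phi>, OF assms] by (simp_all only: sets_uniform_measure sets_lborel)
  qed auto
  also have "{u \<in> {0..1}. \<Phi> t x u = True} \<union> {u \<in> {0..1}. \<Phi> t x u = False} = {0..1}" by auto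
  also have "prob {0..1} = 1" by (simp add: measure_def)
  finally show ?thesis .
qed

lemma trajectory_Suc: "trajectory G Y (Suc t) \<omega> = trajectory G Y t \<omega> @ [(G t \<omega>, Y t \<omega>)]"
  by (simp add: trajectory_def)

lemma length_trajectory [simp]: "length (trajectory G Y t \<omega>) = t"
  by (simp add: trajectory_def)

lemma trajectory_nth: "s < t \<Longrightarrow> trajectory G Y t \<omega> ! s = (G s \<omega>, Y s \<omega>)"
  by (simp add: trajectory_def)

lemma trajectory_measurable:
  assumes "\<And>s. G s \<in> measurable M (count_space UNIV)" "\<And>s. Y s \<in> measurable M (count_space UNIV)"
  shows "trajectory G Y t \<in> measurable M (trajectory_space t)"
proof (rule measurableI)
  fix A assume "A \<in> sets (trajectory_space t)"
  then have A: "A \<subseteq> {x. length x = t}" by simp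
  have "finite {x :: (bool \<times> bool) list. length x = t}"
    using finite_lists_length_eq[of "UNIV :: (bool \<times> bool) set" t] by simp
  then have fin: "finite A" using A by (rule rev_finite_subset)
  note [measurable] = assms
  have "{\<omega> \<in> space M. trajectory G Y t \<omega> = x} \<in> sets M" if "x \<in> A" for x
  proof -
    have "trajectory G Y t \<omega> = x \<longleftrightarrow> (\<forall>s<t. (G s \<omega>, Y s \<omega>) = x ! s)" for \<omega>
      using that A by (auto simp: list_eq_iff_nth_eq trajectory_nth)
    then have "{\<omega> \<in> space M. trajectory G Y t \<omega> = x} = {\<omega> \<in> space M. \<forall>s\<in>{..<t}. G s \<omega> = fst (x ! s) \<and> Y s \<omega> = snd (x ! s)}"
      by (auto simp: prod_eq_iff)
    also have "\<dots> \<in> sets M"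
      by measurable
    finally show ?thesis .
  qed
  then have "(\<Union>x\<in>A. {\<omega> \<in> space M. trajectory G Y t \<omega> = x}) \<in> sets M"
    using fin by (intro sets.finite_UN) auto
  also have "(\<Union>x\<in>A. {\<omega> \<in> space M. trajectory G Y t \<omega> = x}) = trajectory G Y t -` A \<inter> space M" by auto
  finally show "trajectory G Y t -` A \<inter> space M \<in> sets M" .
qed simp

text \<open>The future event indicators are carried along so that the induction over time shows at once
  that they stay independent of the past.\<close>
lemma trajectory_future_prob:
  fixes M :: "'w measure"
  assumes law: "ded_law D q \<Phi> M G Y"
    and \<Phi>: "\<And>t. (\<lambda>(x, u). \<Phi> t x u) \<in> measurable (trajectory_space t \<Otimes>\<^sub>M restrict_space borel {0..1}) (count_space UNIV)"
    and q: "\<And>t. 0 \<le> q t \<and> q t \<le> 1"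
  shows "\<exists>Z. \<forall>t x n z. length x = t \<longrightarrow> measure M {\<omega> \<in> space M. trajectory G Y t \<omega> = x \<and> (\<forall>i<n. Z (t + i) \<omega> = z i)}
      = likelihood \<Phi> q x * (\<Prod>i<n. obs_prob (q (t + i)) (True, z i))"
proof -
  interpret prob_space M using law by (simp add: ded_law_def)
  from law have GY: "\<And>t. G t \<in> measurable M (count_space UNIV)" "\<And>t. Y t \<in> measurable M (count_space UNIV)"
    by (auto simp: ded_law_def)
  from law obtain Z where Z: "indep_vars (\<lambda>_. count_space UNIV) Z UNIV"
    and Zq: "\<And>t. distr M (count_space UNIV) (Z t) = measure_pmf (bernoulli_pmf (q t))"
    and Y: "\<And>t. AE \<omega> in M. Y t \<omega> \<longleftrightarrow> G t \<omega> \<and> Z t \<omega>"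
    and U: "\<And>t. \<exists>U :: 'w \<Rightarrow> real. U \<in> borel_measurable M \<and>
        distr M borel U = uniform_measure lborel {0..1} \<and>
        indep_rvs M borel U
          ((\<Pi>\<^sub>M s\<in>UNIV. count_space UNIV) \<Otimes>\<^sub>M trajectory_space t)
          (\<lambda>\<omega>. ((\<lambda>s. Z s \<omega>), trajectory G Y t \<omega>)) \<and>
        (AE \<omega> in M. G t \<omega> \<longleftrightarrow> \<Phi> t (trajectory G Y t \<omega>) (U \<omega>))"
    unfolding ded_law_def by blast
  have Zm [measurable]: "Z i \<in> measurable M (count_space UNIV)" for i
    using Z by (auto simp: indep_vars_def)
  have ZP: "prob (Z i -` {b} \<inter> space M) = obs_prob (q i) (True, b)" for i b
  proof -
    have "prob (Z i -` {b} \<inter> space M) = measure (distr M (count_space UNIV) (Z i)) {b}"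
      by (subst measure_distr) auto
    also have "\<dots> = pmf (bernoulli_pmf (q i)) b" unfolding Zq by (simp add: measure_pmf_single)
    also have "\<dots> = obs_prob (q i) (True, b)"
      using q[of i] by (cases b) (auto simp: obs_prob_def)
    finally show ?thesis .
  qed
  have trm [measurable]: "trajectory G Y t \<in> measurable M (trajectory_space t)" for t
    using trajectory_measurable GY .
  have "prob {\<omega> \<in> space M. trajectory G Y t \<omega> = x \<and> (\<forall>i<n. Z (t + i) \<omega> = z i)}
      = likelihood \<Phi> q x * (\<Prod>i<n. obs_prob (q (t + i)) (True, z i))" if "length x = t" for t x n z
    using that
  proof (induction t arbitrary: x n z)
    case 0
    show ?case
    \<comment> \<open>The product rule for independent variables is stated for a nonempty index set,
      so n = 0 is treated apart.\<close>
    proof (cases "n = 0")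
      case True
      then show ?thesis using 0 by (simp add: trajectory_def prob_space)
    next
      case False
      have "{\<omega> \<in> space M. trajectory G Y 0 \<omega> = x \<and> (\<forall>i<n. Z (0 + i) \<omega> = z i)} = (\<Inter>i\<in>{..<n}. Z i -` {z i} \<inter> space M)"
        using False 0 by (auto simp: trajectory_def)
      then show ?thesis
        using indep_varsD[OF Z, of "{..<n}" "\<lambda>i. {z i}"] False 0 by (simp add: ZP lessThan_empty_iff)
    qed
  next
    case (Suc t)
    obtain x' g y where x: "x = x' @ [(g, y)]" and x': "length x' = t"
      using Suc.prems by (metis length_Suc_conv_rev prod.collapse)
    from U[of t] obtain U :: "'w \<Rightarrow> real" where Um [measurable]: "U \<in> borel_measurable M"
      and Uu: "distr M borel U = uniform_measure lborel {0..1}"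
      and Ui: "indep_rvs M borel U ((\<Pi>\<^sub>M s\<in>UNIV. count_space UNIV) \<Otimes>\<^sub>M trajectory_space t)
          (\<lambda>\<omega>. ((\<lambda>s. Z s \<omega>), trajectory G Y t \<omega>))"
      and UG: "AE \<omega> in M. G t \<omega> \<longleftrightarrow> \<Phi> t (trajectory G Y t \<omega>) (U \<omega>)"
      by blast
    define B where "B = {u \<in> {0..1}. \<Phi> t x' u = g}"
    have B: "B \<in> sets borel" unfolding B_def by (rule gate_set_measurable[where \<Phi>=\<Phi>, OF \<Phi> x'])
    have U01: "AE \<omega> in M. U \<omega> \<in> {0..1}"
    proof -
      have "AE u in distr M borel U. u \<in> {0..1}"
        unfolding Uu by (rule AE_uniform_measureI) auto
      then show ?thesis by (subst (asm) AE_distr_iff) auto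
    qed
    \<comment> \<open>An event about the sequence Z and the past before t only. The gating noise is
      independent of that pair, so the probability factors into the gate factor and the probability
      of E.\<close>
    define E where "E = {\<omega> \<in> space M. trajectory G Y t \<omega> = x' \<and> (y \<longleftrightarrow> g \<and> Z t \<omega>) \<and> (\<forall>i<n. Z (Suc t + i) \<omega> = z i)}"
    have "prob {\<omega> \<in> space M. trajectory G Y (Suc t) \<omega> = x \<and> (\<forall>i<n. Z (Suc t + i) \<omega> = z i)} = prob ((U -` B \<inter> space M) \<inter> E)"
    proof (rule finite_measure_eq_AE)
      show "AE \<omega> in M. \<omega> \<in> {\<omega> \<in> space M. trajectory G Y (Suc t) \<omega> = x \<and> (\<forall>i<n. Z (Suc t + i) \<omega> = z i)} \<longleftrightarrow> \<omega> \<in> (U -` B \<inter> space M) \<inter> E"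
        using UG U01 Y[of t]
      proof eventually_elim
        case (elim \<omega>)
        then show ?case unfolding x E_def B_def trajectory_Suc by auto
      qed
      show "{\<omega> \<in> space M. trajectory G Y (Suc t) \<omega> = x \<and> (\<forall>i<n. Z (Suc t + i) \<omega> = z i)} \<in> sets M"
        using Suc.prems by measurable
      show "(U -` B \<inter> space M) \<inter> E \<in> sets M"
        unfolding E_def using B x' by measurable
    qed
    also have "\<dots> = prob (U -` B \<inter> space M) * prob E"
    proof (rule indep_setD)
      show "indep_set (sigma_sets (space M) {U -` A \<inter> space M |A. A \<in> sets borel})
        (sigma_sets (space M) {(\<lambda>\<omega>. ((\<lambda>s. Z s \<omega>), trajectory G Y t \<omega>)) -` A \<inter> space M |A. A \<in> sets ((\<Pi>\<^sub>M s\<in>UNIV. count_space UNIV) \<Otimes>\<^sub>M trajectory_space t)})"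
        using Ui by (simp add: indep_rvs_def)
      show "U -` B \<inter> space M \<in> sigma_sets (space M) {U -` A \<inter> space M |A. A \<in> sets borel}"
        using B by (intro sigma_sets.Basic) auto
      let ?N = "(\<Pi>\<^sub>M s\<in>(UNIV::nat set). count_space (UNIV::bool set)) \<Otimes>\<^sub>M trajectory_space t"
      define F where "F = {p \<in> space ?N. snd p = x' \<and> (y \<longleftrightarrow> g \<and> fst p t) \<and> (\<forall>i<n. fst p (Suc t + i) = z i)}"
      have "F \<in> sets ?N" unfolding F_def using x' by measurable
      moreover have "E = (\<lambda>\<omega>. ((\<lambda>s. Z s \<omega>), trajectory G Y t \<omega>)) -` F \<inter> space M"
        by (auto simp: E_def F_def space_pair_measure space_PiM)
      ultimately show "E \<in> sigma_sets (space M) {(\<lambda>\<omega>. ((\<lambda>s. Z s \<omega>), trajectory G Y t \<omega>)) -` A \<inter> space M |A. A \<in> sets ?N}"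
        by (intro sigma_sets.Basic) auto
    qed
    also have "prob (U -` B \<inter> space M) = gate_prob \<Phi> t x' g"
      unfolding gate_prob_def B_def[symmetric] Uu[symmetric] using B by (subst measure_distr) auto
    also have "prob E = likelihood \<Phi> q x' * (obs_prob (q t) (g, y) * (\<Prod>i<n. obs_prob (q (Suc t + i)) (True, z i)))"
    proof -
      \<comment> \<open>The current indicator becomes the head of the future sequence, via
        \<open>case_nat\<close>, and the induction hypothesis applies with n + 1 future
        values.\<close>
      define E0 where "E0 b = {\<omega> \<in> space M. trajectory G Y t \<omega> = x' \<and> (\<forall>i<Suc n. Z (t + i) \<omega> = case_nat b z i)}" for b
      have E0: "E0 b = {\<omega> \<in> space M. trajectory G Y t \<omega> = x' \<and> Z t \<omega> = b \<and> (\<forall>i<n. Z (Suc t + i) \<omega> = z i)}" for b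
        unfolding E0_def by (auto simp: All_less_Suc2)
      have E0m: "E0 b \<in> sets M" for b
        unfolding E0 using x' by measurable
      have P0: "prob (E0 b) = likelihood \<Phi> q x' * (obs_prob (q t) (True, b) * (\<Prod>i<n. obs_prob (q (Suc t + i)) (True, z i)))" for b
        unfolding E0_def Suc.IH[OF x'] by (simp add: prod.lessThan_Suc_shift del: prod.lessThan_Suc)
      show ?thesis
      proof (cases g)
        case True
        then have "E = E0 y" unfolding E_def E0 by auto
        then show ?thesis using P0 True by simp
      next
        case False
        show ?thesis
        proof (cases y)
          case True
          then have "E = {}" using False by (auto simp: E_def)
          then show ?thesis using True False by (simp add: obs_prob_def)
        next
          case y: False
          \<comment> \<open>With the gate closed the observation does not reveal the current
            indicator; its two values are added and their weights q t and 1 - q t sum to 1.\<close>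
          have "E = E0 True \<union> E0 False" using False y unfolding E_def E0 by auto
          moreover have "E0 True \<inter> E0 False = {}" unfolding E0 by auto
          ultimately have "prob E = prob (E0 True) + prob (E0 False)"
            using finite_measure_Union[OF E0m E0m] by metis
          then show ?thesis unfolding P0 using False y by (simp add: obs_prob_def algebra_simps)
        qed
      qed
    qed
    finally show ?case
      unfolding x likelihood_snoc by (simp add: x' ac_simps)
  qed
  then show ?thesis by blast
qed

lemma finite_trajectories: "finite {x :: (bool \<times> bool) list. length x = T}"
  using finite_lists_length_eq[of "UNIV :: (bool \<times> bool) set" T] by simp

lemma
  assumes law: "ded_law D q \<Phi> M G Y"
    and \<Phi>: "\<And>t. (\<lambda>(x, u). \<Phi> t x u) \<in> measurable (trajectory_space t \<Otimes>\<^sub>M restrict_space borel {0..1}) (count_space UNIV)"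
    and q: "\<And>t. 0 \<le> q t \<and> q t \<le> 1"
  shows nn_integral_obs_law: "(\<integral>\<^sup>+x. F x \<partial>obs_law M G Y T) = (\<Sum>x\<in>{x. length x = T}. ennreal (likelihood \<Phi> q x) * F x)"
    and measure_trajectory: "measure M {\<omega> \<in> space M. P (trajectory G Y T \<omega>)} = (\<Sum>x\<in>{x. length x = T \<and> P x}. likelihood \<Phi> q x)"
proof -
  interpret prob_space M using law by (simp add: ded_law_def)
  from law have GY: "\<And>t. G t \<in> measurable M (count_space UNIV)" "\<And>t. Y t \<in> measurable M (count_space UNIV)"
    by (auto simp: ded_law_def)
  note [measurable] = trajectory_measurable[OF GY]
  obtain Z where Z: "\<And>t x n z. length x = t \<Longrightarrow> measure M {\<omega> \<in> space M. trajectory G Y t \<omega> = x \<and> (\<forall>i<n. Z (t + i) \<omega> = z i)}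
      = likelihood \<Phi> q x * (\<Prod>i<n. obs_prob (q (t + i)) (True, z i))"
    using trajectory_future_prob[where \<Phi>=\<Phi>, OF law \<Phi> q] by blast
  \<comment> \<open>An empty future, n = 0, leaves the point masses of the trajectory.\<close>
  have single: "prob {\<omega> \<in> space M. trajectory G Y T \<omega> = x} = likelihood \<Phi> q x" if "length x = T" for x
    using Z[OF that, of 0] by simp
  have em: "emeasure (obs_law M G Y T) {x} = ennreal (likelihood \<Phi> q x)" if "length x = T" for x
  proof -
    have "emeasure (obs_law M G Y T) {x} = emeasure M (trajectory G Y T -` {x} \<inter> space M)"
      unfolding obs_law_def using that by (subst emeasure_distr) auto
    also have "trajectory G Y T -` {x} \<inter> space M = {\<omega> \<in> space M. trajectory G Y T \<omega> = x}" by auto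
    finally show ?thesis using single[OF that] by (simp add: emeasure_eq_measure)
  qed
  have "obs_law M G Y T = point_measure {x. length x = T} (\<lambda>x. ennreal (likelihood \<Phi> q x))"
  proof (rule measure_eqI_finite[where A="{x. length x = T}"])
    show "sets (obs_law M G Y T) = Pow {x. length x = T}" by (simp add: obs_law_def)
    fix x :: "(bool \<times> bool) list" assume "x \<in> {x. length x = T}"
    then show "emeasure (obs_law M G Y T) {x} = emeasure (point_measure {x. length x = T} (\<lambda>x. ennreal (likelihood \<Phi> q x))) {x}"
      using em[of x] by (subst emeasure_point_measure_finite) (auto simp: finite_trajectories)
  qed (auto simp: sets_point_measure finite_trajectories)
  then show "(\<integral>\<^sup>+x. F x \<partial>obs_law M G Y T) = (\<Sum>x\<in>{x. length x = T}. ennreal (likelihood \<Phi> q x) * F x)"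
    by (simp add: nn_integral_point_measure_finite finite_trajectories)
  have "{\<omega> \<in> space M. P (trajectory G Y T \<omega>)} = (\<Union>x\<in>{x. length x = T \<and> P x}. {\<omega> \<in> space M. trajectory G Y T \<omega> = x})"
    by auto
  also have "prob \<dots> = (\<Sum>x\<in>{x. length x = T \<and> P x}. prob {\<omega> \<in> space M. trajectory G Y T \<omega> = x})"
    by (rule finite_measure_finite_Union)
      (auto simp: disjoint_family_on_def intro: finite_subset[OF _ finite_trajectories[of T]])
  also have "\<dots> = (\<Sum>x\<in>{x. length x = T \<and> P x}. likelihood \<Phi> q x)"
    by (intro sum.cong) (auto simp: single)
  finally show "measure M {\<omega> \<in> space M. P (trajectory G Y T \<omega>)} = (\<Sum>x\<in>{x. length x = T \<and> P x}. likelihood \<Phi> q x)" .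
qed

section \<open>Averaging over the gating law one step at a time\<close>

locale gating =
  fixes \<Phi> :: "nat \<Rightarrow> (bool \<times> bool) list \<Rightarrow> real \<Rightarrow> bool"
  assumes gating_measurable: "\<And>t. (\<lambda>(x, u). \<Phi> t x u)
    \<in> measurable (trajectory_space t \<Otimes>\<^sub>M restrict_space borel {0..1}) (count_space UNIV)"
begin

lemma gate_prob_nonneg: "0 \<le> gate_prob \<Phi> t x g"
  by (simp add: gate_prob_def)

lemma gate_prob_total: "length x = t \<Longrightarrow> gate_prob \<Phi> t x True + gate_prob \<Phi> t x False = 1"
  by (rule gate_prob_sum[OF gating_measurable])

lemma likelihood_nonneg: "(\<And>t. 0 \<le> q t \<and> q t \<le> 1) \<Longrightarrow> 0 \<le> likelihood \<Phi> q x"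
  unfolding likelihood_def by (intro prod_nonneg mult_nonneg_nonneg gate_prob_nonneg) (auto simp: obs_prob_def)

lemma sum_trajectories_Suc:
  fixes F :: "(bool \<times> bool) list \<Rightarrow> 'b::comm_monoid_add"
  shows "(\<Sum>x\<in>{x. length x = Suc T}. F x) = (\<Sum>x\<in>{x. length x = T}. \<Sum>z\<in>UNIV. F (x @ [z]))"
proof -
  have "(\<Sum>x\<in>{x. length x = T}. \<Sum>z\<in>UNIV. F (x @ [z])) = (\<Sum>(x, z)\<in>{x. length x = T} \<times> UNIV. F (x @ [z]))"
    by (rule sum.cartesian_product)
  also have "\<dots> = (\<Sum>x\<in>{x. length x = Suc T}. F x)"
    by (rule sum.reindex_bij_witness[where i="\<lambda>x. (butlast x, last x)" and j="\<lambda>(x, z). x @ [z]"])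
      (auto simp flip: length_0_conv)
  finally show ?thesis by simp
qed

lemma sum_UNIV_obs: "(\<Sum>z\<in>UNIV. F z) = F (True, True) + F (True, False) + (F (False, True) + F (False, False))"
  for F :: "bool \<times> bool \<Rightarrow> 'b::comm_monoid_add"
  by (simp add: UNIV_Times_UNIV[symmetric] sum.cartesian_product[symmetric] UNIV_bool del: UNIV_Times_UNIV) (simp add: ac_simps)

text \<open>The bound is required for the open and the closed gate separately. An unknown gate
  probability depending on the past then only averages two quantities below \<open>B x\<close>. The
  outcome (False, True) has weight 0.\<close>

lemma likelihood_step_le:
  assumes q: "\<And>t. 0 \<le> q t \<and> q t \<le> 1"
    and step: "\<And>x. length x = T \<Longrightarrow> q T * F (x @ [(True, True)]) + (1 - q T) * F (x @ [(True, False)]) \<le> B x"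
      "\<And>x. length x = T \<Longrightarrow> F (x @ [(False, False)]) \<le> B x"
  shows "(\<Sum>x\<in>{x. length x = Suc T}. likelihood \<Phi> q x * F x) \<le> (\<Sum>x\<in>{x. length x = T}. likelihood \<Phi> q x * B x)"
  unfolding sum_trajectories_Suc
proof (rule sum_mono)
  fix x :: "(bool \<times> bool) list" assume "x \<in> {x. length x = T}"
  then have x: "length x = T" by simp
  have "(\<Sum>z\<in>UNIV. likelihood \<Phi> q (x @ [z]) * F (x @ [z])) =
    likelihood \<Phi> q x * (gate_prob \<Phi> T x True * (q T * F (x @ [(True, True)]) + (1 - q T) * F (x @ [(True, False)]))
      + gate_prob \<Phi> T x False * F (x @ [(False, False)]))"
    unfolding sum_UNIV_obs likelihood_snoc by (simp add: obs_prob_def x algebra_simps)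
  also have "\<dots> \<le> likelihood \<Phi> q x * (gate_prob \<Phi> T x True * B x + gate_prob \<Phi> T x False * B x)"
    using step[OF x] by (intro mult_left_mono add_mono gate_prob_nonneg likelihood_nonneg q)
  also have "\<dots> = likelihood \<Phi> q x * B x"
    using gate_prob_total[OF x] by (simp add: distrib_right[symmetric])
  finally show "(\<Sum>z\<in>UNIV. likelihood \<Phi> q (x @ [z]) * F (x @ [z])) \<le> likelihood \<Phi> q x * B x" .
qed

lemma likelihood_total: "(\<Sum>x\<in>{x. length x = T}. likelihood \<Phi> q x) = 1"
proof (induction T)
  case 0
  have "{x :: (bool \<times> bool) list. length x = 0} = {[]}" by auto
  then show ?case by simp
next
  case (Suc T)
  have "(\<Sum>z\<in>UNIV. likelihood \<Phi> q (x @ [z])) = likelihood \<Phi> q x" if "length x = T" for x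
  proof -
    have "(\<Sum>z\<in>UNIV. likelihood \<Phi> q (x @ [z])) = likelihood \<Phi> q x * (gate_prob \<Phi> T x True + gate_prob \<Phi> T x False)"
      unfolding sum_UNIV_obs likelihood_snoc by (simp add: obs_prob_def that algebra_simps)
    then show ?thesis using gate_prob_total[OF that] by simp
  qed
  then show ?case unfolding sum_trajectories_Suc using Suc.IH by simp
qed

end

section \<open>Phase counts and the log-likelihood ratio\<close>

definition open_count :: "nat \<Rightarrow> nat \<Rightarrow> (bool \<times> bool) list \<Rightarrow> real" where
  "open_count K r x = (\<Sum>t<length x. of_bool (t mod K = r \<and> fst (x ! t)))"

definition event_count :: "nat \<Rightarrow> nat \<Rightarrow> (bool \<times> bool) list \<Rightarrow> real" where
  "event_count K r x = (\<Sum>t<length x. of_bool (t mod K = r \<and> fst (x ! t) \<and> snd (x ! t)))"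

lemma open_count_snoc: "open_count K r (x @ [z]) = open_count K r x + of_bool (length x mod K = r \<and> fst z)"
  by (simp add: open_count_def nth_append)

lemma event_count_snoc: "event_count K r (x @ [z]) = event_count K r x + of_bool (length x mod K = r \<and> fst z \<and> snd z)"
  by (simp add: event_count_def nth_append)

lemma open_count_bounds: "0 \<le> open_count K r x" "open_count K r x \<le> real (length x)"
proof -
  show "0 \<le> open_count K r x" unfolding open_count_def by (intro sum_nonneg) auto
  have "open_count K r x \<le> (\<Sum>t<length x. 1)" unfolding open_count_def by (intro sum_mono) auto
  then show "open_count K r x \<le> real (length x)" by simp
qed

definition centred_count :: "nat \<Rightarrow> real \<Rightarrow> nat \<Rightarrow> (bool \<times> bool) list \<Rightarrow> real" where
  "centred_count K p r x = event_count K r x - p * open_count K r x"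

text \<open>Increments have conditional mean 0, and conditional variance p * (1 - p) at an open gate
  of the phase and 0 otherwise. The second moment thus grows by at most 1 per step, whatever the
  gates do.\<close>

lemma (in gating) centred_count_second_moment:
  assumes q: "\<And>t. 0 \<le> q t \<and> q t \<le> 1" and p: "\<And>t. t mod K = r \<Longrightarrow> q t = p"
  shows "(\<Sum>x\<in>{x. length x = T}. likelihood \<Phi> q x * (centred_count K p r x)\<^sup>2) \<le> real T"
proof (induction T)
  case 0
  have "{x :: (bool \<times> bool) list. length x = 0} = {[]}" by auto
  then show ?case by (simp add: centred_count_def event_count_def open_count_def)
next
  case (Suc T)
  have "(\<Sum>x\<in>{x. length x = Suc T}. likelihood \<Phi> q x * (centred_count K p r x)\<^sup>2) \<le>
    (\<Sum>x\<in>{x. length x = T}. likelihood \<Phi> q x * ((centred_count K p r x)\<^sup>2 + 1))"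
  proof (rule likelihood_step_le[OF q])
    fix x :: "(bool \<times> bool) list" assume x: "length x = T"
    let ?s = "centred_count K p r x"
    show "(centred_count K p r (x @ [(False, False)]))\<^sup>2 \<le> ?s\<^sup>2 + 1"
      by (simp add: centred_count_def open_count_snoc event_count_snoc)
    show "q T * (centred_count K p r (x @ [(True, True)]))\<^sup>2 + (1 - q T) * (centred_count K p r (x @ [(True, False)]))\<^sup>2 \<le> ?s\<^sup>2 + 1"
    proof (cases "T mod K = r")
      case True
      have s: "centred_count K p r (x @ [(True, True)]) = ?s + (1 - p)" "centred_count K p r (x @ [(True, False)]) = ?s - p"
        using True x by (simp_all add: centred_count_def open_count_snoc event_count_snoc algebra_simps)
      have "p * (?s + (1 - p))\<^sup>2 + (1 - p) * (?s - p)\<^sup>2 = ?s\<^sup>2 + p * (1 - p)"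
        by (simp add: power2_eq_square algebra_simps)
      moreover have "p * (1 - p) \<le> 1" using q[of T] p[OF True] by (simp add: mult_le_one)
      ultimately show ?thesis unfolding s p[OF True] by simp
    next
      case False
      then have s: "centred_count K p r (x @ [(True, b)]) = ?s" for b
        using x by (simp add: centred_count_def open_count_snoc event_count_snoc)
      show ?thesis unfolding s by (simp add: algebra_simps)
    qed
  qed
  also have "\<dots> = (\<Sum>x\<in>{x. length x = T}. likelihood \<Phi> q x * (centred_count K p r x)\<^sup>2) + 1"
    by (simp add: distrib_left sum.distrib likelihood_total)
  finally show ?case using Suc.IH by simp
qed

text \<open>Logarithm of the likelihood ratio between rates a and a0. An event contributes the log
  ratio of the event probabilities; an open gate without event contributes - (a r - a0 r), as its
  probability is exp (- a r).\<close>

definition log_ratio :: "nat \<Rightarrow> (nat \<Rightarrow> real) \<Rightarrow> (nat \<Rightarrow> real) \<Rightarrow> (bool \<times> bool) list \<Rightarrow> real" where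
  "log_ratio K a a0 x = (\<Sum>r<K. event_count K r x * ln ((1 - exp (- a r)) / (1 - exp (- a0 r)))
     - (open_count K r x - event_count K r x) * (a r - a0 r))"

lemma log_ratio_snoc:
  assumes "K \<ge> 1"
  shows "log_ratio K a a0 (x @ [z]) = log_ratio K a a0 x + (let r = length x mod K in
    if fst z then (if snd z then ln ((1 - exp (- a r)) / (1 - exp (- a0 r))) else - (a r - a0 r)) else 0)"
proof -
  let ?r = "length x mod K"
  let ?d = "if fst z then (if snd z then ln ((1 - exp (- a ?r)) / (1 - exp (- a0 ?r))) else - (a ?r - a0 ?r)) else 0"
  have r: "?r \<in> {..<K}" using assms by simp
  have "log_ratio K a a0 (x @ [z]) = (\<Sum>r<K. (event_count K r x * ln ((1 - exp (- a r)) / (1 - exp (- a0 r)))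
     - (open_count K r x - event_count K r x) * (a r - a0 r)) + (if r = ?r then ?d else 0))"
    unfolding log_ratio_def by (intro sum.cong refl) (auto simp: open_count_snoc event_count_snoc algebra_simps)
  also have "\<dots> = log_ratio K a a0 x + ?d"
    unfolding log_ratio_def using r by (simp add: sum.distrib)
  finally show ?thesis by (simp add: Let_def)
qed

text \<open>Doob decomposition: each event count is split into its martingale part and p times the
  open count. The coefficient of the martingale is of first order in d. That of the open count is
  minus the Kullback-Leibler divergence of two Bernoulli laws, hence of second order.\<close>

lemma log_ratio_eq:
  "log_ratio K a a0 x = (\<Sum>r<K. let p = 1 - exp (- a0 r); d = a r - a0 r; l = ln ((1 - exp (- a r)) / (1 - exp (- a0 r))) in
     centred_count K p r x * (l + d) + open_count K r x * (p * l - (1 - p) * d))"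
  unfolding log_ratio_def by (intro sum.cong refl) (simp add: centred_count_def Let_def algebra_simps)

context gating
begin

text \<open>The gate factors agree on both sides, so at each step only the ratio of the two
  \<open>obs_prob\<close> factors has to be matched.\<close>

lemma likelihood_log_ratio:
  assumes K: "K \<ge> 1" and a: "\<And>r. r < K \<Longrightarrow> a r > 0" and a0: "\<And>r. r < K \<Longrightarrow> a0 r > 0"
  shows "likelihood \<Phi> (\<lambda>t. 1 - exp (- a (t mod K))) x = likelihood \<Phi> (\<lambda>t. 1 - exp (- a0 (t mod K))) x * exp (log_ratio K a a0 x)"
proof (induction x rule: rev_induct)
  case Nil
  show ?case by (simp add: log_ratio_def open_count_def event_count_def)
next
  case (snoc z x)
  let ?r = "length x mod K"
  have r: "?r < K" using K by simp
  have pos: "1 - exp (- a ?r) > 0" "1 - exp (- a0 ?r) > 0" using a[OF r] a0[OF r] by auto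
  have e: "exp (- (a ?r - a0 ?r)) = exp (- a ?r) / exp (- a0 ?r)"
    by (simp add: exp_diff[symmetric])
  have "obs_prob (1 - exp (- a ?r)) z = obs_prob (1 - exp (- a0 ?r)) z * exp (let r = ?r in
    if fst z then (if snd z then ln ((1 - exp (- a r)) / (1 - exp (- a0 r))) else - (a r - a0 r)) else 0)"
    using pos by (simp add: obs_prob_def Let_def e del: minus_diff_eq)
  then show ?case
    unfolding likelihood_snoc snoc.IH log_ratio_snoc[OF K] exp_add by simp
qed

text \<open>At an open gate the squared ratio has conditional mean 1 plus the chi-square divergence
  of the two Bernoulli laws; at a closed gate the ratio does not change. This gives (1 + \<nu>)^T,
  which stays bounded when \<nu> is of order 1 / T.\<close>

lemma ratio_second_moment:
  fixes \<nu> :: real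
  assumes K: "K \<ge> 1" and a: "\<And>r. r < K \<Longrightarrow> a r > 0" and a0: "\<And>r. r < K \<Longrightarrow> a0 r > 0"
    and \<nu>: "\<And>r. r < K \<Longrightarrow> (exp (- a r) - exp (- a0 r))\<^sup>2 / ((1 - exp (- a0 r)) * exp (- a0 r)) \<le> \<nu>" "\<nu> \<ge> 0"
  shows "(\<Sum>x\<in>{x. length x = T}. likelihood \<Phi> (\<lambda>t. 1 - exp (- a0 (t mod K))) x * (exp (log_ratio K a a0 x))\<^sup>2) \<le> exp (real T * \<nu>)"
proof -
  let ?q = "\<lambda>t. 1 - exp (- a0 (t mod K))"
  have q: "0 \<le> ?q t \<and> ?q t \<le> 1" for t using a0[of "t mod K"] K by simp
  have "(\<Sum>x\<in>{x. length x = T}. likelihood \<Phi> ?q x * (exp (log_ratio K a a0 x))\<^sup>2) \<le> (1 + \<nu>) ^ T"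
  proof (induction T)
    case 0
    have "{x :: (bool \<times> bool) list. length x = 0} = {[]}" by auto
    then show ?case by (simp add: log_ratio_def open_count_def event_count_def)
  next
    case (Suc T)
    have "(\<Sum>x\<in>{x. length x = Suc T}. likelihood \<Phi> ?q x * (exp (log_ratio K a a0 x))\<^sup>2) \<le>
      (\<Sum>x\<in>{x. length x = T}. likelihood \<Phi> ?q x * ((exp (log_ratio K a a0 x))\<^sup>2 * (1 + \<nu>)))"
    proof (rule likelihood_step_le[OF q])
      fix x :: "(bool \<times> bool) list" assume x: "length x = T"
      let ?L = "log_ratio K a a0 x"
      let ?r = "T mod K"
      have r: "?r < K" using K by simp
      define p p0 where "p = exp (- a ?r)" and "p0 = exp (- a0 ?r)"
      have pos: "0 < p" "0 < p0" "p < 1" "p0 < 1" using a[OF r] a0[OF r] by (auto simp: p_def p0_def)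
      show "(exp (log_ratio K a a0 (x @ [(False, False)])))\<^sup>2 \<le> (exp ?L)\<^sup>2 * (1 + \<nu>)"
        unfolding log_ratio_snoc[OF K] using \<nu>(2) by (simp add: mult_le_cancel_left1)
      have e1: "exp (log_ratio K a a0 (x @ [(True, True)])) = exp ?L * ((1 - p) / (1 - p0))"
        unfolding log_ratio_snoc[OF K] exp_add using pos by (simp add: x Let_def p_def p0_def)
      have e2: "exp (log_ratio K a a0 (x @ [(True, False)])) = exp ?L * (p / p0)"
        unfolding log_ratio_snoc[OF K] exp_add by (simp add: x Let_def p_def p0_def exp_diff[symmetric])
      have "?q T * (exp (log_ratio K a a0 (x @ [(True, True)])))\<^sup>2 + (1 - ?q T) * (exp (log_ratio K a a0 (x @ [(True, False)])))\<^sup>2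
        = (exp ?L)\<^sup>2 * ((1 - p0) * ((1 - p) / (1 - p0))\<^sup>2 + p0 * (p / p0)\<^sup>2)"
        unfolding e1 e2 p0_def[symmetric] power_mult_distrib by (simp only: diff_diff_eq2 add_diff_cancel_left' distrib_left ac_simps)
      also have "(1 - p0) * ((1 - p) / (1 - p0))\<^sup>2 + p0 * (p / p0)\<^sup>2 = 1 + (p - p0)\<^sup>2 / ((1 - p0) * p0)"
        using pos by (simp add: power2_eq_square divide_simps) (simp add: algebra_simps)
      also have "(exp ?L)\<^sup>2 * \<dots> \<le> (exp ?L)\<^sup>2 * (1 + \<nu>)"
        using \<nu>(1)[OF r] by (intro mult_left_mono) (auto simp: p_def p0_def)
      finally show "?q T * (exp (log_ratio K a a0 (x @ [(True, True)])))\<^sup>2 + (1 - ?q T) * (exp (log_ratio K a a0 (x @ [(True, False)])))\<^sup>2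
        \<le> (exp ?L)\<^sup>2 * (1 + \<nu>)" .
    qed
    also have "\<dots> = (\<Sum>x\<in>{x. length x = T}. likelihood \<Phi> ?q x * (exp (log_ratio K a a0 x))\<^sup>2) * (1 + \<nu>)"
      by (simp add: sum_distrib_right mult.assoc)
    also have "\<dots> \<le> (1 + \<nu>) ^ T * (1 + \<nu>)"
      using Suc.IH \<nu>(2) by (intro mult_right_mono) auto
    finally show ?case by (simp add: mult.commute)
  qed
  also have "\<dots> \<le> (exp \<nu>) ^ T"
    using \<nu>(2) by (intro power_mono exp_ge_add_one_self) auto
  also have "\<dots> = exp (real T * \<nu>)" by (simp add: exp_of_nat_mult)
  finally show ?thesis .
qed

end

section \<open>Taylor expansion of the log-likelihood coefficients\<close>

text \<open>Caratheodory's form of the derivative, f z = g z * z with g continuous at 0, avoids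
  division at indices where u vanishes.\<close>

lemma log_odds_first_order:
  assumes "(\<lambda>n. s n * u n) \<longlonglongrightarrow> d" "u \<longlonglongrightarrow> 0" and f: "(f has_real_derivative D) (at 0)" "f 0 = 0"
  shows "(\<lambda>n. s n * f (u n)) \<longlonglongrightarrow> D * d"
proof -
  obtain g where g: "\<And>z. f z - f 0 = g z * (z - 0)" "isCont g 0" "g 0 = D"
    using f(1) unfolding CARAT_DERIV by blast
  have "(\<lambda>n. g (u n)) \<longlonglongrightarrow> g 0"
    using g(2) assms(2) by (rule isCont_tendsto_compose)
  then have "(\<lambda>n. g (u n) * (s n * u n)) \<longlonglongrightarrow> D * d"
    unfolding g(3) by (intro tendsto_mult assms)
  moreover have "s n * f (u n) = g (u n) * (s n * u n)" for n
    using g(1)[of "u n"] f(2) by simp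
  ultimately show ?thesis by (simp only:)
qed

text \<open>The quotient f z / z^2 is filled in by c at 0, again to allow indices with u equal to
  0.\<close>

lemma second_order_limit:
  fixes s u :: "nat \<Rightarrow> real"
  assumes "(\<lambda>n. s n * u n) \<longlonglongrightarrow> d" "u \<longlonglongrightarrow> 0" and f: "((\<lambda>z. f z / z\<^sup>2) \<longlongrightarrow> c) (at 0)" "f 0 = 0"
  shows "(\<lambda>n. (s n)\<^sup>2 * f (u n)) \<longlonglongrightarrow> c * d\<^sup>2"
proof -
  define g where "g z = (if z = 0 then c else f z / z\<^sup>2)" for z
  have "isCont g 0"
    unfolding isCont_def using f(1) by (simp add: g_def cong: Lim_cong_within) 
  then have "(\<lambda>n. g (u n)) \<longlonglongrightarrow> g 0"
    using assms(2) by (rule isCont_tendsto_compose)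
  then have "(\<lambda>n. g (u n) * (s n * u n)\<^sup>2) \<longlonglongrightarrow> c * d\<^sup>2"
    by (intro tendsto_mult tendsto_power assms) (simp add: g_def)
  moreover have "(s n)\<^sup>2 * f (u n) = g (u n) * (s n * u n)\<^sup>2" for n
    using f(2) by (simp add: g_def power_mult_distrib)
  ultimately show ?thesis by simp
qed

text \<open>With p = 1 - exp (- l) the linear terms cancel, because p times the derivative of ln p
  is exp (- l). What remains is minus half the coefficient (1 - p) / p of the Fisher information of
  a phase.\<close>

lemma log_odds_second_order:
  fixes l :: real
  assumes "l > 0"
  shows "((\<lambda>z. ((1 - exp (- l)) * ln ((1 - exp (- (l + z))) / (1 - exp (- l))) - exp (- l) * z) / z\<^sup>2)
    \<longlongrightarrow> - (exp (- l) / (1 - exp (- l))) / 2) (at 0)"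
proof -
  have ne: "1 - exp (- l) \<noteq> 0" using assms by simp
  show ?thesis
    using assms by real_asymp (use ne in \<open>simp_all add: divide_simps\<close>, use ne in \<open>simp_all add: algebra_simps\<close>)
qed

section \<open>Local asymptotic normality\<close>

text \<open>Convergence to 0 in probability on finite spaces that change with T; w gives the point
  masses.\<close>

definition vanishes :: "(nat \<Rightarrow> 'x set) \<Rightarrow> (nat \<Rightarrow> 'x \<Rightarrow> real) \<Rightarrow> (nat \<Rightarrow> 'x \<Rightarrow> real) \<Rightarrow> bool" where
  "vanishes X w u \<longleftrightarrow> (\<forall>\<epsilon>>0. (\<lambda>T. \<Sum>x\<in>{x \<in> X T. \<bar>u T x\<bar> > \<epsilon>}. w T x) \<longlonglongrightarrow> 0)"

locale weighted_sets =
  fixes X :: "nat \<Rightarrow> 'x set" and w :: "nat \<Rightarrow> 'x \<Rightarrow> real"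
  assumes finite_X: "\<And>T. finite (X T)" and w_nonneg: "\<And>T x. 0 \<le> w T x"
begin

lemma vanishes_cong:
  assumes "eventually (\<lambda>T. \<forall>x\<in>X T. u T x = v T x) sequentially" "vanishes X w v"
  shows "vanishes X w u"
  unfolding vanishes_def
proof (intro allI impI)
  fix \<epsilon> :: real assume "\<epsilon> > 0"
  then have "(\<lambda>T. \<Sum>x\<in>{x \<in> X T. \<bar>v T x\<bar> > \<epsilon>}. w T x) \<longlonglongrightarrow> 0"
    using assms(2) by (auto simp: vanishes_def)
  moreover have "eventually (\<lambda>T. (\<Sum>x\<in>{x \<in> X T. \<bar>v T x\<bar> > \<epsilon>}. w T x) = (\<Sum>x\<in>{x \<in> X T. \<bar>u T x\<bar> > \<epsilon>}. w T x)) sequentially"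
    using assms(1) by eventually_elim (intro sum.cong, auto)
  ultimately show "(\<lambda>T. \<Sum>x\<in>{x \<in> X T. \<bar>u T x\<bar> > \<epsilon>}. w T x) \<longlonglongrightarrow> 0"
    by (rule Lim_transform_eventually)
qed

lemma vanishes_add:
  assumes "vanishes X w u" "vanishes X w v"
  shows "vanishes X w (\<lambda>T x. u T x + v T x)"
  unfolding vanishes_def
proof (intro allI impI)
  fix \<epsilon> :: real assume \<epsilon>: "\<epsilon> > 0"
  let ?s = "\<lambda>u T \<epsilon>. \<Sum>x\<in>{x \<in> X T. \<bar>u T x\<bar> > \<epsilon>}. w T x"
  have "(\<lambda>T. ?s u T (\<epsilon>/2) + ?s v T (\<epsilon>/2)) \<longlonglongrightarrow> 0 + 0"
    using assms \<epsilon> by (intro tendsto_add assms[unfolded vanishes_def, rule_format]) simp_all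
  moreover have "?s (\<lambda>T x. u T x + v T x) T \<epsilon> \<le> ?s u T (\<epsilon>/2) + ?s v T (\<epsilon>/2)" for T
  proof -
    have "?s (\<lambda>T x. u T x + v T x) T \<epsilon> \<le> sum (w T) ({x \<in> X T. \<bar>u T x\<bar> > \<epsilon>/2} \<union> {x \<in> X T. \<bar>v T x\<bar> > \<epsilon>/2})"
      by (intro sum_mono2) (auto simp: finite_X w_nonneg)
    also have "\<dots> \<le> ?s u T (\<epsilon>/2) + ?s v T (\<epsilon>/2)"
      by (subst sum.union_inter[symmetric]) (auto simp: finite_X intro!: sum_nonneg w_nonneg)
    finally show ?thesis .
  qed
  ultimately show "(\<lambda>T. ?s (\<lambda>T x. u T x + v T x) T \<epsilon>) \<longlonglongrightarrow> 0"
  proof (intro tendsto_sandwich[where f="\<lambda>_. 0" and g="\<lambda>T. ?s (\<lambda>T x. u T x + v T x) T \<epsilon>" and h="\<lambda>T. ?s u T (\<epsilon>/2) + ?s v T (\<epsilon>/2)"])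
    show "eventually (\<lambda>T. 0 \<le> ?s (\<lambda>T x. u T x + v T x) T \<epsilon>) sequentially"
      by (intro always_eventually allI sum_nonneg w_nonneg)
  qed (simp_all add: always_eventually)
qed

lemma vanishes_sum:
  assumes "finite I" "\<And>i. i \<in> I \<Longrightarrow> vanishes X w (u i)"
  shows "vanishes X w (\<lambda>T x. \<Sum>i\<in>I. u i T x)"
  using assms
proof (induction I rule: finite_induct)
  case empty
  then show ?case by (simp add: vanishes_def)
next
  case (insert i I)
  then show ?case using vanishes_add[of "u i"] by simp
qed

lemma vanishes_mult_const:
  assumes "vanishes X w u" shows "vanishes X w (\<lambda>T x. u T x * k)"
proof (cases "k = 0")
  case True
  then show ?thesis by (simp add: vanishes_def)
next
  case False
  have "{x \<in> X T. \<bar>u T x * k\<bar> > \<epsilon>} = {x \<in> X T. \<bar>u T x\<bar> > \<epsilon> / \<bar>k\<bar>}" for T \<epsilon>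
    using False by (auto simp: abs_mult field_simps)
  then show ?thesis using assms False by (simp add: vanishes_def)
qed

text \<open>Chebyshev's inequality: a quantity bounded in mean square, times a deterministic null
  sequence, is negligible.\<close>

lemma vanishes_second_moment:
  assumes "\<And>T. (\<Sum>x\<in>X T. w T x * (u T x)\<^sup>2) \<le> C" and c: "c \<longlonglongrightarrow> 0"
  shows "vanishes X w (\<lambda>T x. u T x * c T)"
  unfolding vanishes_def
proof (intro allI impI)
  fix \<epsilon> :: real assume \<epsilon>: "\<epsilon> > 0"
  let ?s = "\<lambda>T. \<Sum>x\<in>{x \<in> X T. \<bar>u T x * c T\<bar> > \<epsilon>}. w T x"
  have "(\<lambda>T. C * (c T)\<^sup>2 / \<epsilon>\<^sup>2) \<longlonglongrightarrow> C * 0\<^sup>2 / \<epsilon>\<^sup>2"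
    using \<epsilon> by (intro tendsto_intros c) auto
  moreover have "?s T \<le> C * (c T)\<^sup>2 / \<epsilon>\<^sup>2" for T
  proof -
    have "?s T \<le> (\<Sum>x\<in>{x \<in> X T. \<bar>u T x * c T\<bar> > \<epsilon>}. w T x * (u T x)\<^sup>2 * (c T)\<^sup>2 / \<epsilon>\<^sup>2)"
    proof (rule sum_mono)
      fix x assume "x \<in> {x \<in> X T. \<bar>u T x * c T\<bar> > \<epsilon>}"
      then have "\<epsilon>\<^sup>2 \<le> \<bar>u T x * c T\<bar>\<^sup>2" using \<epsilon> by (intro power_mono) auto
      then have "1 \<le> (u T x)\<^sup>2 * (c T)\<^sup>2 / \<epsilon>\<^sup>2" using \<epsilon> by (simp add: power_mult_distrib)
      from mult_left_mono[OF this w_nonneg[of T x]]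
      show "w T x \<le> w T x * (u T x)\<^sup>2 * (c T)\<^sup>2 / \<epsilon>\<^sup>2" by (simp add: mult.assoc)
    qed
    also have "\<dots> \<le> (\<Sum>x\<in>X T. w T x * (u T x)\<^sup>2 * (c T)\<^sup>2 / \<epsilon>\<^sup>2)"
      by (intro sum_mono2) (auto simp: finite_X w_nonneg)
    also have "\<dots> = (\<Sum>x\<in>X T. w T x * (u T x)\<^sup>2) * (c T)\<^sup>2 / \<epsilon>\<^sup>2"
      by (simp add: sum_distrib_right sum_divide_distrib)
    also have "\<dots> \<le> C * (c T)\<^sup>2 / \<epsilon>\<^sup>2"
      by (intro divide_right_mono mult_right_mono assms) auto
    finally show ?thesis .
  qed
  ultimately show "?s \<longlonglongrightarrow> 0"
  proof (intro tendsto_sandwich[where f="\<lambda>_. 0" and g="?s" and h="\<lambda>T. C * (c T)\<^sup>2 / \<epsilon>\<^sup>2"])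
    show "eventually (\<lambda>T. 0 \<le> ?s T) sequentially" by (intro always_eventually allI sum_nonneg w_nonneg)
  qed (simp_all add: always_eventually)
qed

end

section \<open>Gating frequencies along a phase\<close>

text \<open>The upper limit is the ceiling of (T - r) / K. Adding K - 1 before subtracting r keeps
  the natural-number difference exact, even when T \<le> r.\<close>

lemma sum_phase:
  fixes F :: "nat \<Rightarrow> real"
  assumes r: "r < K"
  shows "(\<Sum>t<T. of_bool (t mod K = r) * F t) = (\<Sum>l<(T + K - 1 - r) div K. F (r + l * K))"
proof -
  have "(\<Sum>t<T. of_bool (t mod K = r) * F t) = (\<Sum>t\<in>{t \<in> {..<T}. t mod K = r}. F t)"
  proof -
    have "(\<Sum>t<T. of_bool (t mod K = r) * F t) = (\<Sum>t<T. if t mod K = r then F t else 0)"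
      by (intro sum.cong) auto
    then show ?thesis by (simp only: sum.inter_filter[OF finite_lessThan])
  qed
  also have "\<dots> = (\<Sum>l<(T + K - 1 - r) div K. F (r + l * K))"
  proof (rule sum.reindex_bij_witness[where i="\<lambda>l. r + l * K" and j="\<lambda>t. t div K"])
    fix t assume "t \<in> {t \<in> {..<T}. t mod K = r}"
    then have t: "t < T" "r = t mod K" by auto
    then show e: "r + t div K * K = t" by simp
    have "(t div K + 1) * K \<le> T + K - 1 - r" using t(1) e r by (simp add: algebra_simps)
    then show "t div K \<in> {..<(T + K - 1 - r) div K}"
      using r by (simp add: Suc_le_eq[symmetric] less_eq_div_iff_mult_less_eq)
    show "F (r + t div K * K) = F t" using e by simp
  next
    fix l assume "l \<in> {..<(T + K - 1 - r) div K}"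
    then have "(l + 1) * K \<le> T + K - 1 - r"
      using r by (simp add: Suc_le_eq[symmetric] less_eq_div_iff_mult_less_eq)
    then show "r + l * K \<in> {t \<in> {..<T}. t mod K = r}" using r by (simp add: algebra_simps)
    show "(r + l * K) div K = l" using r by simp
  qed
  finally show ?thesis .
qed

lemma phase_count_bounds:
  fixes K r T :: nat
  assumes r: "r < K"
  defines "L \<equiv> (T + K - 1 - r) div K"
  shows "real L * real K \<le> real T + real K" "real T \<le> real L * real K + real K"
proof -
  have "L * K \<le> T + K - 1 - r" unfolding L_def by simp
  then have "L * K \<le> T + K" by linarith
  then have "real (L * K) \<le> real (T + K)" by (simp only: of_nat_le_iff)
  then show "real L * real K \<le> real T + real K" by simp
  have "T + K - 1 - r < (L + 1) * K"
    unfolding L_def using r dividend_less_div_times[of K "T + K - 1 - r"] by (simp add: algebra_simps)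
  then have "T \<le> L * K + K" using r by simp
  then have "real T \<le> real (L * K + K)" by (simp only: of_nat_le_iff)
  then show "real T \<le> real L * real K + real K" by simp
qed

lemma open_count_trajectory:
  assumes "r < K"
  shows "open_count K r (trajectory G Y T \<omega>) = (\<Sum>l<(T + K - 1 - r) div K. of_bool (G (r + l * K) \<omega>))"
proof -
  have "open_count K r (trajectory G Y T \<omega>) = (\<Sum>t<T. of_bool (t mod K = r) * of_bool (G t \<omega>))"
    unfolding open_count_def length_trajectory by (intro sum.cong) (auto simp: trajectory_nth)
  also have "\<dots> = (\<Sum>l<(T + K - 1 - r) div K. of_bool (G (r + l * K) \<omega>))"
    by (rule sum_phase[OF assms])
  finally show ?thesis .
qed

text \<open>The assumed frequencies average over the number of visits to phase r, whereas the
  likelihood normalises by T. The number of visits times K differs from T by at most K, so the two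
  averages differ by at most 1 / T after the factor 1 / K.\<close>

lemma (in gating) open_frequency_vanishes:
  assumes law: "ded_law D q \<Phi> M G Y" and q: "\<And>t. 0 \<le> q t \<and> q t \<le> 1" and r: "r < K"
    and freq: "tendsto_in_prob M (\<lambda>L \<omega>. (1 / real L) * (\<Sum>l<L. of_bool (G (r + l * K) \<omega>))) g"
  shows "vanishes (\<lambda>T. {x. length x = T}) (\<lambda>T. likelihood \<Phi> q) (\<lambda>T x. open_count K r x / real T - g / real K)"
  unfolding vanishes_def
proof (intro allI impI)
  fix \<epsilon> :: real assume \<epsilon>: "\<epsilon> > 0"
  interpret prob_space M using law by (simp add: ded_law_def)
  from law have GY [measurable]: "\<And>t. G t \<in> measurable M (count_space UNIV)"
    by (auto simp: ded_law_def)
  define L where "L T = (T + K - 1 - r) div K" for T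
  define A where "A n \<omega> = (1 / real n) * (\<Sum>l<n. of_bool (G (r + l * K) \<omega>))" for n \<omega>
  have [measurable]: "A n \<in> borel_measurable M" for n unfolding A_def by measurable
  have K: "K > 0" using r by simp
  have A01: "0 \<le> A n \<omega>" "A n \<omega> \<le> 1" for n \<omega>
  proof -
    show "0 \<le> A n \<omega>" unfolding A_def by (intro mult_nonneg_nonneg sum_nonneg) auto
    have "(\<Sum>l<n. of_bool (G (r + l * K) \<omega>) :: real) \<le> (\<Sum>l<n. 1)" by (intro sum_mono) auto
    then show "A n \<omega> \<le> 1" unfolding A_def by (cases "n = 0") (auto simp: divide_simps)
  qed
  have Linf: "filterlim L at_top sequentially"
    unfolding filterlim_at_top
  proof
    fix Z
    show "eventually (\<lambda>T. Z \<le> L T) sequentially"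
    proof (rule eventually_sequentiallyI[of "(Z + 1) * K"])
      fix T assume "(Z + 1) * K \<le> T"
      then have "real (Z + 1) * real K \<le> real T" by (metis of_nat_le_iff of_nat_mult)
      also have "\<dots> \<le> (real (L T) + 1) * real K"
        using phase_count_bounds(2)[OF r, of T] by (simp add: L_def algebra_simps)
      finally show "Z \<le> L T" using K by simp
    qed
  qed
  have "(\<lambda>n. prob {\<omega> \<in> space M. \<bar>A n \<omega> - g\<bar> > \<epsilon> * real K / 2}) \<longlonglongrightarrow> 0"
  proof -
    have "\<epsilon> * real K / 2 > 0" using \<epsilon> K by simp
    then show ?thesis using freq unfolding tendsto_in_prob_def A_def by blast
  qed
  then have lim: "(\<lambda>T. prob {\<omega> \<in> space M. \<bar>A (L T) \<omega> - g\<bar> > \<epsilon> * real K / 2}) \<longlonglongrightarrow> 0"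
    by (rule filterlim_compose[OF _ Linf])
  \<comment> \<open>Makes the boundary term 1 / T smaller than \<epsilon> / 2; the other half of
    \<epsilon>, times K, is the threshold for the frequency itself.\<close>
  have "eventually (\<lambda>T. real T > 2 / \<epsilon>) sequentially"
    using filterlim_real_sequentially unfolding filterlim_at_top_dense by blast
  then have le: "eventually (\<lambda>T. (\<Sum>x\<in>{x \<in> {x. length x = T}. \<bar>open_count K r x / real T - g / real K\<bar> > \<epsilon>}. likelihood \<Phi> q x)
    \<le> prob {\<omega> \<in> space M. \<bar>A (L T) \<omega> - g\<bar> > \<epsilon> * real K / 2}) sequentially"
  proof eventually_elim
    case (elim T)
    have T: "real T > 0" using elim \<epsilon> by (meson divide_pos_pos less_trans zero_less_numeral)
    have "(\<Sum>x\<in>{x \<in> {x. length x = T}. \<bar>open_count K r x / real T - g / real K\<bar> > \<epsilon>}. likelihood \<Phi> q x)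
      = prob {\<omega> \<in> space M. \<bar>open_count K r (trajectory G Y T \<omega>) / real T - g / real K\<bar> > \<epsilon>}"
      using measure_trajectory[where \<Phi>=\<Phi>, OF law gating_measurable q, of "\<lambda>x. \<bar>open_count K r x / real T - g / real K\<bar> > \<epsilon>" T]
      by simp
    also have "\<dots> \<le> prob {\<omega> \<in> space M. \<bar>A (L T) \<omega> - g\<bar> > \<epsilon> * real K / 2}"
    proof (rule finite_measure_mono)
      show "{\<omega> \<in> space M. \<bar>open_count K r (trajectory G Y T \<omega>) / real T - g / real K\<bar> > \<epsilon>} \<subseteq> {\<omega> \<in> space M. \<bar>A (L T) \<omega> - g\<bar> > \<epsilon> * real K / 2}"
      proof safe
        fix \<omega> assume big: "\<bar>open_count K r (trajectory G Y T \<omega>) / real T - g / real K\<bar> > \<epsilon>"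
        have o: "open_count K r (trajectory G Y T \<omega>) = real (L T) * A (L T) \<omega>"
          unfolding open_count_trajectory[OF r] A_def L_def[symmetric] by simp
        have "\<bar>real (L T) * real K - real T\<bar> \<le> real K"
          using phase_count_bounds[OF r, of T] by (simp add: L_def abs_le_iff)
        then have "\<bar>(real (L T) * real K - real T) * A (L T) \<omega>\<bar> \<le> real K * 1"
          unfolding abs_mult using A01[of "L T" \<omega>] by (intro mult_mono) auto
        moreover have "open_count K r (trajectory G Y T \<omega>) / real T - g / real K
          = (A (L T) \<omega> - g) / real K + (real (L T) * real K - real T) * A (L T) \<omega> / (real K * real T)"
          unfolding o using T K by (simp add: field_simps)
        ultimately have "\<epsilon> < \<bar>A (L T) \<omega> - g\<bar> / real K + real K / (real K * real T)"
        proof -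
          assume b: "\<bar>(real (L T) * real K - real T) * A (L T) \<omega>\<bar> \<le> real K * 1"
            and e: "open_count K r (trajectory G Y T \<omega>) / real T - g / real K
              = (A (L T) \<omega> - g) / real K + (real (L T) * real K - real T) * A (L T) \<omega> / (real K * real T)"
          have "\<epsilon> < \<bar>(A (L T) \<omega> - g) / real K\<bar> + \<bar>(real (L T) * real K - real T) * A (L T) \<omega> / (real K * real T)\<bar>"
            using big unfolding e using abs_triangle_ineq order_less_le_trans by blast
          also have "\<dots> = \<bar>A (L T) \<omega> - g\<bar> / real K + \<bar>(real (L T) * real K - real T) * A (L T) \<omega>\<bar> / (real K * real T)"
            by (simp add: abs_divide)
          also have "\<dots> \<le> \<bar>A (L T) \<omega> - g\<bar> / real K + real K / (real K * real T)"
            using b T K by (intro add_left_mono divide_right_mono) auto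
          finally show ?thesis .
        qed
        also have "real K / (real K * real T) < \<epsilon> / 2" using elim T K \<epsilon> by (simp add: field_simps)
        finally show "\<bar>A (L T) \<omega> - g\<bar> > \<epsilon> * real K / 2" using K by (simp add: field_simps)
      qed
    qed measurable
    finally show ?case .
  qed
  show "(\<lambda>T. \<Sum>x\<in>{x \<in> {x. length x = T}. \<bar>open_count K r x / real T - g / real K\<bar> > \<epsilon>}. likelihood \<Phi> q x) \<longlonglongrightarrow> 0"
    by (rule tendsto_sandwich[OF _ le tendsto_const lim]) (intro always_eventually allI sum_nonneg likelihood_nonneg q)
qed

lemma matrix_vector_mult_sum_left:
  fixes M :: "'i \<Rightarrow> real^'d^'e"
  shows "(\<Sum>i\<in>I. M i) *v x = (\<Sum>i\<in>I. M i *v x)"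
  by (induction I rule: infinite_finite_induct) (auto simp: matrix_vector_mult_add_rdistrib)

lemma outer_mult_vector: "outer v *v h = (v \<bullet> h) *\<^sub>R v"
  by (simp add: outer_def matrix_vector_mult_def vec_eq_iff inner_vec_def sum_distrib_left sum_distrib_right ac_simps)

lemma fisher_quad:
  "h \<bullet> (fisher K lam \<theta> \<alpha> *v h) = (\<Sum>r<K. \<alpha> r / real K *
    (exp (- lam r \<theta>) / (1 - exp (- lam r \<theta>))) * (h \<bullet> grad (lam r) \<theta>)\<^sup>2)"
  unfolding fisher_def scaleR_matrix_vector_assoc[symmetric] matrix_vector_mult_sum_left fisher_phase_def outer_mult_vector event_prob_def
  by (simp add: inner_sum_right sum_divide_distrib inner_commute power2_eq_square sum_distrib_left ac_simps)

text \<open>\<open>grad\<close> is a definite description, so the representing vector built from the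
  values of the derivative on a basis must also be shown unique.\<close>

lemma has_derivative_grad:
  fixes f :: "real^'d \<Rightarrow> real"
  assumes "f differentiable (at x)"
  shows "(f has_derivative (\<lambda>h. h \<bullet> grad f x)) (at x)"
proof -
  obtain F where F: "(f has_derivative F) (at x)" using assms by (auto simp: differentiable_def)
  then have lin: "linear F" by (rule has_derivative_linear)
  define g where "g = (\<Sum>b\<in>Basis. F b *\<^sub>R b)"
  have Fg: "F = (\<lambda>h. h \<bullet> g)"
  proof
    fix h
    have "F h = F (\<Sum>b\<in>Basis. (h \<bullet> b) *\<^sub>R b)" by (simp add: euclidean_representation)
    also have "\<dots> = (\<Sum>b\<in>Basis. (h \<bullet> b) * F b)"
      by (simp add: linear_sum[OF lin] linear_scale[OF lin])
    also have "\<dots> = h \<bullet> g" by (simp add: g_def inner_sum_right ac_simps)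
    finally show "F h = h \<bullet> g" .
  qed
  have "grad f x = g"
    unfolding grad_def
  proof (rule the_equality)
    show "GDERIV f x :> g" using F unfolding gderiv_def Fg .
    fix g' assume "GDERIV f x :> g'"
    then have "(f has_derivative (\<lambda>h. h \<bullet> g')) (at x)" by (simp add: gderiv_def)
    then have "(\<lambda>h. h \<bullet> g') = (\<lambda>h. h \<bullet> g)"
      using F unfolding Fg by (rule has_derivative_unique)
    then have "(g' - g) \<bullet> (g' - g) = 0" by (metis inner_diff_right diff_self)
    then show "g' = g" by simp
  qed
  with F Fg show ?thesis by simp
qed

lemma ennreal_mono_tendsto_SUP:
  fixes F :: "real \<Rightarrow> ennreal"
  assumes "mono F"
  shows "(F \<longlongrightarrow> (SUP x. F x)) at_top"
proof (rule order_tendstoI)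
  fix a assume "a < (SUP x. F x)"
  then obtain x where x: "a < F x" by (auto simp: less_SUP_iff)
  show "eventually (\<lambda>y. a < F y) at_top"
    using eventually_ge_at_top[of x] by eventually_elim (rule less_le_trans[OF x monoD[OF assms]])
next
  fix a assume a: "(SUP x. F x) < a"
  show "eventually (\<lambda>y. F y < a) at_top"
    by (intro always_eventually allI le_less_trans[OF SUP_upper a]) simp
qed

section \<open>The model localised at \<theta>0\<close>

text \<open>The parameter-dependent data are reduced to what the expansion at \<theta>0 uses.
  \<open>closed\<close> and \<open>lam_cont\<close> serve the measurability in h of the localised
  rates.\<close>

locale ded_local = gating \<Phi>
  for \<Phi> :: "nat \<Rightarrow> (bool \<times> bool) list \<Rightarrow> real \<Rightarrow> bool" +
  fixes K D :: nat and \<Theta> :: "(real^'d) set" and lam :: "nat \<Rightarrow> real^'d \<Rightarrow> real"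
    and \<gamma> :: "nat \<Rightarrow> real" and P :: "real^'d \<Rightarrow> 'w measure" and G Y :: "nat \<Rightarrow> 'w \<Rightarrow> bool"
    and \<theta>0 :: "real^'d"
  assumes K: "K \<ge> 1"
    and law: "\<And>\<theta>. \<theta> \<in> \<Theta> \<Longrightarrow> ded_law D (\<lambda>t. event_prob lam t \<theta>) \<Phi> (P \<theta>) G Y"
    and periodic: "\<And>t \<theta>. \<theta> \<in> \<Theta> \<Longrightarrow> lam t \<theta> = lam (t mod K) \<theta>"
    and interior: "\<theta>0 \<in> interior \<Theta>"
    and closed: "closed \<Theta>"
    and lam_pos: "\<And>r \<theta>. r < K \<Longrightarrow> \<theta> \<in> \<Theta> \<Longrightarrow> lam r \<theta> > 0"
    and lam_cont: "\<And>r. r < K \<Longrightarrow> continuous_on \<Theta> (lam r)"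
    and lam_diff: "\<And>r. r < K \<Longrightarrow> lam r differentiable (at \<theta>0)"
    and freq: "\<And>r. r < K \<Longrightarrow> tendsto_in_prob (P \<theta>0)
      (\<lambda>L \<omega>. (1 / real L) * (\<Sum>l<L. of_bool (G (r + l * K) \<omega>))) (\<gamma> r)"
    and fisher_pos: "pos_def_matrix (fisher K lam \<theta>0 \<gamma>)"
begin

lemma \<theta>0_in: "\<theta>0 \<in> \<Theta>"
  using interior interior_subset by blast

text \<open>The localized parameter, frozen at \<open>\<theta>0\<close> where the rescaled point leaves \<open>\<Theta>\<close>.\<close>
definition loc :: "nat \<Rightarrow> real^'d \<Rightarrow> real^'d" where
  "loc T h = (if \<theta>0 + (1 / sqrt (real T)) *\<^sub>R h \<in> \<Theta> then \<theta>0 + (1 / sqrt (real T)) *\<^sub>R h else \<theta>0)"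

lemma loc_in: "loc T h \<in> \<Theta>"
  by (simp add: loc_def \<theta>0_in)

lemma loc_0 [simp]: "loc T 0 = \<theta>0"
  by (simp add: loc_def)

definition q0 :: "nat \<Rightarrow> real" where "q0 r = 1 - exp (- lam r \<theta>0)"

lemma q0_bounds: "r < K \<Longrightarrow> 0 < q0 r" "r < K \<Longrightarrow> q0 r < 1"
  using lam_pos[OF _ \<theta>0_in] by (auto simp: q0_def)

definition lik :: "nat \<Rightarrow> real^'d \<Rightarrow> (bool \<times> bool) list \<Rightarrow> real" where
  "lik T h = likelihood \<Phi> (\<lambda>t. 1 - exp (- lam (t mod K) (loc T h)))"

text \<open>Gradient of the log-likelihood at \<theta>0, divided by sqrt T. In
  \<open>log_ratio_eq\<close> the martingale coefficient has derivative 1 / q0 r in the rate, while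
  the coefficient of the open count has derivative 0.\<close>

definition score :: "nat \<Rightarrow> (bool \<times> bool) list \<Rightarrow> real^'d" where
  "score T x = (\<Sum>r<K. (centred_count K (q0 r) r x / sqrt (real T) / q0 r) *\<^sub>R grad (lam r) \<theta>0)"

abbreviation "J \<equiv> fisher K lam \<theta>0 \<gamma>"

text \<open>Defined as the exact difference, so the expansion of the likelihood ratio is an identity
  for all T and h. The analysis goes into \<open>remainder_vanishes\<close>.\<close>

definition remainder :: "nat \<Rightarrow> real^'d \<Rightarrow> (bool \<times> bool) list \<Rightarrow> real" where
  "remainder T h x = log_ratio K (\<lambda>r. lam r (loc T h)) (\<lambda>r. lam r \<theta>0) x - h \<bullet> score T x + (h \<bullet> (J *v h)) / 2"

lemma log_ratio_remainder:
  "log_ratio K (\<lambda>r. lam r (loc T h)) (\<lambda>r. lam r \<theta>0) x = h \<bullet> score T x - (h \<bullet> (J *v h)) / 2 + remainder T h x"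
  by (simp add: remainder_def)

lemma q_bounds: "\<theta> \<in> \<Theta> \<Longrightarrow> 0 \<le> 1 - exp (- lam (t mod K) \<theta>) \<and> 1 - exp (- lam (t mod K) \<theta>) \<le> 1"
  using lam_pos[of "t mod K" \<theta>] K by simp

lemma lik_0: "lik T 0 = likelihood \<Phi> (\<lambda>t. 1 - exp (- lam (t mod K) \<theta>0))"
  by (simp add: lik_def)

lemma lik_nonneg: "0 \<le> lik T h x"
  unfolding lik_def by (intro likelihood_nonneg q_bounds loc_in)

lemma event_prob_periodic: "\<theta> \<in> \<Theta> \<Longrightarrow> (\<lambda>t. event_prob lam t \<theta>) = (\<lambda>t. 1 - exp (- lam (t mod K) \<theta>))"
proof
  fix t assume "\<theta> \<in> \<Theta>"
  then have "lam t \<theta> = lam (t mod K) \<theta>" by (rule periodic)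
  then show "event_prob lam t \<theta> = 1 - exp (- lam (t mod K) \<theta>)" unfolding event_prob_def by (rule arg_cong)
qed

lemma law': "\<theta> \<in> \<Theta> \<Longrightarrow> ded_law D (\<lambda>t. 1 - exp (- lam (t mod K) \<theta>)) \<Phi> (P \<theta>) G Y"
  using law event_prob_periodic by metis

lemma nn_integral_obs_law_loc:
  "(\<integral>\<^sup>+x. F x \<partial>obs_law (P (loc T h)) G Y T) = (\<Sum>x\<in>{x. length x = T}. ennreal (lik T h x) * F x)"
  unfolding lik_def by (rule nn_integral_obs_law[OF law'[OF loc_in] gating_measurable q_bounds[OF loc_in]])

lemma loc_eventually:
  "eventually (\<lambda>T. \<forall>h\<in>cball 0 c. loc T h = \<theta>0 + (1 / sqrt (real T)) *\<^sub>R h) sequentially"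
proof -
  obtain e where e: "e > 0" "ball \<theta>0 e \<subseteq> \<Theta>" using interior mem_interior by blast
  have "(\<lambda>T. \<bar>c\<bar> / sqrt (real T)) \<longlonglongrightarrow> 0" by real_asymp
  from order_tendstoD(2)[OF this e(1)] show ?thesis
  proof eventually_elim
    case (elim T)
    have "\<theta>0 + (1 / sqrt (real T)) *\<^sub>R h \<in> \<Theta>" if "h \<in> cball 0 c" for h
    proof -
      have "norm h / sqrt (real T) \<le> \<bar>c\<bar> / sqrt (real T)"
        using that by (intro divide_right_mono) auto
      then have "\<theta>0 + (1 / sqrt (real T)) *\<^sub>R h \<in> ball \<theta>0 e"
        using elim by (simp add: dist_norm)
      then show ?thesis using e by blast
    qed
    then show ?case by (simp add: loc_def)
  qed
qed

lemma lam_diff_limits: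
  assumes r: "r < K"
  shows "(\<lambda>T. sqrt (real T) * (lam r (loc T h) - lam r \<theta>0)) \<longlonglongrightarrow> h \<bullet> grad (lam r) \<theta>0"
    and "(\<lambda>T. lam r (loc T h) - lam r \<theta>0) \<longlonglongrightarrow> 0"
proof -
  have "((\<lambda>s. lam r (\<theta>0 + s *\<^sub>R h)) has_derivative (\<lambda>s. (s *\<^sub>R h) \<bullet> grad (lam r) \<theta>0)) (at 0)"
  proof (rule has_derivative_compose[where f="\<lambda>s. \<theta>0 + s *\<^sub>R h" and g="lam r"])
    show "((\<lambda>s. \<theta>0 + s *\<^sub>R h) has_derivative (\<lambda>s. s *\<^sub>R h)) (at 0)"
      by (auto intro!: derivative_eq_intros)
    show "(lam r has_derivative (\<lambda>x. x \<bullet> grad (lam r) \<theta>0)) (at (\<theta>0 + 0 *\<^sub>R h))"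
      using has_derivative_grad[OF lam_diff[OF r]] by simp
  qed
  then have "((\<lambda>s. lam r (\<theta>0 + s *\<^sub>R h)) has_real_derivative (h \<bullet> grad (lam r) \<theta>0)) (at 0)"
    by (simp add: has_field_derivative_def mult_commute_abs)
  then have "((\<lambda>s. (lam r (\<theta>0 + s *\<^sub>R h) - lam r \<theta>0) / s) \<longlongrightarrow> h \<bullet> grad (lam r) \<theta>0) (at 0)"
    by (simp add: has_field_derivative_iff)
  moreover have "filterlim (\<lambda>T. 1 / sqrt (real T)) (at 0) sequentially"
    by real_asymp
  ultimately have lim: "(\<lambda>T. (lam r (\<theta>0 + (1 / sqrt (real T)) *\<^sub>R h) - lam r \<theta>0) / (1 / sqrt (real T))) \<longlonglongrightarrow> h \<bullet> grad (lam r) \<theta>0"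
    by (rule filterlim_compose)
  have "eventually (\<lambda>T. (lam r (\<theta>0 + (1 / sqrt (real T)) *\<^sub>R h) - lam r \<theta>0) / (1 / sqrt (real T)) = sqrt (real T) * (lam r (loc T h) - lam r \<theta>0)) sequentially"
    using loc_eventually[of "norm h"] by eventually_elim (auto simp: mult.commute)
  from Lim_transform_eventually[OF lim this]
  show 1: "(\<lambda>T. sqrt (real T) * (lam r (loc T h) - lam r \<theta>0)) \<longlonglongrightarrow> h \<bullet> grad (lam r) \<theta>0" .
  have "(\<lambda>T. 1 / sqrt (real T)) \<longlonglongrightarrow> 0" by real_asymp
  from tendsto_mult[OF this 1]
  have "(\<lambda>T. 1 / sqrt (real T) * (sqrt (real T) * (lam r (loc T h) - lam r \<theta>0))) \<longlonglongrightarrow> 0" by simp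
  moreover have "eventually (\<lambda>T. 1 / sqrt (real T) * (sqrt (real T) * (lam r (loc T h) - lam r \<theta>0)) = lam r (loc T h) - lam r \<theta>0) sequentially"
    using eventually_gt_at_top[of 0] by eventually_elim simp
  ultimately show "(\<lambda>T. lam r (loc T h) - lam r \<theta>0) \<longlonglongrightarrow> 0"
    by (rule Lim_transform_eventually)
qed

definition log_odds :: "nat \<Rightarrow> real \<Rightarrow> real" where
  "log_odds r z = ln ((1 - exp (- (lam r \<theta>0 + z))) / (1 - exp (- lam r \<theta>0)))"

text \<open>The three scalings that the counts need: the martingale coefficient times sqrt T, the
  open-count coefficient times T, and the difference of the no-event probabilities times sqrt T,
  which controls the chi-square divergence.\<close>

lemma log_odds_limits:
  assumes r: "r < K"
  defines "u \<equiv> (\<lambda>h T. lam r (loc T h) - lam r \<theta>0)"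
  shows "(\<lambda>T. sqrt (real T) * (log_odds r (u h T) + u h T)) \<longlonglongrightarrow> (h \<bullet> grad (lam r) \<theta>0) / q0 r"
    and "(\<lambda>T. real T * (q0 r * log_odds r (u h T) - (1 - q0 r) * u h T)) \<longlonglongrightarrow>
      - ((exp (- lam r \<theta>0) / (1 - exp (- lam r \<theta>0))) / 2) * (h \<bullet> grad (lam r) \<theta>0)\<^sup>2"
    and "(\<lambda>T. sqrt (real T) * (exp (- lam r (loc T h)) - exp (- lam r \<theta>0))) \<longlonglongrightarrow>
      - exp (- lam r \<theta>0) * (h \<bullet> grad (lam r) \<theta>0)"
proof -
  let ?l = "lam r \<theta>0"
  have l: "?l > 0" by (rule lam_pos[OF r \<theta>0_in])
  then have pos: "1 - exp (- ?l) > 0" by simp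
  have lim: "(\<lambda>T. sqrt (real T) * u h T) \<longlonglongrightarrow> h \<bullet> grad (lam r) \<theta>0" "u h \<longlonglongrightarrow> 0"
    using lam_diff_limits[OF r, of h] by (simp_all add: u_def)
  have z: "log_odds r 0 = 0" using pos by (simp add: log_odds_def)
  have "((\<lambda>z. (1 - exp (- (?l + z))) / (1 - exp (- ?l))) has_real_derivative exp (- ?l) / (1 - exp (- ?l))) (at 0)"
    using pos by (auto intro!: derivative_eq_intros)
  then have "((\<lambda>z. log_odds r z + z) has_real_derivative 1 / 1 * (exp (- ?l) / (1 - exp (- ?l))) + 1) (at 0)"
    unfolding log_odds_def using pos by (intro DERIV_add DERIV_ident DERIV_chain2[where f=ln]) (auto intro!: DERIV_ln_divide[of 1, simplified])
  moreover have "1 / 1 * (exp (- ?l) / (1 - exp (- ?l))) + 1 = 1 / q0 r"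
    using pos by (simp add: q0_def field_simps)
  ultimately have d1: "((\<lambda>z. log_odds r z + z) has_real_derivative 1 / q0 r) (at 0)"
    by (simp only:)
  have "(\<lambda>T. sqrt (real T) * (\<lambda>z. log_odds r z + z) (u h T)) \<longlonglongrightarrow> 1 / q0 r * (h \<bullet> grad (lam r) \<theta>0)"
    by (rule log_odds_first_order[OF lim d1]) (simp add: z)
  then show "(\<lambda>T. sqrt (real T) * (log_odds r (u h T) + u h T)) \<longlonglongrightarrow> (h \<bullet> grad (lam r) \<theta>0) / q0 r"
    by simp
  have "(\<lambda>T. (sqrt (real T))\<^sup>2 * (\<lambda>z. (1 - exp (- ?l)) * log_odds r z - exp (- ?l) * z) (u h T)) \<longlonglongrightarrow>
    - (exp (- ?l) / (1 - exp (- ?l))) / 2 * (h \<bullet> grad (lam r) \<theta>0)\<^sup>2"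
  proof (rule second_order_limit[OF lim])
    show "((\<lambda>z. ((1 - exp (- ?l)) * log_odds r z - exp (- ?l) * z) / z\<^sup>2) \<longlongrightarrow> - (exp (- ?l) / (1 - exp (- ?l))) / 2) (at 0)"
      unfolding log_odds_def by (rule log_odds_second_order[OF l])
  qed (simp add: z)
  then show "(\<lambda>T. real T * (q0 r * log_odds r (u h T) - (1 - q0 r) * u h T)) \<longlonglongrightarrow>
      - ((exp (- ?l) / (1 - exp (- ?l))) / 2) * (h \<bullet> grad (lam r) \<theta>0)\<^sup>2"
    by (simp add: q0_def)
  have d3: "((\<lambda>z. exp (- (?l + z)) - exp (- ?l)) has_real_derivative - exp (- ?l)) (at 0)"
    by (auto intro!: derivative_eq_intros)
  have "(\<lambda>T. sqrt (real T) * (\<lambda>z. exp (- (?l + z)) - exp (- ?l)) (u h T)) \<longlonglongrightarrow> - exp (- ?l) * (h \<bullet> grad (lam r) \<theta>0)"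
    by (rule log_odds_first_order[OF lim d3]) simp
  then show "(\<lambda>T. sqrt (real T) * (exp (- lam r (loc T h)) - exp (- ?l))) \<longlonglongrightarrow> - exp (- ?l) * (h \<bullet> grad (lam r) \<theta>0)"
    by (simp add: u_def)
qed

lemma centred_moment: "r < K \<Longrightarrow> (\<Sum>x\<in>{x. length x = T}. lik T 0 x * (centred_count K (q0 r) r x / sqrt (real T))\<^sup>2) \<le> 1"
proof -
  assume r: "r < K"
  have "(\<Sum>x\<in>{x. length x = T}. lik T 0 x * (centred_count K (q0 r) r x)\<^sup>2) \<le> real T"
    unfolding lik_0 by (rule centred_count_second_moment) (use q_bounds[OF \<theta>0_in] in \<open>auto simp: q0_def\<close>)
  then have "(\<Sum>x\<in>{x. length x = T}. lik T 0 x * (centred_count K (q0 r) r x)\<^sup>2) / real T \<le> 1"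
    by (cases "T = 0") auto
  then show ?thesis by (simp add: power_divide sum_divide_distrib)
qed

lemma lik_total: "(\<Sum>x\<in>{x. length x = T}. lik T h x) = 1"
  unfolding lik_def by (rule likelihood_total)

sublocale weighted_sets "\<lambda>T. {x :: (bool \<times> bool) list. length x = T}" "\<lambda>T. lik T 0"
  by standard (auto simp: finite_trajectories lik_nonneg)

text \<open>Three kinds of negligible terms per phase: a martingale bounded in mean square times the
  null sequence \<eta>, an open frequency in [0, 1] times the null sequence \<zeta>, and the
  deviation of the open frequency from its limit times a constant.\<close>

lemma remainder_vanishes: "vanishes (\<lambda>T. {x. length x = T}) (\<lambda>T. lik T 0) (\<lambda>T. remainder T h)"
proof (rule vanishes_cong)
  let ?d = "\<lambda>r. h \<bullet> grad (lam r) \<theta>0"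
  let ?f = "\<lambda>r. exp (- lam r \<theta>0) / (1 - exp (- lam r \<theta>0))"
  define u where "u r T = lam r (loc T h) - lam r \<theta>0" for r T
  define \<eta> where "\<eta> r T = sqrt (real T) * (log_odds r (u r T) + u r T) - ?d r / q0 r" for r T
  define \<zeta> where "\<zeta> r T = real T * (q0 r * log_odds r (u r T) - (1 - q0 r) * u r T) + ?f r / 2 * (?d r)\<^sup>2" for r T
  let ?R = "\<lambda>T x. \<Sum>r<K. (centred_count K (q0 r) r x / sqrt (real T)) * \<eta> r T + (open_count K r x / real T) * \<zeta> r T
    + (open_count K r x / real T - \<gamma> r / real K) * (- (?f r / 2 * (?d r)\<^sup>2))"
  show "eventually (\<lambda>T. \<forall>x\<in>{x. length x = T}. remainder T h x = ?R T x) sequentially"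
    using eventually_gt_at_top[of 0]
  proof eventually_elim
    case (elim T)
    show ?case
    proof
      fix x :: "(bool \<times> bool) list"
      have lr: "log_ratio K (\<lambda>r. lam r (loc T h)) (\<lambda>r. lam r \<theta>0) x =
        (\<Sum>r<K. centred_count K (q0 r) r x * (log_odds r (u r T) + u r T) + open_count K r x * (q0 r * log_odds r (u r T) - (1 - q0 r) * u r T))"
        unfolding log_ratio_eq Let_def u_def log_odds_def q0_def by simp
      have sc: "h \<bullet> score T x = (\<Sum>r<K. centred_count K (q0 r) r x / sqrt (real T) * (?d r / q0 r))"
        unfolding score_def by (simp add: inner_sum_right)
      have J: "(h \<bullet> (J *v h)) / 2 = (\<Sum>r<K. \<gamma> r / real K * (?f r / 2 * (?d r)\<^sup>2))"
      proof -
        have "a * F * d / 2 = a * (F / 2 * d)" for a F d :: real by simp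
        then show ?thesis unfolding fisher_quad sum_divide_distrib by (intro sum.cong refl)
      qed
      show "remainder T h x = ?R T x"
        unfolding remainder_def lr sc J sum_subtractf[symmetric] sum.distrib[symmetric]
      proof (intro sum.cong refl)
        fix r
        define S where "S = centred_count K (q0 r) r x"
        define N where "N = open_count K r x"
        define A where "A = log_odds r (u r T) + u r T"
        define B where "B = q0 r * log_odds r (u r T) - (1 - q0 r) * u r T"
        define e where "e = ?d r / q0 r"
        define k where "k = ?f r / 2 * (?d r)\<^sup>2"
        have s: "S / sqrt (real T) * (sqrt (real T) * A) = S * A" "N / real T * (real T * B) = N * B"
          using elim by auto
        have "S * A + N * B - S / sqrt (real T) * e + \<gamma> r / real K * k =
          S / sqrt (real T) * (sqrt (real T) * A - e) + N / real T * (real T * B + k) + (N / real T - \<gamma> r / real K) * (- k)"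
          unfolding right_diff_distrib distrib_left s by (simp add: algebra_simps)
        then show "centred_count K (q0 r) r x * (log_odds r (u r T) + u r T) + open_count K r x * (q0 r * log_odds r (u r T) - (1 - q0 r) * u r T)
          - centred_count K (q0 r) r x / sqrt (real T) * (?d r / q0 r) + \<gamma> r / real K * (?f r / 2 * (?d r)\<^sup>2)
          = (centred_count K (q0 r) r x / sqrt (real T)) * \<eta> r T + (open_count K r x / real T) * \<zeta> r T
            + (open_count K r x / real T - \<gamma> r / real K) * (- (?f r / 2 * (?d r)\<^sup>2))"
          unfolding \<eta>_def \<zeta>_def S_def N_def A_def B_def e_def k_def .
      qed
    qed
  qed
  show "vanishes (\<lambda>T. {x. length x = T}) (\<lambda>T. lik T 0) ?R"
  proof (intro vanishes_sum vanishes_add)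
    fix r assume "r \<in> {..<K}"
    then have r: "r < K" by simp
    have "(\<lambda>T. \<eta> r T) \<longlonglongrightarrow> ?d r / q0 r - ?d r / q0 r"
      unfolding \<eta>_def u_def by (intro tendsto_diff log_odds_limits[OF r] tendsto_const)
    then show "vanishes (\<lambda>T. {x. length x = T}) (\<lambda>T. lik T 0) (\<lambda>T x. (centred_count K (q0 r) r x / sqrt (real T)) * \<eta> r T)"
      using centred_moment[OF r] by (intro vanishes_second_moment[where C=1]) auto
    have "(\<lambda>T. \<zeta> r T) \<longlonglongrightarrow> - (?f r / 2) * (?d r)\<^sup>2 + ?f r / 2 * (?d r)\<^sup>2"
      unfolding \<zeta>_def u_def by (intro tendsto_add log_odds_limits[OF r] tendsto_const)
    then have \<zeta>: "(\<lambda>T. \<zeta> r T) \<longlonglongrightarrow> 0" by simp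
    have "(\<Sum>x\<in>{x. length x = T}. lik T 0 x * (open_count K r x / real T)\<^sup>2) \<le> 1" for T
    proof -
      have "(\<Sum>x\<in>{x. length x = T}. lik T 0 x * (open_count K r x / real T)\<^sup>2) \<le> (\<Sum>x\<in>{x. length x = T}. lik T 0 x * 1)"
      proof (intro sum_mono mult_left_mono lik_nonneg)
        fix x :: "(bool \<times> bool) list" assume "x \<in> {x. length x = T}"
        then have "0 \<le> open_count K r x / real T" "open_count K r x / real T \<le> 1"
          using open_count_bounds[of K r x] by (auto simp: divide_le_eq_1)
        then show "(open_count K r x / real T)\<^sup>2 \<le> 1" by (simp add: power_le_one)
      qed
      then show ?thesis by (simp add: lik_total)
    qed
    then show "vanishes (\<lambda>T. {x. length x = T}) (\<lambda>T. lik T 0) (\<lambda>T x. (open_count K r x / real T) * \<zeta> r T)"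
      by (rule vanishes_second_moment[OF _ \<zeta>])
    show "vanishes (\<lambda>T. {x. length x = T}) (\<lambda>T. lik T 0) (\<lambda>T x. (open_count K r x / real T - \<gamma> r / real K) * (- (?f r / 2 * (?d r)\<^sup>2)))"
      unfolding lik_0
      by (rule weighted_sets.vanishes_mult_const, unfold_locales)
        (auto simp: finite_trajectories intro!: likelihood_nonneg q_bounds \<theta>0_in open_frequency_vanishes[OF law'[OF \<theta>0_in] q_bounds[OF \<theta>0_in] r freq[OF r]])
  qed simp
qed

text \<open>Cauchy-Schwarz over the K phases costs the factor K and spares the covariances between
  phases.\<close>

lemma score_moment:
  "(\<Sum>x\<in>{x. length x = T}. lik T 0 x * (norm (score T x))\<^sup>2) \<le> real K * (\<Sum>r<K. (norm (grad (lam r) \<theta>0) / q0 r)\<^sup>2)"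
proof -
  let ?c = "\<lambda>r. norm (grad (lam r) \<theta>0) / q0 r"
  let ?S = "\<lambda>r x. centred_count K (q0 r) r x / sqrt (real T)"
  have "(norm (score T x))\<^sup>2 \<le> real K * (\<Sum>r<K. (?S r x)\<^sup>2 * (?c r)\<^sup>2)" for x
  proof -
    have "norm (score T x) \<le> (\<Sum>r<K. norm ((?S r x / q0 r) *\<^sub>R grad (lam r) \<theta>0))"
      unfolding score_def by (rule norm_sum)
    also have "\<dots> = (\<Sum>r<K. \<bar>?S r x\<bar> * ?c r)"
      using q0_bounds by (intro sum.cong) (auto simp: abs_divide less_imp_le)
    finally have "(norm (score T x))\<^sup>2 \<le> (\<Sum>r<K. \<bar>?S r x\<bar> * ?c r)\<^sup>2"
      by (rule power_mono) simp
    also have "\<dots> \<le> (\<Sum>r<K. (\<bar>?S r x\<bar> * ?c r)\<^sup>2) * real (card {..<K})"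
      by (rule sum_squared_le_sum_of_squares) 
    also have "\<dots> = real K * (\<Sum>r<K. (?S r x)\<^sup>2 * (?c r)\<^sup>2)"
      by (simp only: power_mult_distrib power2_abs card_lessThan mult.commute)
    finally show ?thesis .
  qed
  then have "(\<Sum>x\<in>{x. length x = T}. lik T 0 x * (norm (score T x))\<^sup>2) \<le> (\<Sum>x\<in>{x. length x = T}. lik T 0 x * (real K * (\<Sum>r<K. (?S r x)\<^sup>2 * (?c r)\<^sup>2)))"
    by (intro sum_mono mult_left_mono lik_nonneg)
  also have "\<dots> = real K * (\<Sum>r<K. (\<Sum>x\<in>{x. length x = T}. lik T 0 x * (?S r x)\<^sup>2) * (?c r)\<^sup>2)"
    by (simp only: sum_distrib_left sum_distrib_right) (subst sum.swap, simp only: ac_simps)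
  also have "\<dots> \<le> real K * (\<Sum>r<K. 1 * (?c r)\<^sup>2)"
    by (intro mult_left_mono sum_mono mult_right_mono centred_moment) auto
  finally show ?thesis by simp
qed

text \<open>The chi-square divergence of one step is of order 1 / T at a localised parameter.
  Summing the divergences of all phases gives one bound valid at every step, and T times this sum
  converges to c.\<close>

lemma ratio_moment_bounded:
  "\<exists>C. eventually (\<lambda>T. (\<Sum>x\<in>{x. length x = T}. lik T 0 x *
    (exp (h \<bullet> score T x - (h \<bullet> (J *v h)) / 2 + remainder T h x))\<^sup>2) \<le> C) sequentially"
proof -
  define v where "v r T = (exp (- lam r (loc T h)) - exp (- lam r \<theta>0))\<^sup>2 / ((1 - exp (- lam r \<theta>0)) * exp (- lam r \<theta>0))" for r T
  have v0: "0 \<le> v r T" if "r < K" for r T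
    unfolding v_def using q0_bounds[OF that] by (simp add: q0_def)
  define c where "c = (\<Sum>r<K. (- exp (- lam r \<theta>0) * (h \<bullet> grad (lam r) \<theta>0))\<^sup>2 / ((1 - exp (- lam r \<theta>0)) * exp (- lam r \<theta>0)))"
  have "(\<lambda>T. \<Sum>r<K. (sqrt (real T) * (exp (- lam r (loc T h)) - exp (- lam r \<theta>0)))\<^sup>2 / ((1 - exp (- lam r \<theta>0)) * exp (- lam r \<theta>0))) \<longlonglongrightarrow> c"
    unfolding c_def
  proof (intro tendsto_sum)
    fix r assume "r \<in> {..<K}"
    then have r: "r < K" by simp
    show "(\<lambda>T. (sqrt (real T) * (exp (- lam r (loc T h)) - exp (- lam r \<theta>0)))\<^sup>2 / ((1 - exp (- lam r \<theta>0)) * exp (- lam r \<theta>0))) \<longlonglongrightarrow>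
      (- exp (- lam r \<theta>0) * (h \<bullet> grad (lam r) \<theta>0))\<^sup>2 / ((1 - exp (- lam r \<theta>0)) * exp (- lam r \<theta>0))"
      using q0_bounds[OF r] by (intro tendsto_divide tendsto_power log_odds_limits(3)[OF r] tendsto_const) (auto simp: q0_def)
  qed
  then have "(\<lambda>T. real T * (\<Sum>r<K. v r T)) \<longlonglongrightarrow> c"
    by (simp add: v_def power_mult_distrib sum_distrib_left)
  then have "eventually (\<lambda>T. real T * (\<Sum>r<K. v r T) < c + 1) sequentially"
    by (rule order_tendstoD(2)) simp
  then have "eventually (\<lambda>T. (\<Sum>x\<in>{x. length x = T}. lik T 0 x *
    (exp (h \<bullet> score T x - (h \<bullet> (J *v h)) / 2 + remainder T h x))\<^sup>2) \<le> exp (c + 1)) sequentially"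
  proof eventually_elim
    case (elim T)
    have "(\<Sum>x\<in>{x. length x = T}. lik T 0 x * (exp (h \<bullet> score T x - (h \<bullet> (J *v h)) / 2 + remainder T h x))\<^sup>2)
      \<le> exp (real T * (\<Sum>r<K. v r T))"
      unfolding log_ratio_remainder[symmetric] lik_0
    proof (rule ratio_second_moment[OF K])
      show "(exp (- lam r (loc T h)) - exp (- lam r \<theta>0))\<^sup>2 / ((1 - exp (- lam r \<theta>0)) * exp (- lam r \<theta>0)) \<le> (\<Sum>r<K. v r T)" if "r < K" for r
        unfolding v_def[symmetric] using that v0 by (intro member_le_sum) auto
      show "0 \<le> (\<Sum>r<K. v r T)" using v0 by (intro sum_nonneg) auto
    qed (use lam_pos loc_in \<theta>0_in in auto)
    also have "\<dots> \<le> exp (c + 1)" using elim by simp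
    finally show ?case .
  qed
  then show ?thesis by blast
qed

text \<open>The rates are known to be continuous only on \<Theta>. Multiplying by the indicator of
  this closed set makes them Borel on the whole space, and nothing changes along \<open>loc\<close>,
  which always stays in \<Theta>.\<close>

lemma remainder_measurable: "(\<lambda>h. remainder T h x) \<in> borel_measurable borel"
proof -
  have lam_meas: "(\<lambda>h. lam r (loc T h)) \<in> borel_measurable borel" if r: "r < K" for r
  proof -
    have "(\<lambda>\<theta>. indicator \<Theta> \<theta> *\<^sub>R lam r \<theta>) \<in> borel_measurable borel"
      using closed lam_cont[OF r] by (intro borel_measurable_continuous_on_indicator) (auto intro: borel_closed)
    moreover have "loc T \<in> borel_measurable borel"
    proof -
      have [measurable]: "\<Theta> \<in> sets borel" using closed by (rule borel_closed)
      have [measurable]: "(\<lambda>h. \<theta>0 + (1 / sqrt (real T)) *\<^sub>R h) \<in> borel_measurable borel" by measurable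
      show ?thesis unfolding loc_def[abs_def] by measurable
    qed
    ultimately have "(\<lambda>h. indicator \<Theta> (loc T h) *\<^sub>R lam r (loc T h)) \<in> borel_measurable borel"
      by (rule measurable_compose[rotated])
    then show ?thesis by (simp add: loc_in)
  qed
  have "(\<lambda>h. log_ratio K (\<lambda>r. lam r (loc T h)) (\<lambda>r. lam r \<theta>0) x) \<in> borel_measurable borel"
    unfolding log_ratio_def
  proof (intro borel_measurable_sum)
    fix r assume "r \<in> {..<K}"
    then have [measurable]: "(\<lambda>h. lam r (loc T h)) \<in> borel_measurable borel" using lam_meas by simp
    show "(\<lambda>h. event_count K r x * ln ((1 - exp (- lam r (loc T h))) / (1 - exp (- lam r \<theta>0)))
      - (open_count K r x - event_count K r x) * (lam r (loc T h) - lam r \<theta>0)) \<in> borel_measurable borel"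
      by measurable
  qed
  then show ?thesis unfolding remainder_def by measurable
qed

sublocale lan_experiment "\<lambda>T. {x :: (bool \<times> bool) list. length x = T}" lik score remainder J
  "real K * (\<Sum>r<K. (norm (grad (lam r) \<theta>0) / q0 r)\<^sup>2)"
proof
  show "lik T h x = lik T 0 x * exp (h \<bullet> score T x - (h \<bullet> (J *v h)) / 2 + remainder T h x)" for T h x
    unfolding log_ratio_remainder[symmetric] lik_0 unfolding lik_def
    by (rule likelihood_log_ratio[OF K]) (auto intro: lam_pos loc_in \<theta>0_in)
  show "(\<lambda>T. \<Sum>x\<in>{x \<in> {x. length x = T}. \<epsilon> < \<bar>remainder T h x\<bar>}. lik T 0 x) \<longlonglongrightarrow> 0" if "\<epsilon> > 0" for h \<epsilon>
    using remainder_vanishes[of h] that by (simp add: vanishes_def)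
qed (use finite_trajectories lik_nonneg lik_total remainder_measurable score_moment ratio_moment_bounded fisher_pos in auto)

section \<open>From the abstract bound to the local maximal risk\<close>

text \<open>Reparametrisation: the rescaled estimate sqrt T * (est - \<theta>0) estimates h = sqrt T
  * (\<theta> - \<theta>0). It holds eventually because \<theta>0 is interior, so that
  \<open>loc\<close> does not freeze any point of the ball of radius c.\<close>

lemma bayes_sup_le_local_max_risk:
  assumes W: "\<And>u. 0 \<le> W u" and b: "b > 0"
  shows "eventually (\<lambda>T. bayes_sup (\<lambda>T x. sqrt (real T) *\<^sub>R (est T x - \<theta>0)) (\<lambda>u. min b (W u)) c T
    \<le> local_max_risk \<Theta> P G Y \<theta>0 est W b c T) sequentially"
  using loc_eventually[of c] eventually_gt_at_top[of 0]
proof eventually_elim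
  case (elim T)
  show ?case
    unfolding bayes_sup_def
  proof (rule SUP_least)
    fix h :: "real^'d" assume h: "h \<in> cball 0 c"
    define \<theta> where "\<theta> = loc T h"
    have \<theta>: "\<theta> = \<theta>0 + (1 / sqrt (real T)) *\<^sub>R h" using elim h by (simp add: \<theta>_def)
    have "norm (\<theta> - \<theta>0) = norm h / sqrt (real T)" by (simp add: \<theta>)
    also have "\<dots> \<le> c / sqrt (real T)" using h by (intro divide_right_mono) auto
    finally have mem: "\<theta> \<in> {\<theta> \<in> \<Theta>. norm (\<theta> - \<theta>0) \<le> c / sqrt (real T)}"
      using loc_in[of T h] by (simp add: \<theta>_def)
    have shift: "sqrt (real T) *\<^sub>R (est T x - \<theta>) = sqrt (real T) *\<^sub>R (est T x - \<theta>0) - h" for x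
      using elim by (simp add: \<theta> algebra_simps)
    have "(\<Sum>x\<in>{x. length x = T}. ennreal (lik T h x * min b (W (sqrt (real T) *\<^sub>R (est T x - \<theta>0) - h))))
      = (\<integral>\<^sup>+x. ennreal (min b (W (sqrt (real T) *\<^sub>R (est T x - \<theta>)))) \<partial>obs_law (P \<theta>) G Y T)"
      unfolding shift unfolding \<theta>_def nn_integral_obs_law_loc using b W by (intro sum.cong refl ennreal_mult lik_nonneg) auto
    also have "\<dots> \<le> local_max_risk \<Theta> P G Y \<theta>0 est W b c T"
      unfolding local_max_risk_def by (rule SUP_upper[OF mem])
    finally show "(\<Sum>x\<in>{x. length x = T}. ennreal (lik T h x * min b (W (sqrt (real T) *\<^sub>R (est T x - \<theta>0) - h))))
      \<le> local_max_risk \<Theta> P G Y \<theta>0 est W b c T" .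
  qed
qed

lemma gaussian_truncated_risk_le:
  assumes W: "bowl_shaped W" and b: "b > 0"
  shows "(\<integral>\<^sup>+z. ennreal (min b (W z)) \<partial>gaussian (matrix_inv J))
    \<le> (SUP c. liminf (local_max_risk \<Theta> P G Y \<theta>0 est W b c))"
proof (rule ennreal_mult_right_le_cancel)
  note [measurable] = bowl_shaped_borel[OF W]
  let ?m = "\<integral>\<^sup>+z. quad_exp J z \<partial>lborel"
  let ?e = "\<lambda>T x. sqrt (real T) *\<^sub>R (est T x - \<theta>0)"
  have m: "?m = ennreal (sqrt ((2 * pi) ^ CARD('d) * det (matrix_inv J)))"
    unfolding quad_exp_def by (rule nn_integral_exp_quadratic(1)[OF fisher_pos])
  show "?m \<noteq> 0" "?m < top"
    unfolding m using nn_integral_exp_quadratic(2)[OF fisher_pos] by auto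
  have "(\<integral>\<^sup>+z. ennreal (min b (W z)) \<partial>gaussian (matrix_inv J)) * ?m = (\<integral>\<^sup>+z. ennreal (min b (W z)) * quad_exp J z \<partial>lborel)"
    unfolding quad_exp_def by (rule nn_integral_gaussian[OF fisher_pos]) measurable
  also have "\<dots> \<le> ?m * (SUP c. liminf (bayes_sup ?e (\<lambda>u. min b (W u)) c))"
    by (rule asymptotic_minimax[OF W b])
  also have "\<dots> \<le> ?m * (SUP c. liminf (local_max_risk \<Theta> P G Y \<theta>0 est W b c))"
    using W b by (intro mult_left_mono SUP_mono' Liminf_mono bayes_sup_le_local_max_risk) (auto simp: bowl_shaped_def)
  finally show "(\<integral>\<^sup>+z. ennreal (min b (W z)) \<partial>gaussian (matrix_inv J)) * ?m
    \<le> (SUP c. liminf (local_max_risk \<Theta> P G Y \<theta>0 est W b c)) * ?m"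
    by (simp only: mult.commute)
qed

lemma local_max_risk_mono:
  assumes "b \<le> b'" "c \<le> c'"
  shows "local_max_risk \<Theta> P G Y \<theta>0 est W b c T \<le> local_max_risk \<Theta> P G Y \<theta>0 est W b' c' T"
  unfolding local_max_risk_def
proof (rule SUP_mono)
  fix \<theta> assume "\<theta> \<in> {\<theta> \<in> \<Theta>. norm (\<theta> - \<theta>0) \<le> c / sqrt (real T)}"
  moreover have "c / sqrt (real T) \<le> c' / sqrt (real T)" using assms by (intro divide_right_mono) auto
  ultimately have "\<theta> \<in> {\<theta> \<in> \<Theta>. norm (\<theta> - \<theta>0) \<le> c' / sqrt (real T)}" by auto
  moreover have "(\<integral>\<^sup>+x. ennreal (min b (W (sqrt (real T) *\<^sub>R (est T x - \<theta>)))) \<partial>obs_law (P \<theta>) G Y T)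
    \<le> (\<integral>\<^sup>+x. ennreal (min b' (W (sqrt (real T) *\<^sub>R (est T x - \<theta>)))) \<partial>obs_law (P \<theta>) G Y T)"
    using assms by (intro nn_integral_mono ennreal_leI) auto
  ultimately show "\<exists>\<theta>'\<in>{\<theta> \<in> \<Theta>. norm (\<theta> - \<theta>0) \<le> c' / sqrt (real T)}.
    (\<integral>\<^sup>+x. ennreal (min b (W (sqrt (real T) *\<^sub>R (est T x - \<theta>)))) \<partial>obs_law (P \<theta>) G Y T)
    \<le> (\<integral>\<^sup>+x. ennreal (min b' (W (sqrt (real T) *\<^sub>R (est T x - \<theta>')))) \<partial>obs_law (P \<theta>') G Y T)" by blast
qed

text \<open>The risk increases in c and in b, so both outer limits exist and are suprema. On the
  Gaussian side W is recovered from its truncations at integer levels by monotone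
  convergence.\<close>

theorem local_asymptotic_minimax:
  assumes W: "bowl_shaped W"
  shows "\<exists>R :: real \<Rightarrow> ennreal. \<exists>v.
    (\<forall>b>0. ((\<lambda>c. liminf (\<lambda>T. local_max_risk \<Theta> P G Y \<theta>0 est W b c T)) \<longlongrightarrow> R b) at_top) \<and>
    (R \<longlongrightarrow> v) at_top \<and> v \<ge> (\<integral>\<^sup>+z. ennreal (W z) \<partial>gaussian (matrix_inv J))"
proof -
  note [measurable] = bowl_shaped_borel[OF W]
  have W0: "0 \<le> W u" for u using W by (simp add: bowl_shaped_def)
  define R where "R b = (SUP c. liminf (local_max_risk \<Theta> P G Y \<theta>0 est W b c))" for b
  have lim_c: "((\<lambda>c. liminf (\<lambda>T. local_max_risk \<Theta> P G Y \<theta>0 est W b c T)) \<longlongrightarrow> R b) at_top" for b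
    unfolding R_def
    by (rule ennreal_mono_tendsto_SUP) (intro monoI Liminf_mono always_eventually allI local_max_risk_mono order_refl)
  have lim_b: "(R \<longlongrightarrow> (SUP b. R b)) at_top"
    unfolding R_def
    by (rule ennreal_mono_tendsto_SUP) (intro monoI SUP_mono' Liminf_mono always_eventually allI local_max_risk_mono order_refl)
  have W_SUP: "ennreal (W z) = (SUP n. ennreal (min (real (Suc n)) (W z)))" for z
  proof (rule antisym)
    obtain n :: nat where "W z \<le> real n" using real_arch_simple by blast
    then show "ennreal (W z) \<le> (SUP n. ennreal (min (real (Suc n)) (W z)))"
      by (intro SUP_upper2[of n]) (auto simp: min_def)
  qed (auto intro!: SUP_least ennreal_leI)
  have "(\<integral>\<^sup>+z. ennreal (W z) \<partial>gaussian (matrix_inv J)) = (SUP n. \<integral>\<^sup>+z. ennreal (min (real (Suc n)) (W z)) \<partial>gaussian (matrix_inv J))"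
    unfolding W_SUP
    by (rule nn_integral_monotone_convergence_SUP)
      (auto simp: incseq_def le_fun_def gaussian_def intro!: ennreal_leI)
  also have "\<dots> \<le> (SUP b. R b)"
  proof (rule SUP_least)
    fix n
    have "(\<integral>\<^sup>+z. ennreal (min (real (Suc n)) (W z)) \<partial>gaussian (matrix_inv J)) \<le> R (real (Suc n))"
      unfolding R_def by (rule gaussian_truncated_risk_le[OF W]) simp
    also have "\<dots> \<le> (SUP b. R b)" by (rule SUP_upper) simp
    finally show "(\<integral>\<^sup>+z. ennreal (min (real (Suc n)) (W z)) \<partial>gaussian (matrix_inv J)) \<le> (SUP b. R b)" .
  qed
  finally show ?thesis using lim_c lim_b by blast
qed

end

lemma bowl_shaped_norm_square: "bowl_shaped (\<lambda>u :: real^'d. (norm u)\<^sup>2)"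
  unfolding bowl_shaped_def
proof (intro conjI allI impI)
  fix a :: real assume a: "0 \<le> a"
  have iff: "(norm u)\<^sup>2 \<le> a \<longleftrightarrow> norm u \<le> sqrt a" for u :: "real^'d"
    using real_sqrt_le_iff[of "(norm u)\<^sup>2" a] by simp
  have eq: "{u :: real^'d. (norm u)\<^sup>2 \<le> a} = cball 0 (sqrt a)"
    by (rule set_eqI) (simp only: mem_Collect_eq mem_cball_0 iff)
  show "closed {u :: real^'d. (norm u)\<^sup>2 \<le> a}" "convex {u :: real^'d. (norm u)\<^sup>2 \<le> a}"
    unfolding eq by auto
qed auto

theorem theorem2:
  fixes K D :: nat
    and \<Theta> :: "(real^'d) set"
    and lam :: "nat \<Rightarrow> real^'d \<Rightarrow> real"
    and \<gamma> :: "real^'d \<Rightarrow> nat \<Rightarrow> real"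
    and P :: "real^'d \<Rightarrow> 'w measure"
    and G Y :: "nat \<Rightarrow> 'w \<Rightarrow> bool"
    and \<theta>0 :: "real^'d"
    and lam_min lam_max :: real
    and W :: "real^'d \<Rightarrow> real"
    and est :: "nat \<Rightarrow> (bool \<times> bool) list \<Rightarrow> real^'d"
  assumes ded: "DED_process K D \<Theta> (event_prob lam) \<gamma> P G Y"
    and periodic: "\<And>t \<theta>. \<theta> \<in> \<Theta> \<Longrightarrow> lam t \<theta> = lam (t mod K) \<theta>"
    and interior: "\<theta>0 \<in> interior \<Theta>"
    and lam_consts: "0 < lam_min" "lam_min \<le> lam_max"
    and lam_bounds: "\<And>r \<theta>. r < K \<Longrightarrow> \<theta> \<in> \<Theta> \<Longrightarrow> lam_min \<le> lam r \<theta> \<and> lam r \<theta> \<le> lam_max"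
    and smooth: "\<And>r. r < K \<Longrightarrow>
      \<exists>V f. open V \<and> \<Theta> \<subseteq> V \<and> Ck_on 3 f V \<and> (\<forall>\<theta>\<in>\<Theta>. f \<theta> = lam r \<theta>)"
    and identifiable: "\<And>\<theta>. \<theta> \<in> \<Theta> \<Longrightarrow> (\<forall>r<K. \<gamma> \<theta>0 r > 0 \<longrightarrow> lam r \<theta> = lam r \<theta>0) \<Longrightarrow> \<theta> = \<theta>0"
    and compact: "compact \<Theta>"
    and pos_def: "pos_def_matrix (fisher K lam \<theta>0 (\<gamma> \<theta>0))"
    and bowl: "bowl_shaped W"
  shows "(\<exists>R :: real \<Rightarrow> ennreal. \<exists>v.
        (\<forall>b>0. ((\<lambda>c. liminf (\<lambda>T. local_max_risk \<Theta> P G Y \<theta>0 est W b c T)) \<longlongrightarrow> R b) at_top) \<and>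
        (R \<longlongrightarrow> v) at_top \<and>
        v \<ge> (\<integral>\<^sup>+ z. ennreal (W z) \<partial>gaussian (matrix_inv (fisher K lam \<theta>0 (\<gamma> \<theta>0)))))
    \<and> (\<exists>R :: real \<Rightarrow> ennreal. \<exists>v.
        (\<forall>b>0. ((\<lambda>c. liminf (\<lambda>T. local_max_risk \<Theta> P G Y \<theta>0 est (\<lambda>u. (norm u)\<^sup>2) b c T)) \<longlongrightarrow> R b) at_top) \<and>
        (R \<longlongrightarrow> v) at_top \<and>
        v \<ge> ennreal (trace (matrix_inv (fisher K lam \<theta>0 (\<gamma> \<theta>0)))))"
proof -
  have \<theta>0: "\<theta>0 \<in> \<Theta>" using interior interior_subset by blast
  obtain \<Phi> where \<Phi>: "\<And>t. (\<lambda>(x, u). \<Phi> t x u) \<in> measurable (trajectory_space t \<Otimes>\<^sub>M restrict_space borel {0..1}) (count_space UNIV)"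
    and laws: "\<And>\<theta>. \<theta> \<in> \<Theta> \<Longrightarrow> ded_law D (\<lambda>t. event_prob lam t \<theta>) \<Phi> (P \<theta>) G Y"
    using ded unfolding DED_process_def by blast
  have "ded_local \<Phi> K D \<Theta> lam (\<gamma> \<theta>0) P G Y \<theta>0"
  proof unfold_locales
    show "K \<ge> 1" using ded by (simp add: DED_process_def)
    show "tendsto_in_prob (P \<theta>0) (\<lambda>L \<omega>. (1 / real L) * (\<Sum>l<L. of_bool (G (r + l * K) \<omega>))) (\<gamma> \<theta>0 r)" if "r < K" for r
      using ded \<theta>0 that unfolding DED_process_def by blast
    show "lam r \<theta> > 0" if "r < K" "\<theta> \<in> \<Theta>" for r \<theta>
      using lam_bounds[OF that] lam_consts by linarith
    show "lam t \<theta> = lam (t mod K) \<theta>" if "\<theta> \<in> \<Theta>" for t \<theta>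
      by (rule periodic[OF that])
    fix r assume "r < K"
    from smooth[OF this] obtain V f where V: "open V" "\<Theta> \<subseteq> V" "Ck_on 3 f V" "\<And>\<theta>. \<theta> \<in> \<Theta> \<Longrightarrow> f \<theta> = lam r \<theta>"
      by blast
    have diff: "f differentiable (at x)" if "x \<in> V" for x
      using V(3) that by (simp add: numeral_3_eq_3)
    then have "continuous_on \<Theta> f"
      using V(2) by (intro continuous_at_imp_continuous_on ballI differentiable_imp_continuous_within) auto
    then show "continuous_on \<Theta> (lam r)" by (rule continuous_on_eq) (rule V(4))
    have "f differentiable (at \<theta>0)" using diff \<theta>0 V(2) by blast
    then obtain F where "(f has_derivative F) (at \<theta>0)" by (auto simp: differentiable_def)
    \<comment> \<open>f and \<open>lam r\<close> agree on \<Theta>, so the derivative is transferred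
      on the open interior, which contains \<theta>0.\<close>
    then have "(lam r has_derivative F) (at \<theta>0)"
      by (rule has_derivative_transform_within_open[OF _ open_interior interior])
        (use V(4) interior_subset in blast)
    then show "lam r differentiable (at \<theta>0)" by (rule differentiableI)
  qed (fact \<Phi> laws interior compact_imp_closed[OF compact] pos_def)+
  then interpret ded_local \<Phi> K D \<Theta> lam "\<gamma> \<theta>0" P G Y \<theta>0 .
  show ?thesis
    using local_asymptotic_minimax[OF bowl, of est]
      local_asymptotic_minimax[OF bowl_shaped_norm_square, of est]
    unfolding nn_integral_gaussian_norm_square[OF pos_def] by (rule conjI)
qed

end
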